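(* Let $\mathcal{X}$ be a simply-connected (rigid) special Kähler manifold with period map $\tau\colon\mathcal{X}\to\mathcal{H}$. Every stable complete geodesic of $\mathcal{X}$ is fully contained in a $\tau$-fiber $\mathcal{X}_{\boldsymbol{\tau}}=\tau^{-1}(\boldsymbol{\tau})$ for some $\boldsymbol{\tau}\in\mathcal{H}$. It is also a geodesic for the induced Kähler metric on $\mathcal{X}_{\boldsymbol{\tau}}$.
   Context: A (rigid, i.e. non-projective) simply-connected special Kähler manifold $\mathcal{X}$ of complex dimension $r$ is a simply-connected complex manifold equipped with holomorphic functions $a^1,\dots,a^r,b_1,\dots,b_r$ (flat symplectic periods) such that $da^1,\dots,da^r$ are linearly independent at every point (so the $a^i$ are local "special coordinates") and $db_i=\sum_j\tau_{ij}\,da^j$ with $(\tau_{ij})$ symmetric with positive-definite imaginary part; locally $b_i=\partial\mathcal{F}/\partial a^i$, $\tau_{ij}=\partial^2\mathcal{F}/\partial a^i\partial a^j$ for a holomorphic prepotential $\mathcal{F}$. It carries the Kähler metric $ds^2=\mathrm{Im}(\tau_{ij})\,da^i\,d\bar a^{\bar j}$, which is not assumed to be complete; no further global (algebraicity) assumption is made. $\mathcal{H}=Sp(2r,\mathbb{R})/U(r)$ is Siegel's upper half-space of complex symmetric $r\times r$ matrices with positive-definite imaginary part, and the period map $\tau\colon\mathcal{X}\to\mathcal{H}$ is the holomorphic map $x\mapsto(\tau_{ij}(x))$. Its fibers $\mathcal{X}_{\boldsymbol{\tau}}=\tau^{-1}(\boldsymbol{\tau})$ are called $\tau$-fibers;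 they are treated as complex submanifolds (as holds for generic $\boldsymbol{\tau}$ in the image), equipped with the Kähler metric induced from $\mathcal{X}$. Geodesics are parametrized by arc-length. A geodesic is complete if it can be extended to a geodesic $\gamma\colon(-\infty,+\infty)\to\mathcal{X}$. A geodesic $\gamma$ is stable between two of its points $p$ and $q$ if the geodesic arc connecting them is locally length-minimizing among all nearby curves joining $p$ and $q$, that is, if the Jacobi operator is positive-definite on the space of normal vector fields along $\gamma$ which vanish at both $p$ and $q$. $\gamma$ is stable if it is stable between all pairs of its points. *)

theory Defs
  imports "HOL-Analysis.Analysis"
begin

text \<open>
  A metric on an open set of a Euclidean space is a field \<open>G z\<close> of inner products.
  For a linear subspace \<open>W\<close>, the metric restricted to \<open>W\<close> has Christoffel symbols with values
  in \<open>W\<close>, determined by the Koszul formula; only derivatives of \<open>G\<close> in directions of \<open>W\<close> enter.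
  \<open>W = UNIV\<close> gives the ordinary Christoffel symbols.
\<close>

definition christoffel ::
    "'v::euclidean_space set \<Rightarrow> ('v \<Rightarrow> 'v \<Rightarrow> 'v \<Rightarrow> real) \<Rightarrow> 'v \<Rightarrow> 'v \<Rightarrow> 'v \<Rightarrow> 'v" where
  "christoffel W G z v w = (THE x. x \<in> W \<and> (\<forall>u\<in>W. G z x u =
      (frechet_derivative (\<lambda>y. G y w u) (at z) v
     + frechet_derivative (\<lambda>y. G y v u) (at z) w
     - frechet_derivative (\<lambda>y. G y v w) (at z) u) / 2))"

text \<open>Sign convention: \<open>R(u,v)w = \<nabla>\<^sub>u\<nabla>\<^sub>v w - \<nabla>\<^sub>v\<nabla>\<^sub>u w - \<nabla>\<^bsub>[u,v]\<^esub> w\<close>.\<close>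

definition curvature ::
    "('v::euclidean_space \<Rightarrow> 'v \<Rightarrow> 'v \<Rightarrow> real) \<Rightarrow> 'v \<Rightarrow> 'v \<Rightarrow> 'v \<Rightarrow> 'v \<Rightarrow> 'v" where
  "curvature G z u v w =
     frechet_derivative (\<lambda>y. christoffel UNIV G y v w) (at z) u
   - frechet_derivative (\<lambda>y. christoffel UNIV G y u w) (at z) v
   + christoffel UNIV G z u (christoffel UNIV G z v w)
   - christoffel UNIV G z v (christoffel UNIV G z u w)"

text \<open>The curve \<open>c\<close> is defined on an open interval, the field \<open>V\<close> along it only on \<open>I\<close>.\<close>

definition covariant_derivative ::
    "('v::euclidean_space \<Rightarrow> 'v \<Rightarrow> 'v \<Rightarrow> real) \<Rightarrow> (real \<Rightarrow> 'v) \<Rightarrow> real set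
      \<Rightarrow> (real \<Rightarrow> 'v) \<Rightarrow> real \<Rightarrow> 'v" where
  "covariant_derivative G c I V t =
     vector_derivative V (at t within I)
   + christoffel UNIV G (c t) (vector_derivative c (at t)) (V t)"

definition jacobi_operator ::
    "('v::euclidean_space \<Rightarrow> 'v \<Rightarrow> 'v \<Rightarrow> real) \<Rightarrow> (real \<Rightarrow> 'v) \<Rightarrow> real set
      \<Rightarrow> (real \<Rightarrow> 'v) \<Rightarrow> real \<Rightarrow> 'v" where
  "jacobi_operator G c I V t =
   - covariant_derivative G c I (covariant_derivative G c I V) t
   - curvature G (c t) (V t) (vector_derivative c (at t)) (vector_derivative c (at t))"

definition unit_speed_geodesic_at ::
    "'v::euclidean_space set \<Rightarrow> ('v \<Rightarrow> 'v \<Rightarrow> 'v \<Rightarrow> real) \<Rightarrow> (real \<Rightarrow> 'v) \<Rightarrow> real \<Rightarrow> bool" where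
  "unit_speed_geodesic_at W G c t \<longleftrightarrow>
     (let c' = (\<lambda>s. vector_derivative c (at s)) in
        c differentiable (at t)
      \<and> G (c t) (c' t) (c' t) = 1
      \<and> (c' has_vector_derivative - christoffel W G (c t) (c' t) (c' t)) (at t))"

definition smooth_on :: "real set \<Rightarrow> (real \<Rightarrow> 'v::real_normed_vector) \<Rightarrow> bool" where
  "smooth_on T f \<longleftrightarrow> (\<exists>D :: nat \<Rightarrow> real \<Rightarrow> 'v. (\<forall>t\<in>T. D 0 t = f t)
     \<and> (\<forall>n. \<forall>t\<in>T. (D n has_vector_derivative D (Suc n) t) (at t within T)))"

definition holomorphic_map :: "(complex^'n \<Rightarrow> complex^'m) \<Rightarrow> (complex^'n) set \<Rightarrow> bool" where
  "holomorphic_map f S \<longleftrightarrow> open S \<and>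
     (\<forall>z\<in>S. \<exists>D. (f has_derivative D) (at z) \<and> (\<forall>c v. D (c *s v) = c *s D v))"

text \<open>A chart is its domain together with its coordinate map, whose values outside the domain
  are irrelevant.\<close>

type_synonym ('x, 'r) chart = "'x set \<times> ('x \<Rightarrow> complex^'r)"

abbreviation chart_dom :: "('x, 'r) chart \<Rightarrow> 'x set" where
  "chart_dom \<kappa> \<equiv> fst \<kappa>"

abbreviation coords :: "('x, 'r) chart \<Rightarrow> 'x \<Rightarrow> complex^'r" where
  "coords \<kappa> \<equiv> snd \<kappa>"

definition param :: "('x, 'r) chart \<Rightarrow> complex^'r \<Rightarrow> 'x" where
  "param \<kappa> = inv_into (chart_dom \<kappa>) (coords \<kappa>)"

definition is_chart :: "('x::topological_space, 'r::finite) chart \<Rightarrow> bool" where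
  "is_chart \<kappa> \<longleftrightarrow> open (chart_dom \<kappa>) \<and> open (coords \<kappa> ` chart_dom \<kappa>)
     \<and> homeomorphism (chart_dom \<kappa>) (coords \<kappa> ` chart_dom \<kappa>) (coords \<kappa>) (param \<kappa>)"

definition compatible :: "('x, 'r::finite) chart \<Rightarrow> ('x, 'r) chart \<Rightarrow> bool" where
  "compatible \<kappa> \<kappa>' \<longleftrightarrow>
     holomorphic_map (coords \<kappa>' \<circ> param \<kappa>) (coords \<kappa> ` (chart_dom \<kappa> \<inter> chart_dom \<kappa>'))
   \<and> holomorphic_map (coords \<kappa> \<circ> param \<kappa>') (coords \<kappa>' ` (chart_dom \<kappa> \<inter> chart_dom \<kappa>'))"

text \<open>The underlying set of the manifold is the whole type \<open>'x\<close>; its complex dimension is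
  \<open>CARD('r)\<close>.\<close>

definition holomorphic_atlas ::
    "('x::{t2_space,second_countable_topology}, 'r::finite) chart set \<Rightarrow> bool" where
  "holomorphic_atlas A \<longleftrightarrow> (\<forall>\<kappa>\<in>A. is_chart \<kappa>) \<and> (\<forall>\<kappa>\<in>A. \<forall>\<kappa>'\<in>A. compatible \<kappa> \<kappa>')
     \<and> (\<Union>\<kappa>\<in>A. chart_dom \<kappa>) = UNIV"

text \<open>The maximal atlas generated by \<open>A\<close>.\<close>

definition charts :: "('x::topological_space, 'r::finite) chart set \<Rightarrow> ('x, 'r) chart set" where
  "charts A = {\<kappa>. is_chart \<kappa> \<and> (\<forall>\<kappa>'\<in>A. compatible \<kappa> \<kappa>')}"

definition charts_at ::
    "('x::topological_space, 'r::finite) chart set \<Rightarrow> 'x \<Rightarrow> ('x, 'r) chart set" where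
  "charts_at A p = {\<kappa> \<in> charts A. p \<in> chart_dom \<kappa>}"

definition holomorphic_function ::
    "('x::topological_space, 'r::finite) chart set \<Rightarrow> ('x \<Rightarrow> complex^'m) \<Rightarrow> bool" where
  "holomorphic_function A f \<longleftrightarrow>
     (\<forall>\<kappa>\<in>charts A. holomorphic_map (f \<circ> param \<kappa>) (coords \<kappa> ` chart_dom \<kappa>))"

text \<open>The differential of \<open>f\<close> at \<open>p\<close>, applied to a tangent vector given by its components in
  the chart \<open>\<kappa>\<close>.\<close>

definition differential ::
    "('x, 'r::finite) chart \<Rightarrow> ('x \<Rightarrow> complex^'m) \<Rightarrow> 'x \<Rightarrow> complex^'r \<Rightarrow> complex^'m" where
  "differential \<kappa> f p = frechet_derivative (f \<circ> param \<kappa>) (at (coords \<kappa> p))"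

text \<open>\<open>slice_chart A S \<kappa> W\<close>: in the coordinates of \<open>\<kappa>\<close> the set \<open>S\<close> is the complex linear
  subspace \<open>W\<close>.\<close>

definition slice_chart ::
    "('x::topological_space, 'r::finite) chart set \<Rightarrow> 'x set \<Rightarrow> ('x, 'r) chart
      \<Rightarrow> (complex^'r) set \<Rightarrow> bool" where
  "slice_chart A S \<kappa> W \<longleftrightarrow> \<kappa> \<in> charts A \<and> vec.subspace W
     \<and> coords \<kappa> ` (chart_dom \<kappa> \<inter> S) = coords \<kappa> ` chart_dom \<kappa> \<inter> W"

definition complex_submanifold ::
    "('x::topological_space, 'r::finite) chart set \<Rightarrow> 'x set \<Rightarrow> bool" where
  "complex_submanifold A S \<longleftrightarrow> (\<forall>p\<in>S. \<exists>\<kappa> W. p \<in> chart_dom \<kappa> \<and> slice_chart A S \<kappa> W)"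

definition siegel :: "(complex^'r^'r) set" where
  "siegel = {Z. transpose Z = Z \<and> (\<forall>x::real^'r. x \<noteq> 0 \<longrightarrow> 0 < x \<bullet> (map_matrix Im Z *v x))}"

record ('x, 'r) special_kaehler_data =
  atlas :: "('x, 'r) chart set"
  a_periods :: "'x \<Rightarrow> complex^'r"
  b_periods :: "'x \<Rightarrow> complex^'r"
  period_map :: "'x \<Rightarrow> complex^'r^'r"

text \<open>The condition \<open>db = \<tau> da\<close> determines the period map from the periods.\<close>

definition special_kaehler ::
    "('x::{t2_space,second_countable_topology}, 'r::finite) special_kaehler_data \<Rightarrow> bool" where
  "special_kaehler X \<longleftrightarrow>
     holomorphic_atlas (atlas X)
   \<and> holomorphic_function (atlas X) (a_periods X)
   \<and> holomorphic_function (atlas X) (b_periods X)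
   \<and> (\<forall>p. period_map X p \<in> siegel)
   \<and> (\<forall>p. \<forall>\<kappa>\<in>charts_at (atlas X) p.
        (\<forall>k. (\<forall>v. (\<Sum>i\<in>UNIV. k i * differential \<kappa> (a_periods X) p v $ i) = 0)
             \<longrightarrow> (\<forall>i. k i = 0))
      \<and> (\<forall>v. differential \<kappa> (b_periods X) p v
             = period_map X p *v differential \<kappa> (a_periods X) p v))"

definition tau_fiber :: "('x, 'r) special_kaehler_data \<Rightarrow> complex^'r^'r \<Rightarrow> 'x set" where
  "tau_fiber X \<tau> = period_map X -` {\<tau>}"

text \<open>The Riemannian metric \<open>Re (\<Sum>i j. Im \<tau>\<^sub>i\<^sub>j da\<^sup>i(v) cnj (da\<^sup>j(w)))\<close> in the coordinates of a chart.\<close>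

definition sk_metric ::
    "('x, 'r::finite) special_kaehler_data \<Rightarrow> ('x, 'r) chart
      \<Rightarrow> complex^'r \<Rightarrow> complex^'r \<Rightarrow> complex^'r \<Rightarrow> real" where
  "sk_metric X \<kappa> z v w =
     (let p = param \<kappa> z; da = differential \<kappa> (a_periods X) p in
      Re (\<Sum>i\<in>UNIV. \<Sum>j\<in>UNIV.
            complex_of_real (Im (period_map X p $ i $ j)) * da v $ i * cnj (da w $ j)))"

text \<open>Geodesics are parametrised by arc length and defined on the whole line, i.e. complete.\<close>

definition complete_geodesic ::
    "('x::topological_space, 'r::finite) special_kaehler_data \<Rightarrow> (real \<Rightarrow> 'x) \<Rightarrow> bool" where
  "complete_geodesic X \<gamma> \<longleftrightarrow> continuous_on UNIV \<gamma>
     \<and> (\<forall>t. \<forall>\<kappa>\<in>charts_at (atlas X) (\<gamma> t).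
          unit_speed_geodesic_at UNIV (sk_metric X \<kappa>) (coords \<kappa> \<circ> \<gamma>) t)"

text \<open>Complete geodesics of a complex submanifold \<open>S\<close> for the metric induced from \<open>X\<close>:
  a slice chart identifies an open part of \<open>S\<close> with an open subset of \<open>W\<close>,
  and the induced metric is the restriction of \<open>sk_metric\<close> to it.\<close>

definition complete_geodesic_of_submanifold ::
    "('x::topological_space, 'r::finite) special_kaehler_data \<Rightarrow> 'x set
      \<Rightarrow> (real \<Rightarrow> 'x) \<Rightarrow> bool" where
  "complete_geodesic_of_submanifold X S \<gamma> \<longleftrightarrow> continuous_on UNIV \<gamma> \<and> range \<gamma> \<subseteq> S
     \<and> (\<forall>t \<kappa> W. slice_chart (atlas X) S \<kappa> W \<and> \<gamma> t \<in> chart_dom \<kappa> \<longrightarrow>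
          unit_speed_geodesic_at W (sk_metric X \<kappa>) (coords \<kappa> \<circ> \<gamma>) t)"

text \<open>A tangent vector at \<open>p\<close> is the family of its components in all charts around \<open>p\<close>, related by
  the Jacobians of the coordinate changes. A vector field along \<open>\<gamma>\<close> is smooth as soon as it is so
  in one chart around each point.\<close>

definition smooth_field_along ::
    "('x::topological_space, 'r::finite) special_kaehler_data \<Rightarrow> (real \<Rightarrow> 'x) \<Rightarrow> real set
      \<Rightarrow> (('x, 'r) chart \<Rightarrow> real \<Rightarrow> complex^'r) \<Rightarrow> bool" where
  "smooth_field_along X \<gamma> I V \<longleftrightarrow>
     (\<forall>t\<in>I. \<forall>\<kappa>\<in>charts_at (atlas X) (\<gamma> t). \<forall>\<kappa>'\<in>charts_at (atlas X) (\<gamma> t).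
        V \<kappa>' t = differential \<kappa> (coords \<kappa>') (\<gamma> t) (V \<kappa> t))
   \<and> (\<forall>t\<in>I. \<exists>\<kappa>\<in>charts_at (atlas X) (\<gamma> t). smooth_on {s\<in>I. \<gamma> s \<in> chart_dom \<kappa>} (V \<kappa>))"

definition normal_field ::
    "('x::topological_space, 'r::finite) special_kaehler_data \<Rightarrow> (real \<Rightarrow> 'x) \<Rightarrow> real set
      \<Rightarrow> (('x, 'r) chart \<Rightarrow> real \<Rightarrow> complex^'r) \<Rightarrow> bool" where
  "normal_field X \<gamma> I V \<longleftrightarrow>
     (\<forall>t\<in>I. \<forall>\<kappa>\<in>charts_at (atlas X) (\<gamma> t).
        sk_metric X \<kappa> (coords \<kappa> (\<gamma> t)) (V \<kappa> t)
          (vector_derivative (coords \<kappa> \<circ> \<gamma>) (at t)) = 0)"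

definition zero_field_at ::
    "('x::topological_space, 'r::finite) special_kaehler_data \<Rightarrow> (real \<Rightarrow> 'x)
      \<Rightarrow> (('x, 'r) chart \<Rightarrow> real \<Rightarrow> complex^'r) \<Rightarrow> real \<Rightarrow> bool" where
  "zero_field_at X \<gamma> V t \<longleftrightarrow> (\<forall>\<kappa>\<in>charts_at (atlas X) (\<gamma> t). V \<kappa> t = 0)"

text \<open>Positivity of the Jacobi operator on the normal fields over \<open>[p, q]\<close> vanishing at both ends.
  The inner product of the Jacobi operator applied to \<open>V\<close> with \<open>V\<close> at time \<open>t\<close> does not depend on
  the chart in which it is computed; \<open>K\<close> is an arbitrary choice of charts along \<open>\<gamma>\<close>.\<close>

definition stable_between ::
    "('x::topological_space, 'r::finite) special_kaehler_data \<Rightarrow> (real \<Rightarrow> 'x)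
      \<Rightarrow> real \<Rightarrow> real \<Rightarrow> bool" where
  "stable_between X \<gamma> p q \<longleftrightarrow>
     (\<forall>V K. smooth_field_along X \<gamma> {p..q} V \<and> normal_field X \<gamma> {p..q} V
        \<and> zero_field_at X \<gamma> V p \<and> zero_field_at X \<gamma> V q
        \<and> (\<exists>t\<in>{p..q}. \<not> zero_field_at X \<gamma> V t)
        \<and> (\<forall>t\<in>{p..q}. K t \<in> charts_at (atlas X) (\<gamma> t))
       \<longrightarrow> 0 < integral {p..q} (\<lambda>t.
             sk_metric X (K t) (coords (K t) (\<gamma> t))
               (jacobi_operator (sk_metric X (K t)) (coords (K t) \<circ> \<gamma>) {p..q} (V (K t)) t)
               (V (K t) t)))"

definition stable_geodesic ::
    "('x::topological_space, 'r::finite) special_kaehler_data \<Rightarrow> (real \<Rightarrow> 'x) \<Rightarrow> bool" where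
  "stable_geodesic X \<gamma> \<longleftrightarrow> (\<forall>p q. p < q \<longrightarrow> stable_between X \<gamma> p q)"

end

theory Submission
  imports Defs "HOL-Complex_Analysis.Cauchy_Integral_Formula"
begin

text \<open>
  In the special coordinates \<open>a\<^sup>i\<close> write \<open>Y = Im \<tau>\<close> and \<open>T(v) = d\<tau>(v)\<close>; since \<open>\<tau>\<close> is the second
  derivative of a prepotential, \<open>T(v) w\<close> is symmetric in \<open>v\<close> and \<open>w\<close>. The Christoffel form is
  \<open>\<Gamma>(v,w) = Y\<^sup>-\<^sup>1 T(v) w / (2\<i>)\<close>, and the curvature satisfies
  \<open>\<langle>R(V,c)c, V\<rangle> = (|T(c) V|\<^sup>2 - Re \<langle>T(c) c, T(V) V\<rangle>) / 4\<close>, where the norm and the pairing on the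
  right are those of \<open>Y\<^sup>-\<^sup>1\<close>. If \<open>E\<close> is a parallel field along the geodesic \<open>\<gamma>\<close>, normal to it, and
  \<open>V = f E\<close> with \<open>f(t) = L\<^sup>2 - (t - t\<^sub>0)\<^sup>2\<close>, then the second variation in direction \<open>V\<close> is
  \<open>\<integral> 2 f |E|\<^sup>2 - f\<^sup>2 \<langle>R(E,\<gamma>')\<gamma>', E\<rangle>\<close>, which is negative for large \<open>L\<close> if the curvature term is
  nonnegative along \<open>\<gamma>\<close> and positive at \<open>t\<^sub>0\<close>. For \<open>E = \<i> \<gamma>'\<close> the curvature term is
  \<open>|T(\<gamma>') \<gamma>'|\<^sup>2 / 2\<close>, so stability forces \<open>T(\<gamma>') \<gamma>' = 0\<close>. After that the curvature term is
  \<open>|T(\<gamma>') E|\<^sup>2 / 4\<close> for every \<open>E\<close>, so \<open>T(\<gamma>') = 0\<close> and \<open>\<tau>\<close> is constant along \<open>\<gamma>\<close>.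
  A geodesic lying in a submanifold is a geodesic of it.
\<close>

section \<open>Holomorphic functions of several variables\<close>

text \<open>The pairing Re \<langle>T(c) c, T(V) V\<rangle> has no sign, so an arbitrary normal V is
  of no use at first. The pairing turns with the phase of V: at V = c it cancels the square, at V =
  \<i> c it doubles it. The direction \<i> \<gamma>' is admissible because \<Gamma> is
  complex-linear, which makes it parallel, and the form is Hermitian, which makes it normal. Once
  T(\<gamma>') \<gamma>' = 0, the pairing is gone for every V. Completeness enters through L: the
  window where the curvature term is known to be positive stays fixed, and only growing L lets it
  win. The quadratic f is smooth at once and -f'' is the constant 2, so the Jacobi operator is
  evaluated directly, without integration by parts. The obstacle is regularity. Holomorphy is given
  as complex differentiability, \<tau> only through db = \<tau> da, and a geodesic only up to its
  second derivative, whereas stability is tested on smooth fields. Hence the need for Cauchy's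
  formula, for the a^i as charts, and for smoothness of the velocity and of parallel fields.\<close>

definition scalar_holomorphic_on :: "(complex^'n \<Rightarrow> complex) \<Rightarrow> (complex^'n) set \<Rightarrow> bool" where
  "scalar_holomorphic_on f S \<longleftrightarrow> open S \<and>
     (\<forall>z\<in>S. \<exists>D. (f has_derivative D) (at z) \<and> (\<forall>c v. D (c *s v) = c * D v))"

lemma bounded_linear_vector_scalar_mult: "bounded_linear (\<lambda>c::complex. c *s (v::complex^'n))"
  unfolding linear_conv_bounded_linear [symmetric]
  by (rule linearI) (auto simp: vec_eq_iff algebra_simps)

lemma bounded_linear_vector_scalar_mult_right: "bounded_linear (\<lambda>v. (c::complex) *s (v::complex^'n))"
  unfolding linear_conv_bounded_linear [symmetric]
  by (rule linearI) (auto simp: vec_eq_iff algebra_simps)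

lemma norm_vector_scalar_mult: "norm (c *s (v::complex^'n)) = norm c * norm v"
  unfolding norm_vec_def by (simp add: norm_mult L2_set_right_distrib)

lemma scalar_holomorphic_on_derivative:
  assumes "scalar_holomorphic_on f S" "z \<in> S"
  shows "(f has_derivative frechet_derivative f (at z)) (at z)"
    and "frechet_derivative f (at z) (c *s v) = c * frechet_derivative f (at z) v"
proof -
  obtain D where D: "(f has_derivative D) (at z)" "\<And>c v. D (c *s v) = c * D v"
    using assms unfolding scalar_holomorphic_on_def by blast
  have "D = frechet_derivative f (at z)"
    using D(1) by (rule frechet_derivative_at)
  with D show "(f has_derivative frechet_derivative f (at z)) (at z)"
    and "frechet_derivative f (at z) (c *s v) = c * frechet_derivative f (at z) v"
    by auto
qed

lemma scalar_holomorphic_on_continuous: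
  assumes "scalar_holomorphic_on f S" shows "continuous_on S f"
  by (meson assms continuous_at_imp_continuous_on has_derivative_continuous
      scalar_holomorphic_on_derivative(1))

text \<open>Restriction to a complex line makes one-variable Cauchy theory available; complex
  linearity turns the real derivative along the line into a complex one.\<close>

lemma has_field_derivative_along_line:
  assumes "scalar_holomorphic_on f S" "z + l *s v \<in> S"
  shows "((\<lambda>l. f (z + l *s v)) has_field_derivative frechet_derivative f (at (z + l *s v)) v) (at l)"
proof -
  have "((\<lambda>l. z + l *s v) has_derivative (\<lambda>h. h *s v)) (at l)"
    by (auto intro!: derivative_eq_intros
        bounded_linear.has_derivative [OF bounded_linear_vector_scalar_mult])
  then have "((\<lambda>l. f (z + l *s v)) has_derivative
      (\<lambda>h. frechet_derivative f (at (z + l *s v)) (h *s v))) (at l)"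
    by (rule has_derivative_compose) (rule scalar_holomorphic_on_derivative(1) [OF assms])
  then show ?thesis
    unfolding has_field_derivative_def
    by (rule has_derivative_eq_rhs) (simp add: scalar_holomorphic_on_derivative(2) [OF assms] fun_eq_iff)
qed

section \<open>Cauchy's formula along complex lines and its consequences\<close>

definition circle_point :: "real \<Rightarrow> real \<Rightarrow> complex" where
  "circle_point r t = r * exp (2 * pi * \<i> * of_real t)"

lemma norm_circle_point: "0 < r \<Longrightarrow> norm (circle_point r t) = r"
  by (simp add: circle_point_def norm_mult)

lemma circle_point_nonzero: "0 < r \<Longrightarrow> circle_point r t \<noteq> 0"
  by (simp add: circle_point_def)

lemma continuous_on_circle_point [continuous_intros]:
  "continuous_on A g \<Longrightarrow> continuous_on A (\<lambda>x. circle_point r (g x))"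
  unfolding circle_point_def by (intro continuous_intros)

text \<open>Cauchy's formula for the first derivative at the centre of a circle in the line through
  \<open>z\<close> in direction \<open>v\<close>. The speed of the circle cancels the factor 1/(2
  \<pi> \<i>) and one of the two powers in the denominator.\<close>

lemma directional_derivative_integral:
  assumes f: "scalar_holomorphic_on f S" and "0 < r"
    and disc: "\<And>l. norm l \<le> r \<Longrightarrow> z + l *s v \<in> S"
  shows "((\<lambda>t. f (z + circle_point r t *s v) / circle_point r t)
     has_integral frechet_derivative f (at z) v) {0..1}"
proof -
  let ?g = "\<lambda>l. f (z + l *s v)"
  have der: "(?g has_field_derivative frechet_derivative f (at (z + l *s v)) v) (at l)"
    if "norm l \<le> r" for l
    using has_field_derivative_along_line [OF f disc [OF that]] .
  have cont: "continuous_on (cball 0 r) ?g"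
    using der by (intro DERIV_continuous_on) (auto intro: DERIV_subset)
  have holo: "?g holomorphic_on ball 0 r"
    by (rule holomorphic_onI) (metis DERIV_subset der field_differentiable_def dist_0_norm less_imp_le mem_ball subset_UNIV)
  have 0: "(0::complex) \<in> ball 0 r" using \<open>0 < r\<close> by simp
  have int: "(\<lambda>u. ?g u / (u - 0)^2) contour_integrable_on circlepath 0 r"
    by (rule Cauchy_derivative_integral_circlepath(1) [OF cont holo 0])
  have c: "(?g has_field_derivative (1 / (2 * of_real pi * \<i>) *
      contour_integral (circlepath 0 r) (\<lambda>u. ?g u / (u - 0)^2))) (at 0)"
    by (rule Cauchy_derivative_integral_circlepath(2) [OF cont holo 0])
  have "(?g has_field_derivative frechet_derivative f (at z) v) (at 0)"
    using der [of 0] \<open>0 < r\<close> by simp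
  from DERIV_unique [OF this c] have eq: "frechet_derivative f (at z) v = 1 / (2 * of_real pi * \<i>) *
      contour_integral (circlepath 0 r) (\<lambda>u. ?g u / (u - 0)^2)"
    .
  have "((\<lambda>u. ?g u / (u - 0)^2) has_contour_integral
      contour_integral (circlepath 0 r) (\<lambda>u. ?g u / (u - 0)^2)) (circlepath 0 r)"
    by (rule has_contour_integral_integral [OF int])
  then have "((\<lambda>t. 1 / (2 * of_real pi * \<i>) * (?g (circlepath 0 r t) / (circlepath 0 r t - 0)^2 *
      vector_derivative (circlepath 0 r) (at t))) has_integral frechet_derivative f (at z) v) {0..1}"
    unfolding has_contour_integral eq by (rule has_integral_mult_right)
  moreover have "1 / (2 * of_real pi * \<i>) * (?g (circlepath 0 r t) / (circlepath 0 r t - 0)^2 *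
      vector_derivative (circlepath 0 r) (at t)) =
      f (z + circle_point r t *s v) / circle_point r t" for t
  proof -
    have "circlepath 0 r t = circle_point r t"
      by (simp add: circlepath circle_point_def mult_ac)
    moreover have "vector_derivative (circlepath 0 r) (at t) = 2 * of_real pi * \<i> * circle_point r t"
      unfolding vector_derivative_circlepath by (simp add: circle_point_def mult_ac)
    ultimately show ?thesis
      using circle_point_nonzero [OF \<open>0 < r\<close>] by (simp add: field_simps power2_eq_square)
  qed
  ultimately show ?thesis by simp
qed

lemma continuous_on_circle_shift:
  fixes z0 v :: "complex^'n"
  assumes "continuous_on S g" "\<And>z t. z \<in> U \<Longrightarrow> z + circle_point r t *s v \<in> S"
  shows "continuous_on (U \<times> cbox 0 1) (\<lambda>(z, t::real). g (z + circle_point r t *s v))"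
  unfolding split_beta
  by (rule continuous_on_compose2 [OF assms(1)])
    (auto intro!: continuous_intros assms(2)
      bounded_linear.continuous_on [OF bounded_linear_vector_scalar_mult])

text \<open>One radius must serve all centres near \<open>z0\<close>, so that Cauchy's formula
  becomes an integral depending on a parameter. Half of the room \<open>e\<close> goes to the centre
  and half to the circle.\<close>

lemma circle_radius:
  fixes v :: "complex^'n"
  assumes "open S" "z0 \<in> S"
  obtains R r :: real where "0 < R" "0 < r" "ball z0 R \<subseteq> S"
    "\<And>z l. z \<in> ball z0 R \<Longrightarrow> norm l \<le> r \<Longrightarrow> z + l *s v \<in> S"
proof -
  obtain e where e: "0 < e" "ball z0 e \<subseteq> S"
    using assms openE by blast
  \<comment> \<open>The summand 1 keeps the radius positive when \<open>v = 0\<close>.\<close>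
  define r where "r = e / 2 / (norm v + 1)"
  have r: "0 < r" "r * norm v \<le> e / 2"
    using e(1) by (auto simp: r_def field_simps add_pos_nonneg)
  have "z + l *s v \<in> S" if "z \<in> ball z0 (e/2)" "norm l \<le> r" for z l
  proof -
    have "norm (l *s v) \<le> e / 2"
      unfolding norm_vector_scalar_mult using that(2) r(2)
      by (meson mult_right_mono norm_ge_zero order_trans)
    then have "dist z0 (z + l *s v) < e"
      using that(1) by (simp add: dist_norm) (smt (verit) diff_diff_eq norm_triangle_ineq4)
    then show ?thesis using e(2) by auto
  qed
  moreover have "ball z0 (e/2) \<subseteq> S"
    using e by auto
  ultimately show ?thesis using that [of "e/2" r] e(1) r(1) by simp
qed

text \<open>Continuity of the derivative is no part of the definition of holomorphy; it comes from
  the continuous dependence of the Cauchy integral on its centre.\<close>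

lemma continuous_on_directional_derivative:
  assumes f: "scalar_holomorphic_on f S"
  shows "continuous_on S (\<lambda>z. frechet_derivative f (at z) v)"
proof (rule continuous_at_imp_continuous_on, rule ballI)
  fix z0 assume "z0 \<in> S"
  have "open S" using f by (simp add: scalar_holomorphic_on_def)
  with \<open>z0 \<in> S\<close> obtain R r :: real where R: "0 < R" "0 < r" "ball z0 R \<subseteq> S"
    "\<And>z l. z \<in> ball z0 R \<Longrightarrow> norm l \<le> r \<Longrightarrow> z + l *s v \<in> S"
    using circle_radius by blast
  have n: "norm (circle_point r t) = r" for t
    using R(2) by (rule norm_circle_point)
  have cont: "continuous_on (ball z0 R \<times> cbox 0 1) (\<lambda>(z, t). f (z + circle_point r t *s v) / circle_point r t)"
    using continuous_on_circle_shift [OF scalar_holomorphic_on_continuous [OF f], of "ball z0 R" r v] R n circle_point_nonzero [OF R(2)]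
    unfolding split_beta by (auto intro!: continuous_intros)
  have "continuous_on (ball z0 R) (\<lambda>z. integral (cbox 0 1) (\<lambda>t. f (z + circle_point r t *s v) / circle_point r t))"
    by (rule integral_continuous_on_param) (rule cont)
  moreover have "integral (cbox 0 1) (\<lambda>t. f (z + circle_point r t *s v) / circle_point r t) = frechet_derivative f (at z) v"
    if "z \<in> ball z0 R" for z
    using directional_derivative_integral [OF f R(2) R(4) [OF that]]
    by (simp add: integral_unique)
  ultimately have "continuous_on (ball z0 R) (\<lambda>z. frechet_derivative f (at z) v)"
    by (simp only: cbox_interval cong: continuous_on_cong)
  then show "continuous (at z0) (\<lambda>z. frechet_derivative f (at z) v)"
    using R(1) by (simp add: continuous_on_eq_continuous_at)
qed

text \<open>Differentiation under the integral sign asks for continuity of the derivative as an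
  operator. In finite dimension, continuity on each basis vector suffices.\<close>

lemma continuous_on_blinfun_derivative:
  assumes f: "scalar_holomorphic_on f S"
  shows "continuous_on S (\<lambda>z. Blinfun (frechet_derivative f (at z)))"
proof (rule continuous_on_blinfun_componentwise)
  fix i :: "complex^'a" assume "i \<in> Basis"
  have "blinfun_apply (Blinfun (frechet_derivative f (at z))) i = frechet_derivative f (at z) i"
    if "z \<in> S" for z
    using scalar_holomorphic_on_derivative(1) [OF f that]
    by (simp add: bounded_linear_Blinfun_apply has_derivative_bounded_linear)
  then show "continuous_on S (\<lambda>z. blinfun_apply (Blinfun (frechet_derivative f (at z))) i)"
    using continuous_on_directional_derivative [OF f] by (simp cong: continuous_on_cong)
qed

text \<open>Differentiating Cauchy's formula for the derivative in direction \<open>v\<close> under the integral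
  sign gives Cauchy's formula for the derivative in direction \<open>v\<close> of the derivative in
  direction \<open>w\<close>.\<close>

lemma directional_derivative_has_derivative:
  assumes f: "scalar_holomorphic_on f S" and "z0 \<in> S"
  obtains D where "((\<lambda>z. frechet_derivative f (at z) v) has_derivative D) (at z0)"
    "\<And>c w. D (c *s w) = c * D w"
    "\<And>w. scalar_holomorphic_on (\<lambda>z. frechet_derivative f (at z) w) S \<Longrightarrow>
        D w = frechet_derivative (\<lambda>z. frechet_derivative f (at z) w) (at z0) v"
proof -
  have "open S" using f by (simp add: scalar_holomorphic_on_def)
  with \<open>z0 \<in> S\<close> obtain R r :: real where R: "0 < R" "0 < r" "ball z0 R \<subseteq> S"
    "\<And>z l. z \<in> ball z0 R \<Longrightarrow> norm l \<le> r \<Longrightarrow> z + l *s v \<in> S"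
    using circle_radius by blast
  let ?B = "\<lambda>z. Blinfun (frechet_derivative f (at z))"
  let ?D = "\<lambda>z t. blinfun_mult_right (inverse (circle_point r t)) o\<^sub>L ?B (z + circle_point r t *s v)"
  have n: "norm (circle_point r t) = r" for t
    using R(2) by (rule norm_circle_point)
  have inS: "z + circle_point r t *s v \<in> S" if "z \<in> ball z0 R" for z t
    using R(4) [OF that] n by simp
  have B: "blinfun_apply (?B z) = frechet_derivative f (at z)" if "z \<in> S" for z
    using scalar_holomorphic_on_derivative(1) [OF f that]
    by (simp add: bounded_linear_Blinfun_apply has_derivative_bounded_linear)
  have D: "blinfun_apply (?D z t) w = frechet_derivative f (at (z + circle_point r t *s v)) w / circle_point r t"
    if "z \<in> ball z0 R" for z t w
    using B [OF inS [OF that]] by (simp add: field_simps)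
  have cont: "continuous_on (ball z0 R \<times> cbox 0 1) (\<lambda>(z, t). ?D z t)"
    using continuous_on_circle_shift [OF continuous_on_blinfun_derivative [OF f], of "ball z0 R" r v] R n circle_point_nonzero [OF R(2)]
    unfolding split_beta
    by (auto intro!: continuous_intros bounded_linear.continuous_on [OF bounded_linear_blinfun_mult_right])
  have der: "((\<lambda>z. f (z + circle_point r t *s v) / circle_point r t) has_derivative blinfun_apply (?D z t))
      (at z within ball z0 R)" if "z \<in> ball z0 R" for z t
  proof -
    have "((\<lambda>z. f (z + circle_point r t *s v)) has_derivative frechet_derivative f (at (z + circle_point r t *s v))) (at z)"
    proof (rule has_derivative_compose [where f' = "\<lambda>h. h" and f = "\<lambda>z. z + circle_point r t *s v"])
      show "(f has_derivative frechet_derivative f (at (z + circle_point r t *s v)))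
          (at (z + circle_point r t *s v))"
        by (rule scalar_holomorphic_on_derivative(1) [OF f inS [OF that]])
    qed (auto intro!: derivative_eq_intros)
    then have "((\<lambda>z. inverse (circle_point r t) * f (z + circle_point r t *s v)) has_derivative
       (\<lambda>h. inverse (circle_point r t) * frechet_derivative f (at (z + circle_point r t *s v)) h)) (at z)"
      by (auto intro!: derivative_eq_intros)
    then have "((\<lambda>z. f (z + circle_point r t *s v) / circle_point r t) has_derivative blinfun_apply (?D z t)) (at z)"
      unfolding D [OF that, abs_def] by (simp add: field_simps)
    then show ?thesis by (rule has_derivative_at_withinI)
  qed
  have z0: "z0 \<in> ball z0 R" using R(1) by simp
  have "((\<lambda>z. integral (cbox 0 1) (\<lambda>t. f (z + circle_point r t *s v) / circle_point r t)) has_derivative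
      integral (cbox 0 1) (?D z0)) (at z0 within ball z0 R)"
  proof (rule leibniz_rule [where fx = ?D])
    show "(\<lambda>t. f (z + circle_point r t *s v) / circle_point r t) integrable_on cbox 0 1" if "z \<in> ball z0 R" for z
      using directional_derivative_integral [OF f R(2) R(4) [OF that]] by auto
  qed (use der cont R in auto)
  then have "((\<lambda>z. integral (cbox 0 1) (\<lambda>t. f (z + circle_point r t *s v) / circle_point r t)) has_derivative
      integral (cbox 0 1) (?D z0)) (at z0)"
    using at_within_open [OF z0] by simp
  then have der_int: "((\<lambda>z. frechet_derivative f (at z) v) has_derivative
      integral (cbox 0 1) (?D z0)) (at z0)"
  proof (rule has_derivative_transform_within_open [OF _ open_ball z0])
    show "integral (cbox 0 1) (\<lambda>t. f (z + circle_point r t *s v) / circle_point r t) = frechet_derivative f (at z) v"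
      if "z \<in> ball z0 R" for z
      using directional_derivative_integral [OF f R(2) R(4) [OF that]] by (simp add: integral_unique)
  qed
  have "?D z0 integrable_on cbox 0 1"
  proof (rule integrable_continuous)
    have "continuous_on (cbox 0 1) ((\<lambda>(z, t). ?D z t) \<circ> (\<lambda>t. (z0, t)))"
      by (rule continuous_on_compose)
        (auto intro!: continuous_intros continuous_on_subset [OF cont] simp: z0 R(1))
    then show "continuous_on (cbox 0 1) (?D z0)" by (simp add: o_def)
  qed
  then have app: "((\<lambda>t. frechet_derivative f (at (z0 + circle_point r t *s v)) w / circle_point r t) has_integral
      blinfun_apply (integral (cbox 0 1) (?D z0)) w) (cbox 0 1)" for w
    using has_integral_linear [OF integrable_integral blinfun.bounded_linear_left, of "?D z0" "cbox 0 1" w]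
    by (simp add: o_def D [OF z0] del: blinfun_apply_blinfun_compose)
  show ?thesis
  proof (rule that [OF der_int])
    fix c w
    have "((\<lambda>t. c * (frechet_derivative f (at (z0 + circle_point r t *s v)) w / circle_point r t)) has_integral
       c * blinfun_apply (integral (cbox 0 1) (?D z0)) w) (cbox 0 1)"
      by (rule has_integral_mult_right [OF app])
    moreover have "c * (frechet_derivative f (at (z0 + circle_point r t *s v)) w / circle_point r t) =
        frechet_derivative f (at (z0 + circle_point r t *s v)) (c *s w) / circle_point r t" for t
      using scalar_holomorphic_on_derivative(2) [OF f inS [OF z0]] by simp
    ultimately show "blinfun_apply (integral (cbox 0 1) (?D z0)) (c *s w) =
        c * blinfun_apply (integral (cbox 0 1) (?D z0)) w"
      using app [of "c *s w"] by (metis (no_types, lifting) has_integral_eq has_integral_unique)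
  next
    fix w assume "scalar_holomorphic_on (\<lambda>z. frechet_derivative f (at z) w) S"
    from directional_derivative_integral [OF this R(2) R(4) [OF z0]]
    show "blinfun_apply (integral (cbox 0 1) (?D z0)) w =
        frechet_derivative (\<lambda>z. frechet_derivative f (at z) w) (at z0) v"
      using app [of w] by (simp add: has_integral_unique)
  qed
qed

lemma scalar_holomorphic_on_directional_derivative:
  assumes "scalar_holomorphic_on f S"
  shows "scalar_holomorphic_on (\<lambda>z. frechet_derivative f (at z) v) S"
  using directional_derivative_has_derivative [OF assms] assms
  unfolding scalar_holomorphic_on_def by metis

text \<open>The operator \<open>D\<close> of \<open>directional_derivative_has_derivative\<close> is
  the derivative of the \<open>v\<close>-derivative, and its third property says that
  \<open>D w\<close> is also the \<open>v\<close>-derivative of the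
  \<open>w\<close>-derivative.\<close>

lemma second_directional_derivative_commute:
  assumes "scalar_holomorphic_on f S" "z \<in> S"
  shows "frechet_derivative (\<lambda>z. frechet_derivative f (at z) v) (at z) w =
         frechet_derivative (\<lambda>z. frechet_derivative f (at z) w) (at z) v"
  by (metis assms directional_derivative_has_derivative frechet_derivative_at
      scalar_holomorphic_on_directional_derivative)

section \<open>Holomorphic maps with several components\<close>

lemma holomorphic_map_derivative:
  assumes "holomorphic_map f S" "z \<in> S"
  shows "(f has_derivative frechet_derivative f (at z)) (at z)"
    and "frechet_derivative f (at z) (c *s v) = c *s frechet_derivative f (at z) v"
proof -
  obtain D where D: "(f has_derivative D) (at z)" "\<And>c v. D (c *s v) = c *s D v"
    using assms unfolding holomorphic_map_def by blast
  have "D = frechet_derivative f (at z)"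
    using D(1) by (rule frechet_derivative_at)
  with D show "(f has_derivative frechet_derivative f (at z)) (at z)"
    and "frechet_derivative f (at z) (c *s v) = c *s frechet_derivative f (at z) v"
    by auto
qed

lemma holomorphic_map_continuous: "holomorphic_map f S \<Longrightarrow> continuous_on S f"
  by (meson continuous_at_imp_continuous_on has_derivative_continuous holomorphic_map_derivative(1))

lemma has_derivative_vec_nth:
  "(f has_derivative f') F \<Longrightarrow> ((\<lambda>x. f x $ i) has_derivative (\<lambda>h. f' h $ i)) F"
  by (rule bounded_linear.has_derivative [OF bounded_linear_vec_nth])

lemma has_derivative_vec_componentwise:
  fixes f :: "'a::real_normed_vector \<Rightarrow> 'b::euclidean_space ^ 'n"
  assumes "\<And>i. ((\<lambda>x. f x $ i) has_derivative (\<lambda>h. f' h $ i)) (at x within S)"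
  shows "(f has_derivative f') (at x within S)"
  unfolding has_derivative_componentwise_within [of f]
proof
  fix j :: "'b ^ 'n" assume "j \<in> Basis"
  then obtain i u where j: "j = axis i u" and "u \<in> Basis"
    by (auto simp: Basis_vec_def)
  have "((\<lambda>x. f x $ i \<bullet> u) has_derivative (\<lambda>h. f' h $ i \<bullet> u)) (at x within S)"
    by (rule has_derivative_inner_left [OF assms])
  then show "((\<lambda>x. f x \<bullet> j) has_derivative (\<lambda>h. f' h \<bullet> j)) (at x within S)"
    by (simp add: j inner_axis)
qed

lemma frechet_derivative_vec_nth:
  assumes "f differentiable at z"
  shows "frechet_derivative (\<lambda>x. f x $ i) (at z) v = frechet_derivative f (at z) v $ i"
proof -
  have "((\<lambda>x. f x $ i) has_derivative (\<lambda>h. frechet_derivative f (at z) h $ i)) (at z)"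
    using assms by (intro has_derivative_vec_nth) (simp add: frechet_derivative_works)
  from frechet_derivative_at [OF this] show ?thesis by metis
qed

lemma holomorphic_map_vec_nth:
  assumes "holomorphic_map f S" shows "scalar_holomorphic_on (\<lambda>z. f z $ i) S"
  unfolding scalar_holomorphic_on_def
proof (intro conjI ballI)
  show "open S" using assms by (simp add: holomorphic_map_def)
  fix z assume "z \<in> S"
  show "\<exists>D. ((\<lambda>z. f z $ i) has_derivative D) (at z) \<and> (\<forall>c v. D (c *s v) = c * D v)"
    using has_derivative_vec_nth [OF holomorphic_map_derivative(1) [OF assms \<open>z \<in> S\<close>]]
      holomorphic_map_derivative(2) [OF assms \<open>z \<in> S\<close>]
    by (intro exI [of _ "\<lambda>h. frechet_derivative f (at z) h $ i"]) auto
qed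

lemma holomorphic_map_comp:
  assumes f: "holomorphic_map f T" and g: "holomorphic_map g S" and "g ` S \<subseteq> T"
  shows "holomorphic_map (f \<circ> g) S"
  unfolding holomorphic_map_def
proof (intro conjI ballI)
  show "open S" using g by (simp add: holomorphic_map_def)
  fix z assume z: "z \<in> S"
  then have gz: "g z \<in> T" using assms(3) by blast
  show "\<exists>D. (f \<circ> g has_derivative D) (at z) \<and> (\<forall>c v. D (c *s v) = c *s D v)"
    using diff_chain_at [OF holomorphic_map_derivative(1) [OF g z] holomorphic_map_derivative(1) [OF f gz]]
      holomorphic_map_derivative(2) [OF g z] holomorphic_map_derivative(2) [OF f gz]
    by (metis comp_apply)
qed

lemma scalar_holomorphic_on_comp:
  assumes f: "scalar_holomorphic_on f T" and g: "holomorphic_map g S" and "g ` S \<subseteq> T"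
  shows "scalar_holomorphic_on (f \<circ> g) S"
  unfolding scalar_holomorphic_on_def
proof (intro conjI ballI)
  show "open S" using g by (simp add: holomorphic_map_def)
  fix z assume z: "z \<in> S"
  then have gz: "g z \<in> T" using assms(3) by blast
  show "\<exists>D. (f \<circ> g has_derivative D) (at z) \<and> (\<forall>c v. D (c *s v) = c * D v)"
    using diff_chain_at [OF holomorphic_map_derivative(1) [OF g z] scalar_holomorphic_on_derivative(1) [OF f gz]]
      holomorphic_map_derivative(2) [OF g z] scalar_holomorphic_on_derivative(2) [OF f gz]
    by (metis comp_apply)
qed

lemma holomorphic_map_subset:
  "holomorphic_map f S \<Longrightarrow> open T \<Longrightarrow> T \<subseteq> S \<Longrightarrow> holomorphic_map f T"
  by (auto simp: holomorphic_map_def)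

lemma holomorphic_map_transform:
  assumes "holomorphic_map f S" "\<And>z. z \<in> S \<Longrightarrow> f z = g z"
  shows "holomorphic_map g S"
  using assms unfolding holomorphic_map_def by (metis has_derivative_transform_within_open)

lemma scalar_holomorphic_on_transform:
  assumes "scalar_holomorphic_on f S" "\<And>z. z \<in> S \<Longrightarrow> f z = g z"
  shows "scalar_holomorphic_on g S"
  using assms unfolding scalar_holomorphic_on_def by (metis has_derivative_transform_within_open)

lemma continuous_on_blinfun_derivative_map:
  assumes f: "holomorphic_map f S"
  shows "continuous_on S (\<lambda>z. Blinfun (frechet_derivative f (at z)))"
proof (rule continuous_on_blinfun_componentwise)
  fix v :: "complex^'a"
  have "blinfun_apply (Blinfun (frechet_derivative f (at z))) v
      = (\<chi> i. frechet_derivative (\<lambda>z. f z $ i) (at z) v)" if "z \<in> S" for z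
  proof -
    have "f differentiable at z"
      using holomorphic_map_derivative(1) [OF f that] differentiable_def by blast
    then show ?thesis
      using holomorphic_map_derivative(1) [OF f that]
      by (simp add: bounded_linear_Blinfun_apply has_derivative_bounded_linear vec_eq_iff
          frechet_derivative_vec_nth)
  qed
  moreover have "continuous_on S (\<lambda>z. \<chi> i. frechet_derivative (\<lambda>z. f z $ i) (at z) v)"
    by (intro continuous_on_vec_lambda continuous_on_directional_derivative
        holomorphic_map_vec_nth f)
  ultimately show "continuous_on S (\<lambda>z. blinfun_apply (Blinfun (frechet_derivative f (at z))) v)"
    by (simp cong: continuous_on_cong)
qed

lemma matrix_of_complex_linear:
  fixes D :: "complex^'n \<Rightarrow> complex^'m"
  assumes "linear D" "\<And>c v. D (c *s v) = c *s D v"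
  shows "D v = (\<chi> i k. D (axis k 1) $ i) *v v"
proof -
  have "D v = D (\<Sum>k\<in>UNIV. v $ k *s axis k 1)"
    by (simp add: basis_expansion)
  also have "\<dots> = (\<Sum>k\<in>UNIV. v $ k *s D (axis k 1))"
    by (simp add: linear_sum [OF assms(1)] assms(2))
  finally show ?thesis
    by (simp add: vec_eq_iff matrix_vector_mult_def mult.commute)
qed

lemma bounded_linear_matrix_vector: "bounded_linear (\<lambda>v. (C :: complex^'n^'m) *v v)"
  unfolding linear_conv_bounded_linear [symmetric]
proof (rule linearI)
  show "C *v (r *\<^sub>R v) = r *\<^sub>R (C *v v)" for r v
    by (simp add: vec_eq_iff matrix_vector_mult_def scaleR_sum_right)
qed (rule matrix_vector_right_distrib)

section \<open>Charts and special coordinates\<close>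

lemma is_chart_open: "is_chart \<kappa> \<Longrightarrow> open (chart_dom \<kappa>)" "is_chart \<kappa> \<Longrightarrow> open (coords \<kappa> ` chart_dom \<kappa>)"
  by (auto simp: is_chart_def)

lemma is_chart_continuous:
  assumes "is_chart \<kappa>"
  shows "continuous_on (chart_dom \<kappa>) (coords \<kappa>)"
    "continuous_on (coords \<kappa> ` chart_dom \<kappa>) (param \<kappa>)"
  using assms by (auto simp: is_chart_def homeomorphism_def)

lemma param_coords: "is_chart \<kappa> \<Longrightarrow> x \<in> chart_dom \<kappa> \<Longrightarrow> param \<kappa> (coords \<kappa> x) = x"
  by (auto simp: is_chart_def homeomorphism_def)

lemma coords_param: "is_chart \<kappa> \<Longrightarrow> z \<in> coords \<kappa> ` chart_dom \<kappa> \<Longrightarrow> coords \<kappa> (param \<kappa> z) = z"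
  by (auto simp: is_chart_def homeomorphism_def)

lemma param_in_dom: "is_chart \<kappa> \<Longrightarrow> z \<in> coords \<kappa> ` chart_dom \<kappa> \<Longrightarrow> param \<kappa> z \<in> chart_dom \<kappa>"
  by (auto simp: is_chart_def homeomorphism_def)

lemma open_coords_image:
  assumes \<kappa>: "is_chart \<kappa>" and W: "open W" "W \<subseteq> chart_dom \<kappa>"
  shows "open (coords \<kappa> ` W)"
proof -
  have "coords \<kappa> ` W = coords \<kappa> ` chart_dom \<kappa> \<inter> param \<kappa> -` W"
    using W(2) by (auto simp: param_coords [OF \<kappa>] coords_param [OF \<kappa>] intro!: image_eqI)
  then show ?thesis
    using continuous_open_preimage [OF is_chart_continuous(2) [OF \<kappa>] is_chart_open(2) [OF \<kappa>] W(1)]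
    by simp
qed

lemma open_param_image:
  assumes \<kappa>: "is_chart \<kappa>" and W: "open W" "W \<subseteq> coords \<kappa> ` chart_dom \<kappa>"
  shows "open (param \<kappa> ` W)"
proof -
  have "param \<kappa> ` W = chart_dom \<kappa> \<inter> coords \<kappa> -` W"
    using W(2) by (auto simp: param_coords [OF \<kappa>] coords_param [OF \<kappa>] intro!: rev_image_eqI)
  then show ?thesis
    using continuous_open_preimage [OF is_chart_continuous(1) [OF \<kappa>] is_chart_open(1) [OF \<kappa>] W(1)]
    by simp
qed

lemma charts_is_chart: "\<kappa> \<in> charts A \<Longrightarrow> is_chart \<kappa>"
  by (simp add: charts_def)

lemma charts_at_D: "\<kappa> \<in> charts_at A p \<Longrightarrow> \<kappa> \<in> charts A" "\<kappa> \<in> charts_at A p \<Longrightarrow> p \<in> chart_dom \<kappa>"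
  by (auto simp: charts_at_def)

lemma atlas_subset_charts: "holomorphic_atlas A \<Longrightarrow> A \<subseteq> charts A"
  by (auto simp: holomorphic_atlas_def charts_def)

lemma atlas_covers:
  assumes "holomorphic_atlas A" obtains \<kappa> where "\<kappa> \<in> A" "p \<in> chart_dom \<kappa>"
  using assms unfolding holomorphic_atlas_def by (metis UNIV_I UN_iff)

text \<open>Two charts of the maximal atlas are only known to be compatible with members of the
  given atlas, so the change of coordinates is factored through an atlas chart \<open>\<mu>\<close>
  around \<open>p\<close>.\<close>

lemma coordinate_change_has_derivative:
  assumes A: "holomorphic_atlas A" and \<kappa>: "\<kappa> \<in> charts_at A p" and \<kappa>': "\<kappa>' \<in> charts_at A p"
  shows "(coords \<kappa>' \<circ> param \<kappa> has_derivative differential \<kappa> (coords \<kappa>') p) (at (coords \<kappa> p))"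
proof -
  obtain \<mu> where \<mu>: "\<mu> \<in> A" "p \<in> chart_dom \<mu>"
    using atlas_covers [OF A] .
  note ch = charts_is_chart [OF charts_at_D(1) [OF \<kappa>]] charts_is_chart [OF charts_at_D(1) [OF \<kappa>']]
    charts_is_chart [OF subsetD [OF atlas_subset_charts [OF A] \<mu>(1)]]
  note p = charts_at_D(2) [OF \<kappa>] charts_at_D(2) [OF \<kappa>'] \<mu>(2)
  have "compatible \<kappa> \<mu>" "compatible \<kappa>' \<mu>"
    using \<kappa> \<kappa>' \<mu> by (auto simp: charts_at_def charts_def)
  then have hol: "holomorphic_map (coords \<mu> \<circ> param \<kappa>) (coords \<kappa> ` (chart_dom \<kappa> \<inter> chart_dom \<mu>))"
    "holomorphic_map (coords \<kappa>' \<circ> param \<mu>) (coords \<mu> ` (chart_dom \<kappa>' \<inter> chart_dom \<mu>))"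
    by (auto simp: compatible_def)
  have "(coords \<mu> \<circ> param \<kappa>) (coords \<kappa> p) = coords \<mu> p"
    using param_coords [OF ch(1) p(1)] by simp
  moreover have "coords \<kappa> p \<in> coords \<kappa> ` (chart_dom \<kappa> \<inter> chart_dom \<mu>)"
    "coords \<mu> p \<in> coords \<mu> ` (chart_dom \<kappa>' \<inter> chart_dom \<mu>)"
    using p by blast+
  ultimately obtain D where D: "((coords \<kappa>' \<circ> param \<mu>) \<circ> (coords \<mu> \<circ> param \<kappa>) has_derivative D)
      (at (coords \<kappa> p))"
    using diff_chain_at [OF holomorphic_map_derivative(1) [OF hol(1)], of "coords \<kappa> p"]
      holomorphic_map_derivative(1) [OF hol(2)] by metis
  have "(coords \<kappa>' \<circ> param \<kappa> has_derivative D) (at (coords \<kappa> p))"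
  proof (rule has_derivative_transform_within_open [OF D])
    show "open (coords \<kappa> ` (chart_dom \<kappa> \<inter> chart_dom \<mu>))"
      using ch by (intro open_coords_image open_Int is_chart_open) auto
    show "coords \<kappa> p \<in> coords \<kappa> ` (chart_dom \<kappa> \<inter> chart_dom \<mu>)"
      using p by blast
    show "((coords \<kappa>' \<circ> param \<mu>) \<circ> (coords \<mu> \<circ> param \<kappa>)) z = (coords \<kappa>' \<circ> param \<kappa>) z"
      if "z \<in> coords \<kappa> ` (chart_dom \<kappa> \<inter> chart_dom \<mu>)" for z
      using that param_coords [OF ch(1)] param_coords [OF ch(3)] by auto
  qed
  then show ?thesis
    unfolding differential_def using frechet_derivative_at by metis
qed

lemma differential_chain:
  assumes A: "holomorphic_atlas A" and \<kappa>: "\<kappa> \<in> charts_at A p" and \<kappa>': "\<kappa>' \<in> charts_at A p"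
    and f: "(f \<circ> param \<kappa>' has_derivative D) (at (coords \<kappa>' p))"
  shows "(f \<circ> param \<kappa> has_derivative D \<circ> differential \<kappa> (coords \<kappa>') p) (at (coords \<kappa> p))"
proof -
  note ch = charts_is_chart [OF charts_at_D(1) [OF \<kappa>]] charts_is_chart [OF charts_at_D(1) [OF \<kappa>']]
  note p = charts_at_D(2) [OF \<kappa>] charts_at_D(2) [OF \<kappa>']
  have "((f \<circ> param \<kappa>') \<circ> (coords \<kappa>' \<circ> param \<kappa>) has_derivative D \<circ> differential \<kappa> (coords \<kappa>') p)
      (at (coords \<kappa> p))"
    by (rule diff_chain_at [OF coordinate_change_has_derivative [OF A \<kappa> \<kappa>']])
      (use f param_coords [OF ch(1) p(1)] in simp)
  then show ?thesis
  proof (rule has_derivative_transform_within_open)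
    show "open (coords \<kappa> ` (chart_dom \<kappa> \<inter> chart_dom \<kappa>'))"
      using ch by (intro open_coords_image open_Int is_chart_open) auto
    show "coords \<kappa> p \<in> coords \<kappa> ` (chart_dom \<kappa> \<inter> chart_dom \<kappa>')"
      using p by blast
    show "((f \<circ> param \<kappa>') \<circ> (coords \<kappa>' \<circ> param \<kappa>)) z = (f \<circ> param \<kappa>) z"
      if "z \<in> coords \<kappa> ` (chart_dom \<kappa> \<inter> chart_dom \<kappa>')" for z
      using that param_coords [OF ch(1)] param_coords [OF ch(2)] by auto
  qed
qed

locale special_kaehler_manifold =
  fixes X :: "('x::{t2_space,second_countable_topology}, 'r::finite) special_kaehler_data"
  assumes special_kaehler: "special_kaehler X"
begin

lemma holomorphic_atlas: "holomorphic_atlas (atlas X)"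
  using special_kaehler by (simp add: special_kaehler_def)

lemma a_periods_holomorphic:
  "\<kappa> \<in> charts (atlas X) \<Longrightarrow> holomorphic_map (a_periods X \<circ> param \<kappa>) (coords \<kappa> ` chart_dom \<kappa>)"
  using special_kaehler by (simp add: special_kaehler_def holomorphic_function_def)

lemma b_periods_holomorphic:
  "\<kappa> \<in> charts (atlas X) \<Longrightarrow> holomorphic_map (b_periods X \<circ> param \<kappa>) (coords \<kappa> ` chart_dom \<kappa>)"
  using special_kaehler by (simp add: special_kaehler_def holomorphic_function_def)

lemma period_map_siegel: "period_map X p \<in> siegel"
  using special_kaehler by (simp add: special_kaehler_def)

lemma a_periods_has_derivative:
  assumes "\<kappa> \<in> charts_at (atlas X) p"
  shows "(a_periods X \<circ> param \<kappa> has_derivative differential \<kappa> (a_periods X) p) (at (coords \<kappa> p))"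
    and "differential \<kappa> (a_periods X) p (c *s v) = c *s differential \<kappa> (a_periods X) p v"
  using holomorphic_map_derivative [OF a_periods_holomorphic [OF charts_at_D(1) [OF assms]], of "coords \<kappa> p"]
    charts_at_D(2) [OF assms] by (auto simp: differential_def)

lemma linear_differential_a_periods:
  "\<kappa> \<in> charts_at (atlas X) p \<Longrightarrow> linear (differential \<kappa> (a_periods X) p)"
  using a_periods_has_derivative(1) has_derivative_linear by blast

lemma differential_a_periods_inverse:
  assumes \<kappa>: "\<kappa> \<in> charts_at (atlas X) p"
  obtains C where "\<And>v. C *v differential \<kappa> (a_periods X) p v = v"
    "\<And>w. differential \<kappa> (a_periods X) p (C *v w) = w"
proof -
  define D where "D = differential \<kappa> (a_periods X) p"
  define M where "M = (\<chi> i k. D (axis k 1) $ i)"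
  have D: "D v = M *v v" for v
    unfolding M_def using linear_differential_a_periods [OF \<kappa>] a_periods_has_derivative(2) [OF \<kappa>]
    by (intro matrix_of_complex_linear) (auto simp: D_def)
  have indep: "k = 0" if "\<And>v. (\<Sum>i\<in>UNIV. k $ i * D v $ i) = 0" for k :: "complex^'r"
  proof -
    have "\<forall>k. (\<forall>v. (\<Sum>i\<in>UNIV. k i * D v $ i) = 0) \<longrightarrow> (\<forall>i. k i = 0)"
      using special_kaehler \<kappa> by (simp add: special_kaehler_def D_def)
    from spec [OF this, of "\<lambda>i. k $ i"] show ?thesis
      using that by (simp add: vec_eq_iff)
  qed
  \<comment> \<open>Independence of the forms da^i concerns the rows of \<open>M\<close>, hence the
    kernel of its transpose. Since \<open>M\<close> is square, the resulting one-sided inverse is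
    two-sided.\<close>
  have "x = 0" if "transpose M *v x = 0" for x
  proof (rule indep)
    fix v
    have "(\<Sum>i\<in>UNIV. x $ i * D v $ i) = (\<Sum>i\<in>UNIV. \<Sum>k\<in>UNIV. x $ i * (M $ i $ k * v $ k))"
      by (simp add: D matrix_vector_mult_def sum_distrib_left)
    also have "\<dots> = (\<Sum>k\<in>UNIV. \<Sum>i\<in>UNIV. x $ i * (M $ i $ k * v $ k))"
      by (rule sum.swap)
    also have "\<dots> = (\<Sum>k\<in>UNIV. (transpose M *v x) $ k * v $ k)"
      by (simp add: matrix_vector_mult_def transpose_def sum_distrib_left sum_distrib_right mult_ac)
    finally show "(\<Sum>i\<in>UNIV. x $ i * D v $ i) = 0"
      by (simp only: that zero_index mult_zero_left sum.neutral_const)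
  qed
  then obtain B where "B ** transpose M = mat 1"
    using matrix_left_invertible_ker [of "transpose M"] by blast
  then have "M ** transpose B = mat 1"
    by (metis matrix_transpose_mul transpose_mat transpose_transpose)
  moreover from this have "transpose B ** M = mat 1"
    by (simp add: matrix_left_right_inverse)
  ultimately show ?thesis
    by (intro that [of "transpose B"])
      (simp_all only: D_def [symmetric] D matrix_vector_mul_assoc matrix_vector_mul_lid)
qed

lemma differential_a_periods_bij:
  "\<kappa> \<in> charts_at (atlas X) p \<Longrightarrow> bij (differential \<kappa> (a_periods X) p)"
  using differential_a_periods_inverse by (metis bijI')

text \<open>Since the \<open>da\<^sup>i\<close> are independent, the inverse function theorem makes the periods \<open>a\<^sup>i\<close>
  themselves coordinates near each point.\<close>

lemma special_chart_exists:
  obtains U where "p \<in> U" "(U, a_periods X) \<in> charts (atlas X)"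
proof -
  let ?a = "a_periods X"
  obtain \<kappa> where \<kappa>: "\<kappa> \<in> atlas X" "p \<in> chart_dom \<kappa>"
    using atlas_covers [OF holomorphic_atlas] .
  then have ch: "\<kappa> \<in> charts (atlas X)"
    using atlas_subset_charts [OF holomorphic_atlas] by blast
  note isc = charts_is_chart [OF ch]
  define S where "S = coords \<kappa> ` chart_dom \<kappa>"
  define f where "f = ?a \<circ> param \<kappa>"
  have f: "holomorphic_map f S"
    unfolding f_def S_def by (rule a_periods_holomorphic [OF ch])
  have S: "open S" unfolding S_def by (rule is_chart_open(2) [OF isc])
  have fd: "frechet_derivative f (at z) = differential \<kappa> ?a (param \<kappa> z)" if "z \<in> S" for z
    using coords_param [OF isc] that by (simp add: differential_def f_def S_def)
  have at: "\<kappa> \<in> charts_at (atlas X) (param \<kappa> z)" if "z \<in> S" for z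
    using param_in_dom [OF isc] ch that by (auto simp: charts_at_def S_def)
  have bl: "blinfun_apply (Blinfun (frechet_derivative f (at z))) = frechet_derivative f (at z)"
    if "z \<in> S" for z
    using holomorphic_map_derivative(1) [OF f that]
    by (simp add: bounded_linear_Blinfun_apply has_derivative_bounded_linear)
  have pS: "coords \<kappa> p \<in> S" using \<kappa>(2) by (simp add: S_def)
  obtain C where C: "\<And>v. C *v differential \<kappa> ?a (param \<kappa> (coords \<kappa> p)) v = v"
    using differential_a_periods_inverse [OF at [OF pS]] by metis
  have inv: "Blinfun (\<lambda>v. C *v v) o\<^sub>L Blinfun (frechet_derivative f (at (coords \<kappa> p))) = id_blinfun"
    by (rule blinfun_eqI, simp add: bl [OF pS] bounded_linear_Blinfun_apply [OF bounded_linear_matrix_vector])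
      (simp add: fd [OF pS] C)
  have der: "(f has_derivative blinfun_apply (Blinfun (frechet_derivative f (at z)))) (at z)"
    if "z \<in> S" for z
    using holomorphic_map_derivative(1) [OF f that] bl [OF that] by simp
  have "\<exists>U' V g g'. open U' \<and> U' \<subseteq> S \<and> coords \<kappa> p \<in> U' \<and> open V \<and> homeomorphism U' V f g
      \<and> (\<forall>y\<in>V. (g has_derivative g' y) (at y)
          \<and> g' y = inv (blinfun_apply (Blinfun (frechet_derivative f (at (g y))))))"
    by (rule inverse_function_theorem [OF S der continuous_on_blinfun_derivative_map [OF f] pS inv]) blast+
  then obtain U' V g g' where U': "open U'" "U' \<subseteq> S" "coords \<kappa> p \<in> U'"
    and V: "open V" and hom: "homeomorphism U' V f g"
    and g': "\<And>y. y \<in> V \<Longrightarrow> (g has_derivative g' y) (at y)"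
      "\<And>y. y \<in> V \<Longrightarrow> g' y = inv (blinfun_apply (Blinfun (frechet_derivative f (at (g y)))))"
    by blast
  have gV: "g y \<in> U'" "f (g y) = y" if "y \<in> V" for y
    using hom that by (auto simp: homeomorphism_def)
  have fU: "f z \<in> V" "g (f z) = z" if "z \<in> U'" for z
    using hom that by (auto simp: homeomorphism_def)
  define U where "U = param \<kappa> ` U'"
  define \<mu> where "\<mu> = (U, ?a)"
  have Uo: "open U" unfolding U_def by (rule open_param_image [OF isc U'(1)]) (use U' in \<open>simp add: S_def\<close>)
  have Ud: "U \<subseteq> chart_dom \<kappa>" using U'(2) param_in_dom [OF isc] by (auto simp: U_def S_def)
  have coU: "coords \<kappa> x \<in> U'" "?a x = f (coords \<kappa> x)" if "x \<in> U" for x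
    using that U'(2) coords_param [OF isc] param_coords [OF isc] Ud
    by (auto simp: U_def S_def f_def)
  have aU: "?a ` U = V"
    using gV fU by (force simp: U_def f_def)
  have inj: "inj_on ?a U"
    using fU coU Ud param_coords [OF isc] by (metis (no_types, lifting) inj_onI subsetD)
  have par: "param \<mu> y = param \<kappa> (g y)" if "y \<in> V" for y
  proof -
    have "param \<kappa> (g y) \<in> U" "?a (param \<kappa> (g y)) = y"
      using gV [OF that] by (auto simp: U_def f_def)
    then have "inv_into U ?a y = param \<kappa> (g y)"
      using inv_into_f_f [OF inj] by force
    then show ?thesis
      by (simp add: param_def [of "(U, ?a)"] \<mu>_def)
  qed
  have ghol: "holomorphic_map g V"
    unfolding holomorphic_map_def
  proof (intro conjI ballI exI allI)
    fix y assume y: "y \<in> V"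
    then show "(g has_derivative g' y) (at y)" by (rule g')
    fix c v
    have gS: "g y \<in> S" using gV y U' by blast
    \<comment> \<open>The inverse function theorem is real and gives only a real derivative of
      \<open>g\<close>; it is complex-linear because it inverts a complex-linear bijection.\<close>
    have "bij (frechet_derivative f (at (g y)))"
      using differential_a_periods_bij [OF at [OF gS]] fd [OF gS] by simp
    then show "g' y (c *s v) = c *s g' y v"
      using holomorphic_map_derivative(2) [OF f gS]
      by (simp add: g'(2) [OF y] bl [OF gS])
        (metis bij_inv_eq_iff)
  qed (rule V)
  have \<mu>: "is_chart \<mu>"
    unfolding is_chart_def
  proof (intro conjI)
    show "open (chart_dom \<mu>)" by (simp add: \<mu>_def Uo)
    show "open (coords \<mu> ` chart_dom \<mu>)" by (simp add: \<mu>_def aU V)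
    have "continuous_on U (f \<circ> coords \<kappa>)"
      by (rule continuous_on_compose)
        (auto intro: continuous_on_subset [OF is_chart_continuous(1) [OF isc] Ud]
           continuous_on_subset [OF holomorphic_map_continuous [OF f]] simp: U'(2) [THEN subsetD] coU(1))
    then have 1: "continuous_on U ?a"
      using coU(2) by (simp cong: continuous_on_cong)
    have "continuous_on V (param \<kappa> \<circ> g)"
      using hom U'(2) gV(1)
      by (intro continuous_on_compose continuous_on_subset [OF is_chart_continuous(2) [OF isc]])
        (auto simp: homeomorphism_def S_def)
    then have 2: "continuous_on V (param \<mu>)"
      using par by (simp cong: continuous_on_cong)
    have 3: "param \<mu> (?a x) = x" if "x \<in> U" for x
      using that inj by (simp add: \<mu>_def param_def)
    have 4: "?a (param \<mu> y) = y" if "y \<in> V" for y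
      using par gV that by (simp add: f_def)
    have "param \<mu> ` V = U"
      using 3 aU by force
    then show "homeomorphism (chart_dom \<mu>) (coords \<mu> ` chart_dom \<mu>) (coords \<mu>) (param \<mu>)"
      using 1 2 3 4 aU by (simp add: homeomorphism_def \<mu>_def)
  qed
  have "compatible \<mu> \<kappa>'" if \<kappa>': "\<kappa>' \<in> atlas X" for \<kappa>'
    unfolding compatible_def
  proof
    have ch': "\<kappa>' \<in> charts (atlas X)"
      using atlas_subset_charts [OF holomorphic_atlas] \<kappa>' by blast
    note isc' = charts_is_chart [OF ch']
    have "compatible \<kappa> \<kappa>'" using ch \<kappa>' by (simp add: charts_def)
    then have h: "holomorphic_map (coords \<kappa>' \<circ> param \<kappa>) (coords \<kappa> ` (chart_dom \<kappa> \<inter> chart_dom \<kappa>'))"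
      by (simp add: compatible_def)
    have o: "open (U \<inter> chart_dom \<kappa>')" using Uo is_chart_open(1) [OF isc'] by auto
    have o': "open (?a ` (U \<inter> chart_dom \<kappa>'))"
      using open_coords_image [OF \<mu>, of "U \<inter> chart_dom \<kappa>'"] o by (simp add: \<mu>_def)
    have s: "?a ` (U \<inter> chart_dom \<kappa>') \<subseteq> V" using aU by blast
    have "holomorphic_map ((coords \<kappa>' \<circ> param \<kappa>) \<circ> g) (?a ` (U \<inter> chart_dom \<kappa>'))"
    proof (rule holomorphic_map_comp [OF h holomorphic_map_subset [OF ghol o' s]])
      show "g ` ?a ` (U \<inter> chart_dom \<kappa>') \<subseteq> coords \<kappa> ` (chart_dom \<kappa> \<inter> chart_dom \<kappa>')"
        using coU fU(2) Ud by auto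
    qed
    then have "holomorphic_map (coords \<kappa>' \<circ> param \<mu>) (?a ` (U \<inter> chart_dom \<kappa>'))"
      by (rule holomorphic_map_transform) (use s par in auto)
    then show "holomorphic_map (coords \<kappa>' \<circ> param \<mu>) (coords \<mu> ` (chart_dom \<mu> \<inter> chart_dom \<kappa>'))"
      by (simp add: \<mu>_def)
    show "holomorphic_map (coords \<mu> \<circ> param \<kappa>') (coords \<kappa>' ` (chart_dom \<mu> \<inter> chart_dom \<kappa>'))"
      using holomorphic_map_subset [OF a_periods_holomorphic [OF ch']
          open_coords_image [OF isc', of "U \<inter> chart_dom \<kappa>'"]] o by (simp add: \<mu>_def image_mono)
  qed
  with \<mu> have "\<mu> \<in> charts (atlas X)" by (simp add: charts_def)
  moreover have "p \<in> U"
    using U'(3) param_coords [OF isc \<kappa>(2)] by (force simp: U_def)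
  ultimately show ?thesis using that by (simp add: \<mu>_def)
qed

end

section \<open>Partial derivatives in special coordinates\<close>

lemma scalar_holomorphic_on_local:
  assumes "open S" "\<And>z. z \<in> S \<Longrightarrow> \<exists>T. z \<in> T \<and> scalar_holomorphic_on f T"
  shows "scalar_holomorphic_on f S"
  using assms unfolding scalar_holomorphic_on_def by blast

lemma scalar_holomorphic_on_expansion:
  fixes v :: "complex^'n"
  assumes "scalar_holomorphic_on f S" "z \<in> S"
  shows "frechet_derivative f (at z) v = (\<Sum>k\<in>UNIV. v $ k * frechet_derivative f (at z) (axis k 1))"
proof -
  have "linear (frechet_derivative f (at z))"
    using scalar_holomorphic_on_derivative(1) [OF assms] has_derivative_linear by blast
  then have "frechet_derivative f (at z) (\<Sum>k\<in>UNIV. v $ k *s axis k 1)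
      = (\<Sum>k\<in>UNIV. v $ k * frechet_derivative f (at z) (axis k 1))"
    by (simp add: linear_sum scalar_holomorphic_on_derivative(2) [OF assms])
  then show ?thesis by (simp add: basis_expansion)
qed

context special_kaehler_manifold
begin

definition special :: "'x set \<Rightarrow> bool" where
  "special U \<longleftrightarrow> (U, a_periods X) \<in> charts (atlas X)"

abbreviation point :: "'x set \<Rightarrow> complex^'r \<Rightarrow> 'x" where
  "point U \<equiv> param (U, a_periods X)"

lemma special_exists: obtains U where "special U" "p \<in> U"
  using special_chart_exists unfolding special_def by metis

lemma special_is_chart: "special U \<Longrightarrow> is_chart (U, a_periods X)"
  unfolding special_def by (rule charts_is_chart)

lemma special_charts_at: "special U \<Longrightarrow> p \<in> U \<Longrightarrow> (U, a_periods X) \<in> charts_at (atlas X) p"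
  by (simp add: special_def charts_at_def)

lemma special_open: "special U \<Longrightarrow> open U" "special U \<Longrightarrow> open (a_periods X ` U)"
  using is_chart_open [OF special_is_chart] by auto

lemma point_a_periods: "special U \<Longrightarrow> p \<in> U \<Longrightarrow> point U (a_periods X p) = p"
  using param_coords [OF special_is_chart] by force

lemma a_periods_point: "special U \<Longrightarrow> z \<in> a_periods X ` U \<Longrightarrow> a_periods X (point U z) = z"
  using coords_param [OF special_is_chart] by force

lemma point_in: "special U \<Longrightarrow> z \<in> a_periods X ` U \<Longrightarrow> point U z \<in> U"
  using param_in_dom [OF special_is_chart] by force

lemma open_special_image: "special U \<Longrightarrow> open W \<Longrightarrow> W \<subseteq> U \<Longrightarrow> open (a_periods X ` W)"
  using open_coords_image [OF special_is_chart] by force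

lemma differential_special:
  assumes "special U" "p \<in> U"
  shows "differential (U, a_periods X) (a_periods X) p = (\<lambda>v. v)"
proof -
  have "((\<lambda>z. z) has_derivative (\<lambda>v. v)) (at (a_periods X p))"
    by (rule has_derivative_ident)
  then have "(a_periods X \<circ> point U has_derivative (\<lambda>v. v)) (at (a_periods X p))"
    by (rule has_derivative_transform_within_open [OF _ special_open(2) [OF assms(1)]])
      (use assms a_periods_point in auto)
  then show ?thesis
    unfolding differential_def using frechet_derivative_at by fastforce
qed

definition holo :: "('x \<Rightarrow> complex) \<Rightarrow> bool" where
  "holo h \<longleftrightarrow> (\<forall>U. special U \<longrightarrow> scalar_holomorphic_on (h \<circ> point U) (a_periods X ` U))"

text \<open>All special charts have the coordinate map \<open>a_periods X\<close> and differ only in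
  their domains, so the Jacobian between two of them is the identity. Partial derivatives are
  therefore functions on the whole manifold, even though the periods need not be injective globally;
  the chosen domain does not matter.\<close>

definition pd :: "'r \<Rightarrow> ('x \<Rightarrow> complex) \<Rightarrow> 'x \<Rightarrow> complex" where
  "pd k h p = frechet_derivative (h \<circ> point (SOME U. special U \<and> p \<in> U)) (at (a_periods X p)) (axis k 1)"

lemma holo_derivative:
  assumes "holo h" "special U" "p \<in> U"
  shows "(h \<circ> point U has_derivative frechet_derivative (h \<circ> point U) (at (a_periods X p)))
    (at (a_periods X p))"
  using assms unfolding holo_def by (intro scalar_holomorphic_on_derivative(1)) auto

lemma pd_eq:
  assumes h: "holo h" and U: "special U" "p \<in> U"
  shows "pd k h p = frechet_derivative (h \<circ> point U) (at (a_periods X p)) (axis k 1)"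
proof -
  define V where "V = (SOME U. special U \<and> p \<in> U)"
  have V: "special V" "p \<in> V"
    using someI_ex [of "\<lambda>U. special U \<and> p \<in> U"] U by (auto simp: V_def)
  have "(h \<circ> point U has_derivative frechet_derivative (h \<circ> point V) (at (a_periods X p)))
      (at (a_periods X p))"
  proof (rule has_derivative_transform_within_open [OF holo_derivative [OF h V]])
    show "open (a_periods X ` (U \<inter> V))"
      using special_open(1) U V by (intro open_special_image [OF V(1)]) auto
    show "a_periods X p \<in> a_periods X ` (U \<inter> V)" using U V by blast
    show "(h \<circ> point V) z = (h \<circ> point U) z" if "z \<in> a_periods X ` (U \<inter> V)" for z
      using that point_a_periods [OF U(1)] point_a_periods [OF V(1)] by auto
  qed
  from frechet_derivative_at [OF this] show ?thesis
    by (simp add: pd_def V_def)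
qed

lemma holo_has_derivative:
  assumes "holo h" "special U" "p \<in> U"
  shows "(h \<circ> point U has_derivative (\<lambda>v. \<Sum>k\<in>UNIV. v $ k * pd k h p)) (at (a_periods X p))"
proof -
  have "frechet_derivative (h \<circ> point U) (at (a_periods X p)) v = (\<Sum>k\<in>UNIV. v $ k * pd k h p)" for v
    unfolding pd_eq [OF assms]
    using assms unfolding holo_def by (intro scalar_holomorphic_on_expansion) auto
  then show ?thesis
    by (intro has_derivative_eq_rhs [OF holo_derivative [OF assms]] ext)
qed

lemma pd_point:
  assumes "holo h" "special U" "z \<in> a_periods X ` U"
  shows "pd k h (point U z) = frechet_derivative (h \<circ> point U) (at z) (axis k 1)"
  using pd_eq [OF assms(1,2) point_in [OF assms(2,3)]] a_periods_point [OF assms(2,3)] by simp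

lemma holo_pd: assumes "holo h" shows "holo (pd k h)"
  unfolding holo_def
proof (intro allI impI)
  fix U assume U: "special U"
  have "scalar_holomorphic_on (\<lambda>z. frechet_derivative (h \<circ> point U) (at z) (axis k 1)) (a_periods X ` U)"
    using assms U unfolding holo_def by (intro scalar_holomorphic_on_directional_derivative) auto
  then show "scalar_holomorphic_on (pd k h \<circ> point U) (a_periods X ` U)"
    by (rule scalar_holomorphic_on_transform) (simp add: pd_point [OF assms U])
qed

lemma pd_commute: assumes "holo h" shows "pd j (pd k h) p = pd k (pd j h) p"
proof -
  obtain U where U: "special U" "p \<in> U" by (rule special_exists)
  have h: "scalar_holomorphic_on (h \<circ> point U) (a_periods X ` U)"
    using assms U by (simp add: holo_def)
  have *: "pd j (pd k h) p =
      frechet_derivative (\<lambda>z. frechet_derivative (h \<circ> point U) (at z) (axis k 1)) (at (a_periods X p)) (axis j 1)"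
    for j k
  proof -
    have "(pd k h \<circ> point U has_derivative
        frechet_derivative (\<lambda>z. frechet_derivative (h \<circ> point U) (at z) (axis k 1)) (at (a_periods X p)))
        (at (a_periods X p))"
      by (rule has_derivative_transform_within_open
          [OF scalar_holomorphic_on_derivative(1) [OF scalar_holomorphic_on_directional_derivative [OF h]]
            special_open(2) [OF U(1)]])
        (use U in \<open>auto simp: pd_point [OF assms]\<close>)
    from frechet_derivative_at [OF this] show ?thesis
      unfolding pd_eq [OF holo_pd [OF assms] U] by metis
  qed
  show ?thesis
    unfolding * by (rule second_directional_derivative_commute [OF h]) (use U in auto)
qed

text \<open>Slice charts of a submanifold are arbitrary charts; differentiability of the metric
  there rests on this transfer.\<close>

lemma holo_chart:
  assumes "holo h" and \<kappa>: "\<kappa> \<in> charts (atlas X)"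
  shows "scalar_holomorphic_on (h \<circ> param \<kappa>) (coords \<kappa> ` chart_dom \<kappa>)"
proof (rule scalar_holomorphic_on_local)
  note isc = charts_is_chart [OF \<kappa>]
  show "open (coords \<kappa> ` chart_dom \<kappa>)" by (rule is_chart_open(2) [OF isc])
  fix z assume "z \<in> coords \<kappa> ` chart_dom \<kappa>"
  then obtain p where p: "p \<in> chart_dom \<kappa>" "z = coords \<kappa> p" by blast
  obtain U where U: "special U" "p \<in> U" by (rule special_exists)
  let ?W = "coords \<kappa> ` (chart_dom \<kappa> \<inter> U)"
  have h: "scalar_holomorphic_on (h \<circ> point U) (a_periods X ` U)"
    using assms U by (simp add: holo_def)
  have "open ?W"
    using special_open(1) [OF U(1)] is_chart_open(1) [OF isc] by (intro open_coords_image [OF isc]) auto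
  then have a: "holomorphic_map (a_periods X \<circ> param \<kappa>) ?W"
    by (rule holomorphic_map_subset [OF a_periods_holomorphic [OF \<kappa>]]) auto
  have "scalar_holomorphic_on ((h \<circ> point U) \<circ> (a_periods X \<circ> param \<kappa>)) ?W"
    by (rule scalar_holomorphic_on_comp [OF h a]) (auto simp: param_coords [OF isc])
  then have "scalar_holomorphic_on (h \<circ> param \<kappa>) ?W"
    by (rule scalar_holomorphic_on_transform) (auto simp: param_coords [OF isc] point_a_periods [OF U(1)])
  moreover have "z \<in> ?W" using p U by simp
  ultimately show "\<exists>T. z \<in> T \<and> scalar_holomorphic_on (h \<circ> param \<kappa>) T"
    by (intro exI conjI)
qed

section \<open>The period map in special coordinates\<close>

lemma holo_b_periods: "holo (\<lambda>p. b_periods X p $ i)"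
  unfolding holo_def
proof (intro allI impI)
  fix U assume "special U"
  then have "holomorphic_map (b_periods X \<circ> point U) (a_periods X ` U)"
    using b_periods_holomorphic by (force simp: special_def)
  from holomorphic_map_vec_nth [OF this, of i]
  show "scalar_holomorphic_on ((\<lambda>p. b_periods X p $ i) \<circ> point U) (a_periods X ` U)"
    by (simp add: o_def)
qed

text \<open>In special coordinates da is the identity, so db = \<tau> da makes \<tau> the Jacobian
  matrix of b. Holomorphy of the period map follows from this.\<close>

lemma pd_b_periods: "pd k (\<lambda>p. b_periods X p $ i) p = period_map X p $ i $ k"
proof -
  obtain U where U: "special U" "p \<in> U" by (rule special_exists)
  note ca = special_charts_at [OF U]
  have hol: "holomorphic_map (b_periods X \<circ> point U) (a_periods X ` U)"
    using b_periods_holomorphic U by (force simp: special_def)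
  have "differential (U, a_periods X) (b_periods X) p v = period_map X p *v v" for v
    using special_kaehler ca differential_special [OF U] by (simp add: special_kaehler_def)
  then have D: "frechet_derivative (b_periods X \<circ> point U) (at (a_periods X p)) v = period_map X p *v v" for v
    by (simp add: differential_def)
  have "b_periods X \<circ> point U differentiable at (a_periods X p)"
    using holomorphic_map_derivative(1) [OF hol, of "a_periods X p"] U(2)
    by (auto simp: differentiable_def)
  from frechet_derivative_vec_nth [OF this, of i "axis k 1"]
  have "frechet_derivative ((\<lambda>p. b_periods X p $ i) \<circ> point U) (at (a_periods X p)) (axis k 1) =
      (period_map X p *v axis k 1) $ i"
    by (simp add: o_def D [unfolded o_def])
  also have "\<dots> = period_map X p $ i $ k"
    by (simp add: matrix_vector_mult_def axis_def if_distrib cong: if_cong)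
  finally show ?thesis
    by (simp add: pd_eq [OF holo_b_periods U])
qed

lemma holo_period_map: "holo (\<lambda>p. period_map X p $ i $ k)"
  using holo_pd [OF holo_b_periods, of k i] by (simp add: pd_b_periods [abs_def])

lemma period_map_symmetric: "period_map X p $ i $ k = period_map X p $ k $ i"
proof -
  have "transpose (period_map X p) = period_map X p"
    using period_map_siegel [of p] by (simp add: siegel_def)
  then have "transpose (period_map X p) $ i $ k = period_map X p $ i $ k" by simp
  then show ?thesis by (simp add: transpose_def)
qed

text \<open>The prepotential is never constructed. Symmetry of its third derivatives comes from the
  symmetry of \<tau> and from commuting second partial derivatives of b.\<close>

lemma pd_period_map_symmetric:
  "pd k (\<lambda>p. period_map X p $ i $ j) p = pd k (\<lambda>p. period_map X p $ j $ i) p"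
  "pd k (\<lambda>p. period_map X p $ i $ j) p = pd j (\<lambda>p. period_map X p $ i $ k) p"
proof -
  show "pd k (\<lambda>p. period_map X p $ i $ j) p = pd k (\<lambda>p. period_map X p $ j $ i) p"
    by (simp only: period_map_symmetric [of _ i j])
  show "pd k (\<lambda>p. period_map X p $ i $ j) p = pd j (\<lambda>p. period_map X p $ i $ k) p"
    using pd_commute [OF holo_b_periods, of k j i p] by (simp add: pd_b_periods [abs_def])
qed

end

section \<open>Complex matrices\<close>

text \<open>The pairing is bilinear and conjugation is written out with \<open>cnjv\<close>:
  symmetric complex matrices then move across it unchanged, and holomorphic and conjugate factors
  stay visibly apart.\<close>

definition dot :: "complex^'n \<Rightarrow> complex^'n \<Rightarrow> complex" where
  "dot x y = (\<Sum>i\<in>UNIV. x $ i * y $ i)"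

definition cnjv :: "complex^'n \<Rightarrow> complex^'n" where
  "cnjv x = (\<chi> i. cnj (x $ i))"

definition cnjm :: "complex^'n^'m \<Rightarrow> complex^'n^'m" where
  "cnjm A = (\<chi> i j. cnj (A $ i $ j))"

definition imm :: "complex^'n^'m \<Rightarrow> complex^'n^'m" where
  "imm A = (\<chi> i j. complex_of_real (Im (A $ i $ j)))"

lemma dot_commute: "dot x y = dot y x"
  by (simp add: dot_def mult.commute)

lemma dot_simps:
  "dot (x + x') y = dot x y + dot x' y" "dot x (y + y') = dot x y + dot x y'"
  "dot (x - x') y = dot x y - dot x' y" "dot x (y - y') = dot x y - dot x y'"
  "dot (- x) y = - dot x y" "dot x (- y) = - dot x y"
  "dot (c *s x) y = c * dot x y" "dot x (c *s y) = c * dot x y"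
  "dot 0 y = 0" "dot x 0 = 0"
  by (simp_all add: dot_def algebra_simps sum.distrib sum_subtractf sum_distrib_left sum_negf)

lemma dot_symmetric_matrix:
  fixes A :: "complex^'n^'n"
  assumes "transpose A = A" shows "dot (A *v x) y = dot x (A *v y)"
proof -
  have A: "A $ i $ j = A $ j $ i" for i j
    using assms by (simp add: transpose_def vec_eq_iff)
  have "dot (A *v x) y = (\<Sum>i\<in>UNIV. \<Sum>j\<in>UNIV. A $ i $ j * x $ j * y $ i)"
    by (simp add: dot_def matrix_vector_mult_def sum_distrib_right)
  also have "\<dots> = (\<Sum>j\<in>UNIV. \<Sum>i\<in>UNIV. A $ i $ j * x $ j * y $ i)"
    by (rule sum.swap)
  also have "\<dots> = dot x (A *v y)"
    by (simp add: dot_def matrix_vector_mult_def sum_distrib_left A mult_ac)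
  finally show ?thesis .
qed

lemma cnj_dot: "cnj (dot x y) = dot (cnjv x) (cnjv y)"
  by (simp add: dot_def cnjv_def)

lemma cnjv_simps:
  "cnjv (cnjv x) = x" "cnjv (c *s x) = cnj c *s cnjv x" "cnjv (x + y) = cnjv x + cnjv y"
  "cnjv (x - y) = cnjv x - cnjv y" "cnjv (- x) = - cnjv x" "cnjv 0 = 0"
  by (simp_all add: cnjv_def vec_eq_iff)

lemma cnjv_matrix_vector: "cnjv (A *v x) = cnjm A *v cnjv x"
  by (simp add: cnjv_def cnjm_def matrix_vector_mult_def vec_eq_iff)

lemma cnjm_imm: "cnjm (imm A) = imm A"
  by (simp add: cnjm_def imm_def vec_eq_iff)

text \<open>Splits the derivative of the metric into a holomorphic and a conjugate half, which
  cancel against different terms in the curvature and in parallel transport.\<close>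

lemma imm_matrix_vector: "imm A *v x = (1 / (2 * \<i>)) *s (A *v x - cnjm A *v x)"
proof (rule vec_eq_iff [THEN iffD2], rule allI)
  fix i
  have *: "complex_of_real (Im a) * y = 1 / (2 * \<i>) * (a * y - cnj a * y)" for a y
  proof -
    have "complex_of_real (Im a) = 1 / (2 * \<i>) * (a - cnj a)"
      by (simp add: complex_eq_iff)
    then show ?thesis
      by (simp only: mult.assoc left_diff_distrib)
  qed
  have "(imm A *v x) $ i = (\<Sum>j\<in>UNIV. 1 / (2 * \<i>) * (A $ i $ j * x $ j - cnj (A $ i $ j) * x $ j))"
    unfolding imm_def matrix_vector_mult_def vec_lambda_beta * ..
  also have "\<dots> = ((1 / (2 * \<i>)) *s (A *v x - cnjm A *v x)) $ i"
    by (simp only: cnjm_def matrix_vector_mult_def vec_lambda_beta vector_smult_component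
        vector_minus_component sum_distrib_left sum_subtractf right_diff_distrib)
  finally show "(imm A *v x) $ i = ((1 / (2 * \<i>)) *s (A *v x - cnjm A *v x)) $ i" .
qed

text \<open>Expressing the imaginary part through \<open>A\<close> itself turns the terms of the
  Koszul formula into values of a symmetric trilinear form.\<close>

lemma Re_dot_imm:
  "Re (dot (imm A *v w) (cnjv u)) = (Im (dot (A *v w) (cnjv u)) + Im (dot (A *v cnjv w) u)) / 2"
proof -
  have *: "Re (of_real (Im a) * x * cnj y) = (Im (a * x * cnj y) + Im (a * cnj x * y)) / 2" for a x y
    by (simp add: algebra_simps)
  show ?thesis
    unfolding dot_def matrix_vector_mult_def imm_def cnjv_def vec_lambda_beta sum_distrib_right
      Re_sum Im_sum * sum.distrib [symmetric] sum_divide_distrib ..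
qed

lemma bounded_bilinear_matrix_vector:
  "bounded_bilinear ((*v) :: complex^'n^'m \<Rightarrow> complex^'n \<Rightarrow> complex^'m)"
  unfolding bilinear_conv_bounded_bilinear [symmetric] bilinear_def
  by (auto intro!: linearI simp: vec_eq_iff matrix_vector_mult_def algebra_simps sum.distrib scaleR_sum_right)

lemma bounded_bilinear_matrix_matrix:
  "bounded_bilinear ((**) :: complex^'n^'m \<Rightarrow> complex^'k^'n \<Rightarrow> complex^'k^'m)"
  unfolding bilinear_conv_bounded_bilinear [symmetric] bilinear_def
  by (auto intro!: linearI simp: vec_eq_iff matrix_matrix_mult_def algebra_simps sum.distrib scaleR_sum_right)

lemma bounded_bilinear_dot: "bounded_bilinear (dot :: complex^'n \<Rightarrow> complex^'n \<Rightarrow> complex)"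
  unfolding bilinear_conv_bounded_bilinear [symmetric] bilinear_def
  by (auto intro!: linearI simp: dot_def algebra_simps sum.distrib scaleR_sum_right)

lemmas has_derivative_matrix_vector = bounded_bilinear.FDERIV [OF bounded_bilinear_matrix_vector]

text \<open>Where one factor vanishes, continuity of the other replaces differentiability in the
  product rule, since its derivative would be multiplied by zero.\<close>

lemma has_derivative_vanishing_factor:
  assumes mul: "bounded_bilinear mul" and "isCont B x"
    and G: "(G has_derivative G') (at x)" and "G x = 0"
  shows "((\<lambda>y. mul (B y) (G y)) has_derivative (\<lambda>h. mul (B x) (G' h))) (at x)"
proof -
  interpret bounded_bilinear mul by fact
  obtain K where K: "0 < K" "\<And>a b. norm (mul a b) \<le> norm a * norm b * K"
    using pos_bounded by blast
  obtain C where C: "0 < C" "\<And>h. norm (G' h) \<le> norm h * C"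
    using bounded_linear.pos_bounded [OF has_derivative_bounded_linear [OF G]] by blast
  have "((\<lambda>y. mul (B y - B x) (G y)) has_derivative (\<lambda>h. 0)) (at x)"
    unfolding has_derivative_at_alt
  proof (intro conjI allI impI)
    fix e :: real assume "0 < e"
    \<comment> \<open>Near \<open>x\<close> the second factor is at most
      \<open>(C + 1) * norm (y - x)\<close>: \<open>C\<close> bounds its derivative and 1 is the
      tolerance allowed for the remainder. \<open>K\<close> is the constant of the product.\<close>
    define e' where "e' = e / ((C + 1) * K)"
    have e': "0 < e'" using \<open>0 < e\<close> C K by (simp add: e'_def)
    have "eventually (\<lambda>y. norm (B y - B x) < e') (nhds x)"
      using \<open>isCont B x\<close> e' unfolding isCont_def tendsto_at_iff_tendsto_nhds
      by (auto simp: tendsto_iff dist_norm)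
    then obtain d1 where d1: "0 < d1" "\<And>y. norm (y - x) < d1 \<Longrightarrow> norm (B y - B x) < e'"
      unfolding eventually_nhds_metric dist_norm by blast
    obtain d2 where d2: "0 < d2"
      "\<And>y. norm (y - x) < d2 \<Longrightarrow> norm (G y - G x - G' (y - x)) \<le> 1 * norm (y - x)"
      using G zero_less_one unfolding has_derivative_at_alt by blast
    have "norm (mul (B y - B x) (G y) - mul (B x - B x) (G x) - 0) \<le> e * norm (y - x)"
      if "norm (y - x) < min d1 d2" for y
    proof -
      have "norm (G y) \<le> norm (G y - G x - G' (y - x)) + norm (G' (y - x))"
        using norm_triangle_ineq [of "G y - G x - G' (y - x)" "G' (y - x)"] \<open>G x = 0\<close> by simp
      also have "\<dots> \<le> (C + 1) * norm (y - x)"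
        using d2(2) [of y] C(2) [of "y - x"] that by (simp add: algebra_simps)
      finally have "norm (mul (B y - B x) (G y)) \<le> e' * ((C + 1) * norm (y - x)) * K"
        using d1(2) [of y] that K C e'
        by (intro order_trans [OF K(2)] mult_right_mono mult_mono) auto
      also have "\<dots> = e * norm (y - x)"
        using C K by (simp add: e'_def)
      finally show ?thesis by (simp add: zero_left)
    qed
    then show "\<exists>d>0. \<forall>y. norm (y - x) < d \<longrightarrow>
        norm (mul (B y - B x) (G y) - mul (B x - B x) (G x) - 0) \<le> e * norm (y - x)"
      using d1(1) d2(1) by (intro exI [of _ "min d1 d2"]) auto
  qed auto
  moreover have "((\<lambda>y. mul (B x) (G y)) has_derivative (\<lambda>h. mul (B x) (G' h))) (at x)"
    by (rule bounded_linear.has_derivative [OF bounded_linear_right G])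
  ultimately have "((\<lambda>y. mul (B y - B x) (G y) + mul (B x) (G y)) has_derivative
      (\<lambda>h. 0 + mul (B x) (G' h))) (at x)"
    by (rule has_derivative_add)
  then show ?thesis by (simp add: diff_left)
qed

lemma matrix_inv_mult:
  fixes A :: "complex^'n^'n"
  assumes "invertible A" shows "A ** matrix_inv A = mat 1" "matrix_inv A ** A = mat 1"
  using assms unfolding invertible_def matrix_inv_def by (metis (mono_tags, lifting) someI_ex)+

text \<open>The resolvent identity, bracketed so that the variable inverse stands in front of a
  factor vanishing at the base point.\<close>

lemma matrix_inv_diff:
  fixes A B :: "complex^'n^'n"
  assumes "invertible A" "invertible B"
  shows "matrix_inv A - matrix_inv B = matrix_inv A ** ((B - A) ** matrix_inv B)"
  using matrix_inv_mult [OF assms(1)] matrix_inv_mult [OF assms(2)]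
  by (simp add: bounded_bilinear.diff_left [OF bounded_bilinear_matrix_matrix]
      bounded_bilinear.diff_right [OF bounded_bilinear_matrix_matrix] matrix_mul_assoc)

text \<open>The resolvent identity bounds the increment of the inverse by a multiple of the inverse
  itself, which is not known to be bounded. Close to \<open>x\<close> that multiple is at most 1/2,
  so the unknown norm can be absorbed; the bound obtained then gives convergence.\<close>

lemma isCont_matrix_inv:
  fixes M :: "'a::real_normed_vector \<Rightarrow> complex^'n^'n"
  assumes cont: "isCont M x" and inv: "\<And>y. invertible (M y)"
  shows "isCont (\<lambda>y. matrix_inv (M y)) x"
proof -
  define B where "B y = matrix_inv (M y)" for y
  obtain K where K: "0 < K"
    "\<And>(a :: complex^'n^'n) (b :: complex^'n^'n). norm (a ** b) \<le> norm a * norm b * K"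
    using bounded_bilinear.pos_bounded [OF bounded_bilinear_matrix_matrix] by blast
  define b where "b = norm (B x) + 1"
  have b: "0 < b" "norm (B x) \<le> b" by (auto simp: b_def add_nonneg_pos)
  have bound: "norm (B y - B x) \<le> norm (B y) * norm (M y - M x) * (K * K * b)" for y
  proof -
    have "norm (B y - B x) \<le> norm (B y) * norm ((M x - M y) ** B x) * K"
      unfolding B_def matrix_inv_diff [OF inv inv] by (rule K(2))
    also have "\<dots> \<le> norm (B y) * (norm (M x - M y) * norm (B x) * K) * K"
      using K by (intro mult_right_mono mult_left_mono) auto
    also have "\<dots> \<le> norm (B y) * (norm (M x - M y) * b * K) * K"
      using K b by (intro mult_right_mono mult_left_mono) auto
    finally show ?thesis by (simp add: norm_minus_commute mult_ac)
  qed
  have tend: "((\<lambda>y. norm (M y - M x)) \<longlongrightarrow> 0) (at x)"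
    using cont unfolding isCont_def by (intro tendsto_norm_zero LIM_zero)
  have "eventually (\<lambda>y. norm (M y - M x) < 1 / (2 * (K * K * b))) (at x)"
    using order_tendstoD(2) [OF tend, of "1 / (2 * (K * K * b))"] K b by simp
  then have "eventually (\<lambda>y. norm (B y - B x) \<le> 2 * b * norm (M y - M x) * (K * K * b)) (at x)"
  proof (rule eventually_mono)
    fix y assume y: "norm (M y - M x) < 1 / (2 * (K * K * b))"
    have "norm (M y - M x) * (K * K * b) \<le> 1 / 2"
      using y K b by (simp add: field_simps)
    then have "norm (B y) * (norm (M y - M x) * (K * K * b)) \<le> norm (B y) * (1 / 2)"
      by (rule mult_left_mono) simp
    then have "norm (B y - B x) \<le> norm (B y) / 2"
      using bound [of y] by (simp add: mult.assoc)
    then have "norm (B y) \<le> 2 * b"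
      using norm_triangle_ineq2 [of "B y" "B x"] b(2) by linarith
    then have "norm (B y) * norm (M y - M x) * (K * K * b) \<le> 2 * b * norm (M y - M x) * (K * K * b)"
      using K b by (intro mult_right_mono) auto
    with bound [of y] show "norm (B y - B x) \<le> 2 * b * norm (M y - M x) * (K * K * b)" by linarith
  qed
  moreover have "((\<lambda>y. 2 * b * norm (M y - M x) * (K * K * b)) \<longlongrightarrow> 0) (at x)"
    using tendsto_mult_left [OF tendsto_mult_right [OF tend, of "K * K * b"], of "2 * b"]
    by (simp add: mult.assoc)
  ultimately have "((\<lambda>y. B y - B x) \<longlongrightarrow> 0) (at x)"
    by (rule Lim_null_comparison)
  then show ?thesis
    unfolding isCont_def B_def by (simp add: LIM_zero_iff)
qed

text \<open>In the resolvent identity the factor \<open>(M x - M y) ** ?B x\<close> vanishes at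
  \<open>x\<close>, so continuity of the inverse suffices. Invertibility at every argument fits the
  use, as \<open>metric_matrix\<close> is invertible at every point of the manifold.\<close>

lemma has_derivative_matrix_inv:
  fixes M :: "'a::real_normed_vector \<Rightarrow> complex^'n^'n"
  assumes M: "(M has_derivative M') (at x)" and inv: "\<And>y. invertible (M y)"
  shows "((\<lambda>y. matrix_inv (M y)) has_derivative
     (\<lambda>h. - (matrix_inv (M x) ** (M' h ** matrix_inv (M x))))) (at x)"
proof -
  let ?B = "\<lambda>y. matrix_inv (M y)"
  have G: "((\<lambda>y. (M x - M y) ** ?B x) has_derivative (\<lambda>h. (- M' h) ** ?B x)) (at x)"
    by (rule bounded_linear.has_derivative [OF bounded_bilinear.bounded_linear_left
          [OF bounded_bilinear_matrix_matrix]])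
      (auto intro!: derivative_eq_intros M)
  have "((\<lambda>y. ?B y ** ((M x - M y) ** ?B x)) has_derivative (\<lambda>h. ?B x ** ((- M' h) ** ?B x))) (at x)"
    by (rule has_derivative_vanishing_factor [OF bounded_bilinear_matrix_matrix
          isCont_matrix_inv [OF has_derivative_continuous [OF M] inv] G])
      (simp add: bounded_bilinear.zero_left [OF bounded_bilinear_matrix_matrix])
  then have "((\<lambda>y. ?B y - ?B x) has_derivative (\<lambda>h. ?B x ** ((- M' h) ** ?B x))) (at x)"
    by (simp add: matrix_inv_diff [OF inv inv])
  then have "((\<lambda>y. (?B y - ?B x) + ?B x) has_derivative (\<lambda>h. ?B x ** ((- M' h) ** ?B x) + 0)) (at x)"
    by (rule has_derivative_add) simp
  then show ?thesis
    by (simp add: bounded_bilinear.minus_left [OF bounded_bilinear_matrix_matrix]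
        bounded_bilinear.minus_right [OF bounded_bilinear_matrix_matrix])
qed

section \<open>Christoffel symbols and curvature in special coordinates\<close>

lemma matrix_vector_mult_simps:
  fixes A B :: "complex^'n^'m"
  shows "A *v (x + y) = A *v x + A *v y" "A *v (x - y) = A *v x - A *v y" "A *v (- x) = - (A *v x)"
    "A *v (c *s x) = c *s (A *v x)" "(A + B) *v x = A *v x + B *v x" "(A - B) *v x = A *v x - B *v x"
    "(- A) *v x = - (A *v x)" "A *v 0 = 0" "0 *v x = (0 :: complex^'m)"
  by (simp_all add: vec_eq_iff matrix_vector_mult_def algebra_simps sum.distrib sum_subtractf
      sum_negf sum_distrib_left)

lemma transpose_cnjm: "transpose A = A \<Longrightarrow> transpose (cnjm A) = cnjm A"
  by (simp add: transpose_def cnjm_def vec_eq_iff)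

context special_kaehler_manifold
begin

definition metric_matrix :: "'x \<Rightarrow> complex^'r^'r" where
  "metric_matrix p = imm (period_map X p)"

definition metric_inverse :: "'x \<Rightarrow> complex^'r^'r" where
  "metric_inverse p = matrix_inv (metric_matrix p)"

definition dtau :: "'x \<Rightarrow> complex^'r \<Rightarrow> complex^'r^'r" where
  "dtau p v = (\<chi> i j. \<Sum>k\<in>UNIV. v $ k * pd k (\<lambda>q. period_map X q $ i $ j) p)"

text \<open>\<open>d2tau p u v\<close> is the derivative in direction \<open>u\<close> of \<open>d\<tau>(v)\<close> with \<open>v\<close> held constant.\<close>

definition d2tau :: "'x \<Rightarrow> complex^'r \<Rightarrow> complex^'r \<Rightarrow> complex^'r^'r" where
  "d2tau p u v = (\<chi> i j. \<Sum>k\<in>UNIV. v $ k *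
     (\<Sum>l\<in>UNIV. u $ l * pd l (pd k (\<lambda>q. period_map X q $ i $ j)) p))"

definition herm :: "'x \<Rightarrow> complex^'r \<Rightarrow> complex^'r \<Rightarrow> complex" where
  "herm p v w = dot (metric_matrix p *v v) (cnjv w)"

definition christoffel_form :: "'x \<Rightarrow> complex^'r \<Rightarrow> complex^'r \<Rightarrow> complex^'r" where
  "christoffel_form p v w = (1 / (2 * \<i>)) *s (metric_inverse p *v (dtau p v *v w))"

lemma transpose_metric_matrix: "transpose (metric_matrix p) = metric_matrix p"
  by (simp add: metric_matrix_def imm_def transpose_def vec_eq_iff) (metis period_map_symmetric)

lemma transpose_dtau: "transpose (dtau p v) = dtau p v"
  by (simp add: dtau_def transpose_def vec_eq_iff pd_period_map_symmetric(1) [symmetric])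

lemma dtau_commute: "dtau p v *v w = dtau p w *v v"
proof -
  have "(dtau p v *v w) $ i = (dtau p w *v v) $ i" for i
  proof -
    have "(dtau p v *v w) $ i = (\<Sum>j\<in>UNIV. \<Sum>k\<in>UNIV. v $ k * pd k (\<lambda>q. period_map X q $ i $ j) p * w $ j)"
      by (simp add: dtau_def matrix_vector_mult_def sum_distrib_right)
    also have "\<dots> = (\<Sum>k\<in>UNIV. \<Sum>j\<in>UNIV. v $ k * pd k (\<lambda>q. period_map X q $ i $ j) p * w $ j)"
      by (rule sum.swap)
    also have "\<dots> = (\<Sum>k\<in>UNIV. \<Sum>j\<in>UNIV. w $ j * pd j (\<lambda>q. period_map X q $ i $ k) p * v $ k)"
      by (intro sum.cong refl) (simp only: pd_period_map_symmetric(2) [of _ i] mult_ac)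
    also have "\<dots> = (dtau p w *v v) $ i"
      by (simp add: dtau_def matrix_vector_mult_def sum_distrib_right)
    finally show ?thesis .
  qed
  then show ?thesis by (simp add: vec_eq_iff)
qed

lemma dtau_scale: "dtau p (c *s v) *v w = c *s (dtau p v *v w)"
  by (simp add: dtau_commute [of p _ w] matrix_vector_mult_simps)

lemma d2tau_commute: "d2tau p u v = d2tau p v u"
proof -
  have "(\<Sum>k\<in>UNIV. v $ k * (\<Sum>l\<in>UNIV. u $ l * pd l (pd k (\<lambda>q. period_map X q $ i $ j)) p)) =
      (\<Sum>l\<in>UNIV. u $ l * (\<Sum>k\<in>UNIV. v $ k * pd k (pd l (\<lambda>q. period_map X q $ i $ j)) p))" for i j
    unfolding sum_distrib_left
    by (subst sum.swap, intro sum.cong refl, subst pd_commute [OF holo_period_map]) (simp only: mult_ac)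
  then show ?thesis by (simp add: d2tau_def)
qed

lemma dot_dtau: "dot (dtau p v *v x) y = dot x (dtau p v *v y)"
  by (rule dot_symmetric_matrix [OF transpose_dtau])

lemma dot_metric_matrix: "dot (metric_matrix p *v x) y = dot x (metric_matrix p *v y)"
  by (rule dot_symmetric_matrix [OF transpose_metric_matrix])

lemma cnjv_metric_matrix: "cnjv (metric_matrix p *v x) = metric_matrix p *v cnjv x"
  by (simp add: cnjv_matrix_vector metric_matrix_def cnjm_imm)

lemma herm_simps:
  "herm p (c *s v) w = c * herm p v w" "herm p v (c *s w) = cnj c * herm p v w"
  "herm p (v + v') w = herm p v w + herm p v' w" "herm p v (w + w') = herm p v w + herm p v w'"
  "herm p (v - v') w = herm p v w - herm p v' w" "herm p v (w - w') = herm p v w - herm p v w'"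
  "herm p (- v) w = - herm p v w" "herm p 0 w = 0" "herm p v 0 = 0"
  by (simp_all add: herm_def matrix_vector_mult_simps dot_simps cnjv_simps)

lemma herm_cnj: "cnj (herm p v w) = herm p w v"
  unfolding herm_def cnj_dot cnjv_metric_matrix cnjv_simps
  by (simp only: dot_metric_matrix [of p "cnjv v" w] dot_commute [of "cnjv v"])

text \<open>Membership in \<open>siegel\<close> gives positivity on real vectors only. On a complex
  vector the products of a real with an imaginary part contribute only to the imaginary part of the
  form, leaving the sum of the values at the two real vectors.\<close>

lemma herm_positive: assumes "v \<noteq> 0" shows "0 < Re (herm p v v)"
proof -
  define x :: "real^'r" where "x = (\<chi> i. Re (v $ i))"
  define y :: "real^'r" where "y = (\<chi> i. Im (v $ i))"
  let ?Z = "map_matrix Im (period_map X p)"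
  have *: "Re (of_real (Im a) * b * cnj c) = Re c * (Im a * Re b) + Im c * (Im a * Im b)" for a b c
    by (simp add: algebra_simps)
  have "Re (herm p v v) = (\<Sum>i\<in>UNIV. \<Sum>j\<in>UNIV. Re (v $ i) * (Im (period_map X p $ i $ j) * Re (v $ j))
      + Im (v $ i) * (Im (period_map X p $ i $ j) * Im (v $ j)))"
    unfolding herm_def dot_def metric_matrix_def imm_def cnjv_def matrix_vector_mult_def vec_lambda_beta
      sum_distrib_right Re_sum * ..
  also have "\<dots> = x \<bullet> (?Z *v x) + y \<bullet> (?Z *v y)"
    by (simp add: x_def y_def inner_vec_def matrix_vector_mult_def map_matrix_def sum.distrib sum_distrib_left)
  finally have eq: "Re (herm p v v) = x \<bullet> (?Z *v x) + y \<bullet> (?Z *v y)" .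
  have pos: "u \<noteq> 0 \<Longrightarrow> 0 < u \<bullet> (?Z *v u)" for u
    using period_map_siegel [of p] by (simp add: siegel_def)
  then have nonneg: "0 \<le> u \<bullet> (?Z *v u)" for u
    by (cases "u = 0") (auto simp: less_imp_le)
  have "x \<noteq> 0 \<or> y \<noteq> 0"
    using assms by (auto simp: x_def y_def vec_eq_iff complex_eq_iff)
  then show ?thesis
    unfolding eq using pos nonneg by (meson add_nonneg_pos add_pos_nonneg)
qed

lemma herm_nondegenerate: assumes "\<And>u. Re (herm p v u) = 0" shows "v = 0"
  using herm_positive assms by (metis less_irrefl)

lemma metric_matrix_invertible: "invertible (metric_matrix p)"
proof -
  have "v = 0" if "metric_matrix p *v v = 0" for v
    by (rule herm_nondegenerate [of p]) (simp add: herm_def that dot_simps)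
  then show ?thesis
    unfolding invertible_left_inverse using matrix_left_invertible_ker [of "metric_matrix p"] by blast
qed

lemma metric_inverse_cancel:
  "metric_matrix p *v (metric_inverse p *v x) = x" "metric_inverse p *v (metric_matrix p *v x) = x"
  using matrix_inv_mult [OF metric_matrix_invertible [of p]]
  by (simp_all add: metric_inverse_def matrix_vector_mul_assoc)

lemma herm_metric_inverse: "herm p (metric_inverse p *v x) w = dot x (cnjv w)"
  by (simp add: herm_def metric_inverse_cancel)

text \<open>The squared norm on covectors, where the values of \<open>dtau p v *v w\<close>
  belong.\<close>

definition conorm :: "'x \<Rightarrow> complex^'r \<Rightarrow> real" where
  "conorm p x = Re (dot (metric_inverse p *v x) (cnjv x))"

lemma conorm_eq_herm: "conorm p x = Re (herm p (metric_inverse p *v x) (metric_inverse p *v x))"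
proof -
  have "dot (metric_inverse p *v x) (cnjv x) =
      dot (metric_inverse p *v x) (metric_matrix p *v cnjv (metric_inverse p *v x))"
    unfolding cnjv_metric_matrix [symmetric] metric_inverse_cancel ..
  then show ?thesis
    by (simp add: conorm_def herm_def dot_metric_matrix)
qed

lemma conorm_positive: assumes "x \<noteq> 0" shows "0 < conorm p x"
proof -
  have "metric_inverse p *v x \<noteq> 0"
    using assms metric_inverse_cancel(1) [of p x] by (auto simp: matrix_vector_mult_simps)
  then show ?thesis unfolding conorm_eq_herm by (rule herm_positive)
qed

section \<open>The metric and its derivatives in special coordinates\<close>

lemma sk_metric_eq:
  "sk_metric X \<kappa> z v w = Re (herm (param \<kappa> z)
     (differential \<kappa> (a_periods X) (param \<kappa> z) v) (differential \<kappa> (a_periods X) (param \<kappa> z) w))"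
proof -
  let ?p = "param \<kappa> z"
  let ?v = "differential \<kappa> (a_periods X) ?p v" and ?w = "differential \<kappa> (a_periods X) ?p w"
  have "herm ?p ?v ?w = dot ?v (metric_matrix ?p *v cnjv ?w)"
    by (simp add: herm_def dot_metric_matrix)
  also have "\<dots> = (\<Sum>i\<in>UNIV. \<Sum>j\<in>UNIV.
      complex_of_real (Im (period_map X ?p $ i $ j)) * ?v $ i * cnj (?w $ j))"
    by (simp add: dot_def metric_matrix_def imm_def cnjv_def matrix_vector_mult_def sum_distrib_left mult_ac)
  finally show ?thesis
    by (simp add: sk_metric_def Let_def)
qed

lemma sk_metric_special:
  assumes "special U" "z \<in> a_periods X ` U"
  shows "sk_metric X (U, a_periods X) z v w = Re (herm (point U z) v w)"
  by (simp add: sk_metric_eq differential_special [OF assms(1) point_in [OF assms]])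

lemma metric_matrix_has_derivative:
  assumes "special U" "p \<in> U"
  shows "((\<lambda>z. metric_matrix (point U z)) has_derivative (\<lambda>h. imm (dtau p h))) (at (a_periods X p))"
proof (intro has_derivative_vec_componentwise)
  fix i j
  have bl: "bounded_linear (\<lambda>x. complex_of_real (Im x))"
    by (rule bounded_linear_compose [OF bounded_linear_of_real bounded_linear_Im])
  show "((\<lambda>z. metric_matrix (point U z) $ i $ j) has_derivative (\<lambda>h. imm (dtau p h) $ i $ j)) (at (a_periods X p))"
    using bounded_linear.has_derivative [OF bl holo_has_derivative [OF holo_period_map assms, of i j]]
    by (simp add: metric_matrix_def imm_def dtau_def o_def)
qed

lemma dtau_has_derivative:
  assumes "special U" "p \<in> U"
  shows "((\<lambda>z. dtau (point U z) v) has_derivative (\<lambda>h. d2tau p h v)) (at (a_periods X p))"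
proof (intro has_derivative_vec_componentwise)
  fix i j
  have *: "((\<lambda>z. v $ k * pd k (\<lambda>q. period_map X q $ i $ j) (point U z)) has_derivative
      (\<lambda>h. v $ k * (\<Sum>l\<in>UNIV. h $ l * pd l (pd k (\<lambda>q. period_map X q $ i $ j)) p))) (at (a_periods X p))" for k
    by (rule has_derivative_mult_right
        [OF holo_has_derivative [OF holo_pd [OF holo_period_map] assms, unfolded o_def]])
  show "((\<lambda>z. dtau (point U z) v $ i $ j) has_derivative (\<lambda>h. d2tau p h v $ i $ j)) (at (a_periods X p))"
    unfolding dtau_def d2tau_def vec_lambda_beta by (rule has_derivative_sum) (rule *)
qed

lemma metric_inverse_has_derivative:
  assumes "special U" "p \<in> U"
  shows "((\<lambda>z. metric_inverse (point U z)) has_derivative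
    (\<lambda>h. - (metric_inverse p ** (imm (dtau p h) ** metric_inverse p)))) (at (a_periods X p))"
  unfolding metric_inverse_def
  using has_derivative_matrix_inv [OF metric_matrix_has_derivative [OF assms] metric_matrix_invertible]
  by (simp add: point_a_periods [OF assms])

text \<open>The third derivative of the prepotential, as a trilinear form.\<close>

definition cubic :: "'x \<Rightarrow> complex^'r \<Rightarrow> complex^'r \<Rightarrow> complex^'r \<Rightarrow> complex" where
  "cubic p u v w = dot (dtau p u *v v) w"

lemma cubic_commute: "cubic p u v w = cubic p v u w" "cubic p u v w = cubic p u w v"
proof -
  show "cubic p u v w = cubic p v u w" unfolding cubic_def by (simp only: dtau_commute [of p u])
  show "cubic p u v w = cubic p u w v" unfolding cubic_def by (simp only: dot_dtau [of p u v w] dot_commute [of v])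
qed

lemma sk_metric_derivative:
  assumes "special U" "p \<in> U"
  shows "frechet_derivative (\<lambda>z. sk_metric X (U, a_periods X) z w u) (at (a_periods X p)) v =
     (Im (cubic p v w (cnjv u)) + Im (cubic p v (cnjv w) u)) / 2"
proof -
  have bl: "bounded_linear (\<lambda>A. Re (dot (A *v w) (cnjv u)))"
    by (intro bounded_linear_compose [OF bounded_linear_Re]
        bounded_linear_compose [OF bounded_bilinear.bounded_linear_left [OF bounded_bilinear_dot]]
        bounded_bilinear.bounded_linear_left [OF bounded_bilinear_matrix_vector])
  have "((\<lambda>z. Re (herm (point U z) w u)) has_derivative (\<lambda>h. Re (dot (imm (dtau p h) *v w) (cnjv u))))
      (at (a_periods X p))"
    unfolding herm_def by (rule bounded_linear.has_derivative [OF bl metric_matrix_has_derivative [OF assms]])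
  then have "((\<lambda>z. sk_metric X (U, a_periods X) z w u) has_derivative
      (\<lambda>h. Re (dot (imm (dtau p h) *v w) (cnjv u)))) (at (a_periods X p))"
    by (rule has_derivative_transform_within_open [OF _ special_open(2) [OF assms(1)]])
      (use assms sk_metric_special in auto)
  from frechet_derivative_at [OF this, symmetric] show ?thesis
    by (simp add: Re_dot_imm cubic_def)
qed

lemma christoffel_special:
  assumes "special U" "p \<in> U"
  shows "christoffel UNIV (sk_metric X (U, a_periods X)) (a_periods X p) v w = christoffel_form p v w"
proof -
  let ?G = "sk_metric X (U, a_periods X)"
  have G: "?G (a_periods X p) x u = Re (herm p x u)" for x u
    using sk_metric_special assms point_a_periods by simp
  have K: "(frechet_derivative (\<lambda>y. ?G y w u) (at (a_periods X p)) v
      + frechet_derivative (\<lambda>y. ?G y v u) (at (a_periods X p)) w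
      - frechet_derivative (\<lambda>y. ?G y v w) (at (a_periods X p)) u) / 2 = Im (cubic p v w (cnjv u)) / 2" for u
  proof -
    \<comment> \<open>Of the six cubic values in the Koszul formula, \<open>a\<close> is the one
      with \<open>u\<close> conjugated, while \<open>b\<close> and \<open>d\<close> have
      \<open>w\<close> or \<open>v\<close> conjugated and cancel. What remains is complex-linear in
      \<open>v\<close> and \<open>w\<close>, and so is the Christoffel form.\<close>
    have arith: "((a + b) / 2 + (a + d) / 2 - (b + d) / 2) / 2 = a / 2" for a b d :: real
      by (simp add: field_simps)
    have eqs: "cubic p v (cnjv w) u = cubic p u v (cnjv w)" "cubic p w (cnjv v) u = cubic p u (cnjv v) w"
      "cubic p w v (cnjv u) = cubic p v w (cnjv u)"
      by (metis cubic_commute)+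
    show ?thesis
      unfolding sk_metric_derivative [OF assms] eqs by (rule arith)
  qed
  have \<Gamma>: "Re (herm p (christoffel_form p v w) u) = Im (cubic p v w (cnjv u)) / 2" for u
    unfolding christoffel_form_def herm_simps herm_metric_inverse cubic_def [symmetric]
    by (simp add: Re_divide Im_divide)
  show ?thesis
    unfolding christoffel_def G K
  proof (rule the_equality)
    fix x assume "x \<in> UNIV \<and> (\<forall>u\<in>UNIV. Re (herm p x u) = Im (cubic p v w (cnjv u)) / 2)"
    then have "Re (herm p (x - christoffel_form p v w) u) = 0" for u
      by (simp add: herm_simps \<Gamma>)
    from herm_nondegenerate [OF this] show "x = christoffel_form p v w" by simp
  qed (simp add: \<Gamma>)
qed

text \<open>With \<open>c = 1/(2\<i>)\<close> and \<open>T = d\<tau>\<close>, the terms \<open>c\<^sup>2 Y\<^sup>-\<^sup>1 T(u) Y\<^sup>-\<^sup>1 T(v)\<close> coming from the product of two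
  Christoffel symbols cancel against the holomorphic half of \<open>Im T(u) = c (T(u) - cnj T(u))\<close>, and
  the second derivatives of \<open>\<tau>\<close> cancel by symmetry.\<close>

lemma curvature_special:
  assumes "special U" "p \<in> U"
  shows "curvature (sk_metric X (U, a_periods X)) (a_periods X p) u v w = (- 1 / 4) *s
    (metric_inverse p *v
      (cnjm (dtau p u) *v (metric_inverse p *v (dtau p v *v w))
     - cnjm (dtau p v) *v (metric_inverse p *v (dtau p u *v w))))"
proof -
  let ?G = "sk_metric X (U, a_periods X)" and ?P = "metric_inverse p"
  let ?D = "\<lambda>v u. (1 / (2 * \<i>)) *s (?P *v (d2tau p u v *v w)
      - (?P ** (imm (dtau p u) ** ?P)) *v (dtau p v *v w))"
  have D: "frechet_derivative (\<lambda>y. christoffel UNIV ?G y v w) (at (a_periods X p)) u = ?D v u" for v u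
  proof -
    have 1: "((\<lambda>z. dtau (point U z) v *v w) has_derivative (\<lambda>h. d2tau p h v *v w)) (at (a_periods X p))"
      by (rule bounded_linear.has_derivative [OF bounded_bilinear.bounded_linear_left
            [OF bounded_bilinear_matrix_vector] dtau_has_derivative [OF assms]])
    have "((\<lambda>z. metric_inverse (point U z) *v (dtau (point U z) v *v w)) has_derivative
        (\<lambda>h. metric_inverse (point U (a_periods X p)) *v (d2tau p h v *v w)
          + (- (?P ** (imm (dtau p h) ** ?P))) *v (dtau (point U (a_periods X p)) v *v w))) (at (a_periods X p))"
      by (rule has_derivative_matrix_vector [OF metric_inverse_has_derivative [OF assms] 1])
    from bounded_linear.has_derivative [OF bounded_linear_vector_scalar_mult_right this, of "1 / (2 * \<i>)"]
    have "((\<lambda>z. christoffel_form (point U z) v w) has_derivative ?D v) (at (a_periods X p))"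
      unfolding christoffel_form_def point_a_periods [OF assms] matrix_vector_mult_simps(7) by simp
    then have "((\<lambda>y. christoffel UNIV ?G y v w) has_derivative ?D v) (at (a_periods X p))"
      by (rule has_derivative_transform_within_open [OF _ special_open(2) [OF assms(1)]])
        (use assms christoffel_special point_a_periods in auto)
    from fun_cong [OF frechet_derivative_at [OF this, symmetric], of u] show ?thesis .
  qed
  have key: "c *s (?P *v e - ?P *v (c *s (a - b))) - c *s (?P *v e - ?P *v (c *s (a' - b')))
      + c *s (?P *v (c *s a)) - c *s (?P *v (c *s a')) = (c * c) *s (?P *v (b - b'))"
    for c e a b a' b'
    unfolding matrix_vector_mult_simps by (simp add: vec_eq_iff algebra_simps)
  have c: "(1 / (2 * \<i>)) * (1 / (2 * \<i>)) = - 1 / 4" by simp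
  show ?thesis
    unfolding curvature_def D christoffel_special [OF assms] christoffel_form_def
      d2tau_commute [of p v u] matrix_vector_mul_assoc [symmetric] imm_matrix_vector
      matrix_vector_mult_simps(4) [of "dtau p _"] key c ..
qed

lemma curvature_pairing:
  assumes "special U" "p \<in> U"
  shows "Re (herm p (curvature (sk_metric X (U, a_periods X)) (a_periods X p) V c c) V) =
    (conorm p (dtau p c *v V)
      - Re (dot (metric_inverse p *v (dtau p c *v c)) (cnjv (dtau p V *v V)))) / 4"
proof -
  \<comment> \<open>Moving the conjugate matrix to the other side produces a square from one
    curvature term (\<open>x = c\<close>) and the pairing of T(c) c with T(V) V from the other
    (\<open>x = V\<close>).\<close>
  have "dot (cnjm (dtau p x) *v y) (cnjv V) = dot y (cnjv (dtau p x *v V))" for x y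
    unfolding cnjv_matrix_vector by (rule dot_symmetric_matrix [OF transpose_cnjm [OF transpose_dtau]])
  note adjoint = this
  have arith: "Re ((- 1 / 4) * (x - y)) = (Re y - Re x) / 4" for x y
    by (simp add: field_simps)
  show ?thesis
    unfolding curvature_special [OF assms] herm_simps herm_metric_inverse dot_simps conorm_def
      dtau_commute [of p V c] adjoint arith ..
qed

end

section \<open>Linear differential equations\<close>

text \<open>The inductive step of the Picard estimate: the bound on the derivative is the derivative
  of the claimed bound. The absolute value forces separate comparison functions to the right and to
  the left of \<open>t0\<close>.\<close>

lemma factorial_power_bound:
  fixes f :: "real \<Rightarrow> 'a::real_normed_vector"
  assumes der: "\<And>t. t \<in> {a..b} \<Longrightarrow> (f has_vector_derivative f' t) (at t within {a..b})"
    and bound: "\<And>t. t \<in> {a..b} \<Longrightarrow> norm (f' t) \<le> C * M * (M * \<bar>t - t0\<bar>) ^ n / fact n"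
    and t0: "t0 \<in> {a..b}" "f t0 = 0" and t: "t \<in> {a..b}"
  shows "norm (f t) \<le> C * (M * \<bar>t - t0\<bar>) ^ Suc n / fact (Suc n)"
proof -
  have der': "(f has_vector_derivative f' s) (at s)" if "a < s" "s < b" for s
    using der [of s] that at_within_Icc_at [of a s b] by simp
  have cont: "continuous_on {a..b} f"
    using der has_vector_derivative_continuous continuous_on_eq_continuous_within by blast
  consider "t = t0" | "t0 < t" | "t < t0" by linarith
  then show ?thesis
  proof cases
    case 1 then show ?thesis using t0 by simp
  next
    case 2
    let ?\<phi> = "\<lambda>s. C * (M * (s - t0)) ^ Suc n / fact (Suc n)"
    have "norm (f t - f t0) \<le> ?\<phi> t - ?\<phi> t0"
    proof (rule differentiable_bound_general [OF 2])
      show "continuous_on {t0..t} f"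
        using t t0 by (intro continuous_on_subset [OF cont]) auto
      show "continuous_on {t0..t} ?\<phi>" by (intro continuous_intros) auto
      fix s assume s: "t0 < s" "s < t"
      show "(f has_vector_derivative f' s) (at s)"
        using s t t0 by (intro der') auto
      have "((\<lambda>s. M * (s - t0)) has_field_derivative M) (at s)"
        by (auto intro!: derivative_eq_intros)
      from DERIV_cdivide [OF DERIV_cmult [OF DERIV_power_Suc [OF this]]]
      have "(?\<phi> has_field_derivative C * ((1 + real n) * (M * (M * (s - t0)) ^ n)) / fact (Suc n)) (at s)" .
      moreover have "C * ((1 + real n) * (M * (M * (s - t0)) ^ n)) / fact (Suc n)
          = C * M * (M * (s - t0)) ^ n / fact n"
        using fact_Suc [of n, where 'a = real] by (simp add: divide_simps)
      ultimately show "(?\<phi> has_vector_derivative C * M * (M * (s - t0)) ^ n / fact n) (at s)"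
        by (metis has_real_derivative_iff_has_vector_derivative)
      show "norm (f' s) \<le> C * M * (M * (s - t0)) ^ n / fact n"
        using bound [of s] s t t0 by simp
    qed
    then show ?thesis using 2 t0 by simp
  next
    case 3
    let ?\<phi> = "\<lambda>s. - (C * (M * (t0 - s)) ^ Suc n / fact (Suc n))"
    have "norm (f t0 - f t) \<le> ?\<phi> t0 - ?\<phi> t"
    proof (rule differentiable_bound_general [OF 3])
      show "continuous_on {t..t0} f"
        using t t0 by (intro continuous_on_subset [OF cont]) auto
      show "continuous_on {t..t0} ?\<phi>" by (intro continuous_intros) auto
      fix s assume s: "t < s" "s < t0"
      show "(f has_vector_derivative f' s) (at s)"
        using s t t0 by (intro der') auto
      have "((\<lambda>s. M * (t0 - s)) has_field_derivative - M) (at s)"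
        by (auto intro!: derivative_eq_intros)
      from DERIV_minus [OF DERIV_cdivide [OF DERIV_cmult [OF DERIV_power_Suc [OF this]]]]
      have "(?\<phi> has_field_derivative - (C * ((1 + real n) * (- M * (M * (t0 - s)) ^ n)) / fact (Suc n))) (at s)" .
      moreover have "- (C * ((1 + real n) * (- M * (M * (t0 - s)) ^ n)) / fact (Suc n))
          = C * M * (M * (t0 - s)) ^ n / fact n"
        using fact_Suc [of n, where 'a = real] by (simp add: divide_simps)
      ultimately show "(?\<phi> has_vector_derivative C * M * (M * (t0 - s)) ^ n / fact n) (at s)"
        by (metis has_real_derivative_iff_has_vector_derivative)
      show "norm (f' s) \<le> C * M * (M * (t0 - s)) ^ n / fact n"
        using bound [of s] s t t0 by simp
    qed
    then show ?thesis using 3 t0 by simp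
  qed
qed

lemma antiderivative_vanishing_at:
  fixes g :: "real \<Rightarrow> 'a::banach"
  assumes "continuous_on {a..b} g"
  obtains G where "G t0 = 0" "\<And>t. t \<in> {a..b} \<Longrightarrow> (G has_vector_derivative g t) (at t within {a..b})"
proof (rule that [of "\<lambda>t. integral {a..t} g - integral {a..t0} g"])
  show "integral {a..t0} g - integral {a..t0} g = 0" by simp
  fix t assume "t \<in> {a..b}"
  then show "((\<lambda>t. integral {a..t} g - integral {a..t0} g) has_vector_derivative g t) (at t within {a..b})"
    using integral_has_vector_derivative [OF assms] by (auto intro!: derivative_eq_intros)
qed

text \<open>Existence for a linear system by Picard iteration: the \<open>n\<close>-th iterated integral is bounded
  by \<open>(M \<bar>t - t\<^sub>0\<bar>)\<^sup>n / n!\<close>, so their series may be differentiated term by term.\<close>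

lemma linear_ode_solution:
  fixes A :: "real \<Rightarrow> complex^'n^'n"
  assumes A: "continuous_on {a..b} A" and t0: "t0 \<in> {a..b}"
  obtains E where "E t0 = e"
    "\<And>t. t \<in> {a..b} \<Longrightarrow> (E has_vector_derivative A t *v E t) (at t within {a..b})"
proof -
  obtain K where K: "0 < K"
    "\<And>(B :: complex^'n^'n) (x :: complex^'n). norm (B *v x) \<le> norm B * norm x * K"
    using bounded_bilinear.pos_bounded [OF bounded_bilinear_matrix_vector] by blast
  have "bounded (A ` {a..b})"
    by (intro compact_imp_bounded compact_continuous_image A) simp
  then obtain M0 where M0: "\<And>t. t \<in> {a..b} \<Longrightarrow> norm (A t) \<le> M0"
    unfolding bounded_iff by blast
  define M where "M = M0 * K"
  have M: "norm (A t *v x) \<le> M * norm x" if "t \<in> {a..b}" for t x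
  proof -
    have "norm (A t *v x) \<le> norm (A t) * (norm x * K)" using K(2) by (simp add: mult.assoc)
    also have "\<dots> \<le> M0 * (norm x * K)" using M0 [OF that] K(1) by (intro mult_right_mono) auto
    finally show ?thesis by (simp add: M_def mult_ac)
  qed
  have M_nonneg: "0 \<le> M"
    using M0 [OF t0] norm_ge_zero [of "A t0"] K(1) unfolding M_def by (intro mult_nonneg_nonneg) linarith+
  define J where "J g = (SOME G. G t0 = 0 \<and>
    (\<forall>t\<in>{a..b}. (G has_vector_derivative g t) (at t within {a..b})))" for g :: "real \<Rightarrow> complex^'n"
  have J: "J g t0 = 0 \<and> (\<forall>t\<in>{a..b}. (J g has_vector_derivative g t) (at t within {a..b}))"
    if cont_g: "continuous_on {a..b} g" for g
  proof -
    have "\<exists>G. G t0 = 0 \<and> (\<forall>t\<in>{a..b}. (G has_vector_derivative g t) (at t within {a..b}))"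
      using antiderivative_vanishing_at [OF cont_g, of t0] by metis
    from someI_ex [OF this] show ?thesis unfolding J_def .
  qed
  define \<Phi> where "\<Phi> = rec_nat (\<lambda>t. e) (\<lambda>n f. J (\<lambda>t. A t *v f t))"
  have \<Phi>0: "\<Phi> 0 = (\<lambda>t. e)" and \<Phi>Suc: "\<And>n. \<Phi> (Suc n) = J (\<lambda>t. A t *v \<Phi> n t)"
    by (auto simp: \<Phi>_def)
  have cont: "continuous_on {a..b} (\<Phi> n)" for n
  proof (induction n)
    case (Suc n)
    have "continuous_on {a..b} (\<lambda>t. A t *v \<Phi> n t)"
      by (rule bounded_bilinear.continuous_on [OF bounded_bilinear_matrix_vector A Suc])
    from J [OF this] show ?case
      unfolding \<Phi>Suc using has_vector_derivative_continuous continuous_on_eq_continuous_within by blast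
  qed (simp add: \<Phi>0)
  have \<Phi>J: "\<Phi> (Suc n) t0 = 0 \<and>
      (\<forall>t\<in>{a..b}. (\<Phi> (Suc n) has_vector_derivative A t *v \<Phi> n t) (at t within {a..b}))" for n
    unfolding \<Phi>Suc
    by (rule J [OF bounded_bilinear.continuous_on [OF bounded_bilinear_matrix_vector A cont]])
  have bound: "norm (\<Phi> n t) \<le> norm e * (M * \<bar>t - t0\<bar>) ^ n / fact n" if "t \<in> {a..b}" for n t
    using that
  proof (induction n arbitrary: t)
    case (Suc n)
    show ?case
    proof (rule factorial_power_bound [OF _ _ t0 _ Suc.prems])
      fix s assume s: "s \<in> {a..b}"
      show "(\<Phi> (Suc n) has_vector_derivative A s *v \<Phi> n s) (at s within {a..b})"
        using \<Phi>J s by blast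
      have "norm (A s *v \<Phi> n s) \<le> M * (norm e * (M * \<bar>s - t0\<bar>) ^ n / fact n)"
        using order_trans [OF M [OF s] mult_left_mono [OF Suc.IH [OF s] M_nonneg]] .
      then show "norm (A s *v \<Phi> n s) \<le> norm e * M * (M * \<bar>s - t0\<bar>) ^ n / fact n"
        by (simp add: mult_ac)
    qed (use \<Phi>J in blast)
  qed (simp add: \<Phi>0)
  define R where "R n = norm e * ((M * (b - a)) ^ n / fact n)" for n
  have R: "norm (\<Phi> n t) \<le> R n" if "t \<in> {a..b}" for n t
  proof -
    have "(M * \<bar>t - t0\<bar>) ^ n \<le> (M * (b - a)) ^ n"
      using that t0 M_nonneg by (intro power_mono mult_left_mono) auto
    then have "norm e * (M * \<bar>t - t0\<bar>) ^ n / fact n \<le> norm e * (M * (b - a)) ^ n / fact n"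
      by (intro divide_right_mono mult_left_mono) auto
    with bound [OF that, of n] show ?thesis by (simp add: R_def)
  qed
  have "summable R"
    unfolding R_def by (intro summable_mult) (use summable_exp [of "M * (b - a)"] in \<open>simp add: field_simps\<close>)
  define F where "F t = (\<Sum>n. \<Phi> n t)" for t
  have unif: "uniform_limit {a..b} (\<lambda>n t. \<Sum>i<n. \<Phi> i t) F sequentially"
    unfolding F_def by (rule Weierstrass_m_test [OF R \<open>summable R\<close>])
  have sums: "(\<lambda>n. \<Phi> n t) sums F t" if "t \<in> {a..b}" for t
    unfolding sums_def by (rule tendsto_uniform_limitI [OF unif that])
  \<comment> \<open>The derivative of the \<open>n\<close>-th iterate. Differentiation lowers the
    index by one, so partial sums of derivatives lag one term behind, whence \<open>Suc N\<close>
    below.\<close>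
  define \<Psi> where "\<Psi> n t = (case n of 0 \<Rightarrow> 0 | Suc m \<Rightarrow> A t *v \<Phi> m t)" for n t
  have \<Psi>sum: "(\<Sum>i<Suc n. \<Psi> i t) = A t *v (\<Sum>i<n. \<Phi> i t)" for n t
    unfolding sum.lessThan_Suc_shift \<Psi>_def
    by (simp add: linear_sum [OF bounded_linear.linear [OF bounded_linear_matrix_vector]])
  have "\<exists>g. \<forall>t\<in>{a..b}. (\<lambda>n. \<Phi> n t) sums g t \<and>
      (g has_derivative (\<lambda>h. h *\<^sub>R (A t *v F t))) (at t within {a..b})"
  proof (rule has_derivative_series [where f' = "\<lambda>n t h. h *\<^sub>R \<Psi> n t"])
    show "(\<Phi> n has_derivative (\<lambda>h. h *\<^sub>R \<Psi> n t)) (at t within {a..b})" if "t \<in> {a..b}" for n t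
      using \<Phi>J that by (cases n) (auto simp: \<Psi>_def \<Phi>0 has_vector_derivative_def)
    fix \<epsilon> :: real assume "0 < \<epsilon>"
    \<comment> \<open>\<open>M\<close> may be zero; with \<open>M + 1\<close> the quotient makes
      sense and \<open>M\<close> times it is still at most \<open>\<epsilon>\<close>.\<close>
    then have "0 < \<epsilon> / (M + 1)" using M_nonneg by simp
    from uniform_limitD [OF unif this]
    obtain N where N: "\<And>n t. N \<le> n \<Longrightarrow> t \<in> {a..b} \<Longrightarrow> dist (\<Sum>i<n. \<Phi> i t) (F t) < \<epsilon> / (M + 1)"
      unfolding eventually_sequentially by blast
    have "norm ((\<Sum>i<n. h *\<^sub>R \<Psi> i t) - h *\<^sub>R (A t *v F t)) \<le> \<epsilon> * norm h"
      if n: "Suc N \<le> n" and t: "t \<in> {a..b}" for n t h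
    proof -
      obtain m where m: "n = Suc m" "N \<le> m" using n by (cases n) auto
      have "(\<Sum>i<n. h *\<^sub>R \<Psi> i t) - h *\<^sub>R (A t *v F t) = h *\<^sub>R (A t *v ((\<Sum>i<m. \<Phi> i t) - F t))"
        unfolding scaleR_sum_right [symmetric] m(1) \<Psi>sum
        by (simp add: matrix_vector_mult_simps scaleR_diff_right)
      moreover have "norm (A t *v ((\<Sum>i<m. \<Phi> i t) - F t)) \<le> M * (\<epsilon> / (M + 1))"
        using mult_left_mono [OF less_imp_le [OF N [OF m(2) t]] M_nonneg]
        unfolding dist_norm by (rule order_trans [OF M [OF t]])
      moreover have "M * (\<epsilon> / (M + 1)) \<le> \<epsilon>"
        using M_nonneg \<open>0 < \<epsilon>\<close> by (simp add: field_simps)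
      ultimately have "norm ((\<Sum>i<n. h *\<^sub>R \<Psi> i t) - h *\<^sub>R (A t *v F t)) \<le> \<bar>h\<bar> * \<epsilon>"
        by (simp add: mult_left_mono)
      then show ?thesis by (simp add: mult.commute)
    qed
    then show "\<forall>\<^sub>F n in sequentially. \<forall>t\<in>{a..b}. \<forall>h.
        norm ((\<Sum>i<n. h *\<^sub>R \<Psi> i t) - h *\<^sub>R (A t *v F t)) \<le> \<epsilon> * norm h"
      unfolding eventually_sequentially by blast
  qed (use t0 sums in auto)
  then obtain g where g: "\<And>t. t \<in> {a..b} \<Longrightarrow> (\<lambda>n. \<Phi> n t) sums g t"
    "\<And>t. t \<in> {a..b} \<Longrightarrow> (g has_vector_derivative A t *v F t) (at t within {a..b})"
    unfolding has_vector_derivative_def by blast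
  have gF: "g t = F t" if "t \<in> {a..b}" for t
    using g(1) [OF that] sums [OF that] sums_unique2 by blast
  \<comment> \<open>Every iterated integral vanishes at \<open>t0\<close>, so only the constant
    starting function is left there.\<close>
  have "(\<lambda>n. \<Phi> n t0) sums (\<Sum>n\<in>{0}. \<Phi> n t0)"
    by (rule sums_finite) (use \<Phi>J not0_implies_Suc in auto)
  then have "g t0 = e"
    using g(1) [OF t0] sums_unique2 by (fastforce simp: \<Phi>0)
  then show ?thesis
    using that g(2) gF by simp
qed

section \<open>Smoothness along the geodesic\<close>

text \<open>Smoothness is obtained for all functions built from a set \<open>B\<close> at once: if derivatives of
  members of \<open>B\<close> stay in the ring generated by \<open>B\<close>, the ring is closed under derivatives.\<close>

inductive_set func_ring :: "(real \<Rightarrow> complex) set \<Rightarrow> (real \<Rightarrow> complex) set" for B where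
  base: "f \<in> B \<Longrightarrow> f \<in> func_ring B"
| const: "(\<lambda>t. c) \<in> func_ring B"
| add: "f \<in> func_ring B \<Longrightarrow> g \<in> func_ring B \<Longrightarrow> (\<lambda>t. f t + g t) \<in> func_ring B"
| mult: "f \<in> func_ring B \<Longrightarrow> g \<in> func_ring B \<Longrightarrow> (\<lambda>t. f t * g t) \<in> func_ring B"
| cnj: "f \<in> func_ring B \<Longrightarrow> (\<lambda>t. cnj (f t)) \<in> func_ring B"

lemma func_ring_sum:
  assumes "\<And>i. i \<in> I \<Longrightarrow> (\<lambda>t. f i t) \<in> func_ring B"
  shows "(\<lambda>t. \<Sum>i\<in>I. f i t) \<in> func_ring B"
  using assms by (induction I rule: infinite_finite_induct) (auto intro: func_ring.intros)

lemma func_ring_minus: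
  assumes "f \<in> func_ring B" shows "(\<lambda>t. - f t) \<in> func_ring B"
  using func_ring.mult [OF func_ring.const [of "-1"] assms] by simp

lemma func_ring_derivative:
  assumes "\<And>f. f \<in> B \<Longrightarrow> \<exists>g\<in>func_ring B. \<forall>t\<in>T. (f has_vector_derivative g t) (at t within T)"
    and "f \<in> func_ring B"
  shows "\<exists>g\<in>func_ring B. \<forall>t\<in>T. (f has_vector_derivative g t) (at t within T)"
  using assms(2)
proof induction
  case (base f)
  then show ?case by (rule assms(1))
next
  case (const c)
  then show ?case
    by (intro bexI [of _ "\<lambda>t. 0"]) (auto intro: func_ring.const)
next
  case (add f g)
  then obtain f' g' where "f' \<in> func_ring B" "g' \<in> func_ring B"
    and "\<forall>t\<in>T. (f has_vector_derivative f' t) (at t within T)"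
      "\<forall>t\<in>T. (g has_vector_derivative g' t) (at t within T)" by blast
  then show ?case
    by (intro bexI [of _ "\<lambda>t. f' t + g' t"]) (auto intro!: derivative_intros func_ring.add)
next
  case (mult f g)
  then obtain f' g' where f': "f' \<in> func_ring B" "g' \<in> func_ring B"
    and "\<forall>t\<in>T. (f has_vector_derivative f' t) (at t within T)"
      "\<forall>t\<in>T. (g has_vector_derivative g' t) (at t within T)" by blast
  then have "\<forall>t\<in>T. ((\<lambda>t. f t * g t) has_vector_derivative f t * g' t + f' t * g t) (at t within T)"
    by (auto intro!: has_vector_derivative_mult)
  then show ?case
    by (intro bexI [of _ "\<lambda>t. f t * g' t + f' t * g t"] func_ring.add func_ring.mult f' mult.hyps)
next
  case (cnj f)
  then obtain f' where f': "f' \<in> func_ring B"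
    and "\<forall>t\<in>T. (f has_vector_derivative f' t) (at t within T)" by blast
  then have "\<forall>t\<in>T. ((\<lambda>t. cnj (f t)) has_vector_derivative cnj (f' t)) (at t within T)"
    using bounded_linear.has_vector_derivative [OF bounded_linear_cnj] by blast
  then show ?case
    by (intro bexI [of _ "\<lambda>t. cnj (f' t)"] func_ring.cnj f')
qed

lemma has_vector_derivative_vec_componentwise:
  fixes f :: "real \<Rightarrow> 'b::euclidean_space ^ 'n"
  assumes "\<And>i. ((\<lambda>x. f x $ i) has_vector_derivative f' $ i) (at x within S)"
  shows "(f has_vector_derivative f') (at x within S)"
  using assms unfolding has_vector_derivative_def by (intro has_derivative_vec_componentwise) simp

text \<open>Choosing one derivative inside the ring for each member gives an operator
  \<open>d\<close> that can be iterated; its powers are the sequence of derivatives that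
  \<open>smooth_on\<close> asks for.\<close>

lemma func_ring_smooth:
  fixes V :: "real \<Rightarrow> complex^'n"
  assumes B: "\<And>f. f \<in> B \<Longrightarrow> \<exists>g\<in>func_ring B. \<forall>t\<in>T. (f has_vector_derivative g t) (at t within T)"
    and V: "\<And>i. (\<lambda>t. V t $ i) \<in> func_ring B" and "S \<subseteq> T"
  shows "smooth_on S V"
proof -
  obtain d where d: "\<And>f. f \<in> func_ring B \<Longrightarrow>
      d f \<in> func_ring B \<and> (\<forall>t\<in>T. (f has_vector_derivative d f t) (at t within T))"
    using func_ring_derivative [OF B] by metis
  define D where "D n t = (\<chi> i. (d ^^ n) (\<lambda>t. V t $ i) t)" for n t
  have ring: "(d ^^ n) (\<lambda>t. V t $ i) \<in> func_ring B" for n i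
    by (induction n) (use V d in auto)
  have "(D n has_vector_derivative D (Suc n) t) (at t within S)" if "t \<in> S" for n t
  proof (rule has_vector_derivative_within_subset [OF has_vector_derivative_vec_componentwise \<open>S \<subseteq> T\<close>])
    fix i show "((\<lambda>t. D n t $ i) has_vector_derivative D (Suc n) t $ i) (at t within T)"
      using d [OF ring [of n i]] that \<open>S \<subseteq> T\<close> by (auto simp: D_def)
  qed
  moreover have "D 0 t = V t" for t by (simp add: D_def vec_eq_iff)
  ultimately show ?thesis unfolding smooth_on_def by blast
qed

locale complete_geodesic_of_special_kaehler = special_kaehler_manifold X
  for X :: "('x::{t2_space,second_countable_topology}, 'r::finite) special_kaehler_data" +
  fixes \<gamma> :: "real \<Rightarrow> 'x"
  assumes complete_geodesic: "complete_geodesic X \<gamma>"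
begin

text \<open>The common coordinate map of the special charts makes the components of \<gamma>' one
  function on the whole line, with no choice of charts.\<close>

definition velocity :: "real \<Rightarrow> complex^'r" where
  "velocity t = vector_derivative (a_periods X \<circ> \<gamma>) (at t)"

lemma geodesic_special:
  assumes "special U" "\<gamma> t \<in> U"
  shows "unit_speed_geodesic_at UNIV (sk_metric X (U, a_periods X)) (a_periods X \<circ> \<gamma>) t"
  using complete_geodesic special_charts_at [OF assms] unfolding complete_geodesic_def by force

lemma open_geodesic_preimage: "open U \<Longrightarrow> open (\<gamma> -` U)"
  using complete_geodesic continuous_on_open_vimage [of UNIV \<gamma>] by (simp add: complete_geodesic_def open_vimage)

lemma a_periods_has_vector_derivative: "(a_periods X \<circ> \<gamma> has_vector_derivative velocity t) (at t)"
proof -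
  obtain U where "special U" "\<gamma> t \<in> U" by (rule special_exists)
  from geodesic_special [OF this] show ?thesis
    by (simp add: unit_speed_geodesic_at_def Let_def velocity_def vector_derivative_works)
qed

lemma velocity_unit: "Re (herm (\<gamma> t) (velocity t) (velocity t)) = 1"
proof -
  obtain U where U: "special U" "\<gamma> t \<in> U" by (rule special_exists)
  from geodesic_special [OF this] show ?thesis
    by (simp add: unit_speed_geodesic_at_def Let_def velocity_def [symmetric] sk_metric_special U
        point_a_periods)
qed

lemma velocity_has_vector_derivative:
  "(velocity has_vector_derivative - christoffel_form (\<gamma> t) (velocity t) (velocity t)) (at t)"
proof -
  obtain U where U: "special U" "\<gamma> t \<in> U" by (rule special_exists)
  from geodesic_special [OF this] show ?thesis
    by (simp add: unit_speed_geodesic_at_def Let_def velocity_def [symmetric, abs_def] christoffel_special [OF U])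
qed

lemma has_vector_derivative_along:
  assumes U: "special U" "\<gamma> t \<in> U"
    and F: "((\<lambda>z. F (point U z)) has_derivative F') (at (a_periods X (\<gamma> t)))"
  shows "((\<lambda>s. F (\<gamma> s)) has_vector_derivative F' (velocity t)) (at t)"
proof -
  have "((\<lambda>z. F (point U z)) has_derivative F') (at ((a_periods X \<circ> \<gamma>) t))"
    using F by simp
  from has_derivative_compose [OF a_periods_has_vector_derivative [unfolded has_vector_derivative_def] this]
  have "((\<lambda>s. F (point U ((a_periods X \<circ> \<gamma>) s))) has_derivative (\<lambda>h. F' (h *\<^sub>R velocity t))) (at t)" .
  then have "((\<lambda>s. F (\<gamma> s)) has_derivative (\<lambda>h. F' (h *\<^sub>R velocity t))) (at t)"
    by (rule has_derivative_transform_within_open [OF _ open_geodesic_preimage [OF special_open(1) [OF U(1)]]])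
      (use U point_a_periods in auto)
  then show ?thesis
    unfolding has_vector_derivative_def
    by (simp add: linear_scale [OF has_derivative_linear [OF F]])
qed

lemma holo_along:
  assumes "holo h"
  shows "((\<lambda>s. h (\<gamma> s)) has_vector_derivative (\<Sum>k\<in>UNIV. velocity t $ k * pd k h (\<gamma> t))) (at t)"
proof -
  obtain U where U: "special U" "\<gamma> t \<in> U" by (rule special_exists)
  show ?thesis
    using has_vector_derivative_along [OF U holo_has_derivative [OF assms U, unfolded o_def]] .
qed

lemma metric_matrix_along:
  "((\<lambda>s. metric_matrix (\<gamma> s)) has_vector_derivative imm (dtau (\<gamma> t) (velocity t))) (at t)"
proof -
  obtain U where U: "special U" "\<gamma> t \<in> U" by (rule special_exists)
  show ?thesis
    using has_vector_derivative_along [OF U metric_matrix_has_derivative [OF U]] .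
qed

lemma metric_inverse_along:
  "((\<lambda>s. metric_inverse (\<gamma> s)) has_vector_derivative
     - (metric_inverse (\<gamma> t) ** (imm (dtau (\<gamma> t) (velocity t)) ** metric_inverse (\<gamma> t)))) (at t)"
proof -
  obtain U where U: "special U" "\<gamma> t \<in> U" by (rule special_exists)
  show ?thesis
    using has_vector_derivative_along [OF U metric_inverse_has_derivative [OF U]] .
qed

definition parallel_on :: "real set \<Rightarrow> (real \<Rightarrow> complex^'r) \<Rightarrow> bool" where
  "parallel_on I E \<longleftrightarrow> (\<forall>t\<in>I. (E has_vector_derivative
      - christoffel_form (\<gamma> t) (velocity t) (E t)) (at t within I))"

text \<open>Chosen to be closed under differentiation up to ring operations: holomorphic functions
  bring in their partial derivatives and the velocity, while velocity, inverse metric and parallel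
  field reproduce each other with coefficients from d\<tau>. The real parameter itself serves the
  cut-off function.\<close>

definition along_base :: "(real \<Rightarrow> complex^'r) \<Rightarrow> (real \<Rightarrow> complex) set" where
  "along_base E = {\<lambda>t. h (\<gamma> t) | h. holo h} \<union> range (\<lambda>i t. velocity t $ i)
     \<union> range (\<lambda>(i, j) t. metric_inverse (\<gamma> t) $ i $ j) \<union> range (\<lambda>i t. E t $ i)
     \<union> {complex_of_real}"

lemma along_base_ring:
  "holo h \<Longrightarrow> (\<lambda>t. h (\<gamma> t)) \<in> func_ring (along_base E)"
  "(\<lambda>t. velocity t $ i) \<in> func_ring (along_base E)"
  "(\<lambda>t. metric_inverse (\<gamma> t) $ i $ j) \<in> func_ring (along_base E)"
  "(\<lambda>t. E t $ i) \<in> func_ring (along_base E)"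
  "complex_of_real \<in> func_ring (along_base E)"
  by (rule func_ring.base, force simp: along_base_def)+

lemma dtau_ring:
  assumes "\<And>i. (\<lambda>t. w t $ i) \<in> func_ring (along_base E)"
  shows "(\<lambda>t. dtau (\<gamma> t) (w t) $ i $ j) \<in> func_ring (along_base E)"
  unfolding dtau_def vec_lambda_beta
  by (intro func_ring_sum func_ring.mult along_base_ring holo_pd holo_period_map assms)

lemma christoffel_form_ring:
  assumes "\<And>i. (\<lambda>t. w t $ i) \<in> func_ring (along_base E)"
  shows "(\<lambda>t. christoffel_form (\<gamma> t) (velocity t) (w t) $ i) \<in> func_ring (along_base E)"
  unfolding christoffel_form_def matrix_vector_mult_def vector_smult_component vec_lambda_beta
  by (intro func_ring.mult func_ring.const func_ring_sum along_base_ring dtau_ring assms)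

lemma along_base_derivative:
  assumes E: "parallel_on I E" and f: "f \<in> along_base E"
  shows "\<exists>g\<in>func_ring (along_base E). \<forall>t\<in>I. (f has_vector_derivative g t) (at t within I)"
proof -
  have vec: "(g has_vector_derivative g') (at t within S) \<Longrightarrow>
      ((\<lambda>t. g t $ i) has_vector_derivative g' $ i) (at t within S)"
    for g :: "real \<Rightarrow> complex^'r" and g' i t S
    using bounded_linear.has_vector_derivative [OF bounded_linear_vec_nth] by blast
  have mat: "(g has_vector_derivative g') (at t within S) \<Longrightarrow>
      ((\<lambda>t. g t $ i $ j) has_vector_derivative g' $ i $ j) (at t within S)"
    for g :: "real \<Rightarrow> complex^'r^'r" and g' i j t S
    using bounded_linear.has_vector_derivative [OF bounded_linear_compose
        [OF bounded_linear_vec_nth bounded_linear_vec_nth]] by blast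
  consider (holo) h where "holo h" "f = (\<lambda>t. h (\<gamma> t))" | (velocity) i where "f = (\<lambda>t. velocity t $ i)"
    | (inverse) i j where "f = (\<lambda>t. metric_inverse (\<gamma> t) $ i $ j)" | (E) i where "f = (\<lambda>t. E t $ i)"
    | (id) "f = complex_of_real"
    using f unfolding along_base_def by fastforce
  then show ?thesis
  proof cases
    case holo
    have "\<forall>t\<in>I. (f has_vector_derivative (\<Sum>k\<in>UNIV. velocity t $ k * pd k h (\<gamma> t))) (at t within I)"
      unfolding holo(2) using holo_along [OF holo(1)] has_vector_derivative_at_within by blast
    moreover have "(\<lambda>t. \<Sum>k\<in>UNIV. velocity t $ k * pd k h (\<gamma> t)) \<in> func_ring (along_base E)"
      by (intro func_ring_sum func_ring.mult along_base_ring holo_pd holo(1))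
    ultimately show ?thesis
      by (intro bexI [of _ "\<lambda>t. \<Sum>k\<in>UNIV. velocity t $ k * pd k h (\<gamma> t)"])
  next
    case velocity
    have "\<forall>t\<in>I. (f has_vector_derivative - christoffel_form (\<gamma> t) (velocity t) (velocity t) $ i) (at t within I)"
      unfolding velocity
      using vec [OF has_vector_derivative_at_within [OF velocity_has_vector_derivative]] by simp
    then show ?thesis
      by (intro bexI [of _ "\<lambda>t. - christoffel_form (\<gamma> t) (velocity t) (velocity t) $ i"]
          func_ring_minus christoffel_form_ring along_base_ring)
  next
    case inverse
    let ?P = "\<lambda>t. metric_inverse (\<gamma> t)" and ?T = "\<lambda>t. dtau (\<gamma> t) (velocity t)"
    let ?g = "\<lambda>t. - (\<Sum>k\<in>UNIV. ?P t $ i $ k * (\<Sum>l\<in>UNIV. (1 / (2 * \<i>) * (?T t $ k $ l + - cnj (?T t $ k $ l))) * ?P t $ l $ j))"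
    \<comment> \<open>The derivative of the inverse metric contains Im d\<tau>, which is not
      holomorphic; this is where the ring needs conjugation.\<close>
    have im: "complex_of_real (Im a) = 1 / (2 * \<i>) * (a + - cnj a)" for a
      by (simp add: complex_eq_iff)
    have "\<forall>t\<in>I. (f has_vector_derivative ?g t) (at t within I)"
    proof
      fix t
      have "(f has_vector_derivative (- (?P t ** (imm (?T t) ** ?P t))) $ i $ j) (at t within I)"
        unfolding inverse by (rule mat [OF has_vector_derivative_at_within [OF metric_inverse_along]])
      then show "(f has_vector_derivative ?g t) (at t within I)"
        by (simp only: matrix_matrix_mult_def imm_def vec_lambda_beta vector_uminus_component im)
    qed
    moreover have "?g \<in> func_ring (along_base E)"
      by (intro func_ring_minus func_ring_sum func_ring.mult func_ring.add func_ring.const func_ring.cnj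
          along_base_ring dtau_ring)
    ultimately show ?thesis by (intro bexI [of _ ?g])
  next
    case E
    have "\<forall>t\<in>I. (f has_vector_derivative - christoffel_form (\<gamma> t) (velocity t) (E t) $ i) (at t within I)"
      unfolding E using vec assms(1) unfolding parallel_on_def by fastforce
    then show ?thesis
      by (intro bexI [of _ "\<lambda>t. - christoffel_form (\<gamma> t) (velocity t) (E t) $ i"]
          func_ring_minus christoffel_form_ring along_base_ring)
  next
    case id
    have "(complex_of_real has_vector_derivative 1) (at t within I)" for t
      using bounded_linear.has_vector_derivative [OF bounded_linear_of_real has_vector_derivative_id]
      by simp
    then show ?thesis
      unfolding id by (intro bexI [of _ "\<lambda>t. 1"]) (auto intro: func_ring.const)
  qed
qed

end

section \<open>Parallel fields and the second variation\<close>

lemma of_real_vector_scalar_mult: "complex_of_real r *s v = r *\<^sub>R (v :: complex^'n)"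
  by (simp add: vec_eq_iff) (simp add: scaleR_conv_of_real)

lemma vector_scalar_mult_minus: "c *s (- v) = - (c *s (v :: complex^'n))"
  by (simp add: vec_eq_iff)

lemma has_vector_derivative_transform_within_open_set:
  assumes "(f has_vector_derivative f') (at t within I)" "t \<in> I" "open W" "t \<in> W"
    and "\<And>s. s \<in> I \<Longrightarrow> s \<in> W \<Longrightarrow> f s = g s"
  shows "(g has_vector_derivative f') (at t within I)"
proof -
  obtain d where "0 < d" "ball t d \<subseteq> W"
    using assms openE by metis
  then show ?thesis
    using assms by (intro has_vector_derivative_transform_within [OF assms(1)]) (auto simp: dist_commute subset_eq)
qed

text \<open>The first term grows like \<open>L\<^sup>3\<close>, the second like \<open>L\<^sup>4\<close>.\<close>

lemma index_of_bump_nonpos: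
  fixes \<rho> :: "real \<Rightarrow> real"
  assumes "0 < \<delta>" "2 * \<delta> \<le> L" "0 \<le> N" "4 * N \<le> L * \<delta> * r" "0 \<le> r"
    and nonneg: "\<And>t. t \<in> {t0 - L..t0 + L} \<Longrightarrow> 0 \<le> \<rho> t"
    and lower: "\<And>t. t \<in> {t0 - \<delta>..t0 + \<delta>} \<Longrightarrow> r \<le> \<rho> t"
  shows "integral {t0 - L..t0 + L} (\<lambda>t. 2 * (L\<^sup>2 - (t - t0)\<^sup>2) * N - (L\<^sup>2 - (t - t0)\<^sup>2)\<^sup>2 * \<rho> t) \<le> 0"
    (is "integral ?I ?g \<le> 0")
proof (cases "?g integrable_on ?I")
  case False
  \<comment> \<open>\<open>integral\<close> has the default value 0 in this case, which satisfies
    the bound.\<close>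
  then show ?thesis by (simp add: not_integrable_integral)
next
  case True
  \<comment> \<open>On the window \<bar>t - t0\<bar> \<le> \<delta> \<le> L/2 the bump is at least
    3/4 of its maximum \<open>L\<^sup>2\<close>; squaring gives 9/16.\<close>
  let ?c = "9 / 16 * L ^ 4 * r"
  let ?h = "\<lambda>t. 2 * L\<^sup>2 * N - (if t \<in> {t0 - \<delta>..t0 + \<delta>} then ?c else 0)"
  have L: "0 < L" using assms by linarith
  have "((\<lambda>t. if t \<in> {t0 - \<delta>..t0 + \<delta>} then ?c else 0) has_integral 2 * \<delta> * ?c) ?I"
    using has_integral_const_real [of ?c "t0 - \<delta>" "t0 + \<delta>"] assms
    by (subst has_integral_restrict) auto
  moreover have "((\<lambda>t. 2 * L\<^sup>2 * N) has_integral 2 * L * (2 * L\<^sup>2 * N)) ?I"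
    using has_integral_const_real [of "2 * L\<^sup>2 * N" "t0 - L" "t0 + L"] L by simp
  ultimately have h: "(?h has_integral 2 * L * (2 * L\<^sup>2 * N) - 2 * \<delta> * ?c) ?I"
    by (rule has_integral_diff [rotated])
  have "?g t \<le> ?h t" if t: "t \<in> ?I" for t
  proof -
    have s: "(t - t0)\<^sup>2 \<le> L\<^sup>2"
      using t L by (intro power2_le_iff_abs_le [THEN iffD2]) auto
    have 1: "2 * (L\<^sup>2 - (t - t0)\<^sup>2) * N \<le> 2 * L\<^sup>2 * N"
      using assms by (intro mult_right_mono) auto
    show ?thesis
    proof (cases "t \<in> {t0 - \<delta>..t0 + \<delta>}")
      case True
      then have "t - t0 \<le> L / 2" "- (t - t0) \<le> L / 2"
        using assms(2) unfolding atLeastAtMost_iff by linarith+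
      then have "\<bar>t - t0\<bar> \<le> L / 2" by (rule abs_leI)
      then have "(t - t0)\<^sup>2 \<le> (L / 2)\<^sup>2"
        using L by (intro power2_le_iff_abs_le [THEN iffD2]) auto
      then have "3 / 4 * L\<^sup>2 \<le> L\<^sup>2 - (t - t0)\<^sup>2"
        by (simp add: power_divide)
      then have "(3 / 4 * L\<^sup>2)\<^sup>2 \<le> (L\<^sup>2 - (t - t0)\<^sup>2)\<^sup>2"
        by (intro power_mono) auto
      moreover have "(3 / 4 * L\<^sup>2)\<^sup>2 = 9 / 16 * L ^ 4"
        by (simp add: power_mult_distrib power_divide flip: power_mult)
      ultimately have "?c \<le> (L\<^sup>2 - (t - t0)\<^sup>2)\<^sup>2 * \<rho> t"
        using lower [OF True] assms by (intro mult_mono) auto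
      with 1 True show ?thesis by simp
    next
      case False
      have "0 \<le> (L\<^sup>2 - (t - t0)\<^sup>2)\<^sup>2 * \<rho> t"
        using nonneg [OF t] by simp
      with 1 False show ?thesis by auto
    qed
  qed
  then have "integral ?I ?g \<le> 2 * L * (2 * L\<^sup>2 * N) - 2 * \<delta> * ?c"
    using has_integral_le [OF integrable_integral [OF True] h] by blast
  \<comment> \<open>Since 9/8 exceeds 1, the hypothesis on \<open>4 * N\<close> makes the bracket
    nonpositive.\<close>
  also have "\<dots> = L ^ 3 * (4 * N - 9 / 8 * (L * \<delta> * r))"
    by (simp add: power2_eq_square power3_eq_cube power4_eq_xxxx algebra_simps)
  also have "\<dots> \<le> 0"
  proof -
    have "0 \<le> L * \<delta> * r" using L assms by simp
    then have "4 * N - 9 / 8 * (L * \<delta> * r) \<le> 0" using assms by linarith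
    then show ?thesis using L by (simp add: mult_nonneg_nonpos)
  qed
  finally show ?thesis .
qed

context special_kaehler_manifold
begin

lemma christoffel_form_simps:
  "christoffel_form p v (c *s w) = c *s christoffel_form p v w"
  "christoffel_form p v (w - w') = christoffel_form p v w - christoffel_form p v w'"
  by (simp_all add: christoffel_form_def matrix_vector_mult_simps vec_eq_iff algebra_simps diff_divide_distrib)

lemma conorm_scale: "conorm p (c *s x) = (cmod c)\<^sup>2 * conorm p x"
proof -
  have "dot (metric_inverse p *v (c *s x)) (cnjv (c *s x)) =
      (c * cnj c) * dot (metric_inverse p *v x) (cnjv x)"
    by (simp add: matrix_vector_mult_simps cnjv_simps dot_simps mult_ac)
  also have "c * cnj c = complex_of_real ((cmod c)\<^sup>2)"
    by (rule complex_norm_square [symmetric])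
  finally show ?thesis by (simp add: conorm_def)
qed

lemma conorm_nonneg: "0 \<le> conorm p x"
  using conorm_positive [of x p] by (cases "x = 0") (auto simp: conorm_def cnjv_simps dot_simps)

text \<open>This is \<open>\<langle>R(V,c)c, V\<rangle>\<close>, see \<open>curvature_pairing\<close>.\<close>

definition index_density :: "'x \<Rightarrow> complex^'r \<Rightarrow> complex^'r \<Rightarrow> real" where
  "index_density p c V = (conorm p (dtau p c *v V)
      - Re (dot (metric_inverse p *v (dtau p c *v c)) (cnjv (dtau p V *v V)))) / 4"

text \<open>Only real factors come out as squares: under a phase the first term is unchanged, while
  the second turns by twice the angle.\<close>

lemma index_density_scale:
  "index_density p c (complex_of_real r *s V) = r\<^sup>2 * index_density p c V"
proof -
  have "dtau p (complex_of_real r *s V) *v (complex_of_real r *s V) =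
      complex_of_real (r\<^sup>2) *s (dtau p V *v V)"
    by (simp add: dtau_scale matrix_vector_mult_simps vec_eq_iff power2_eq_square)
  then show ?thesis
    by (simp add: index_density_def matrix_vector_mult_simps conorm_scale cnjv_simps dot_simps
        algebra_simps diff_divide_distrib)
qed

end

context complete_geodesic_of_special_kaehler
begin

text \<open>Compatibility of the connection with the whole Hermitian form, not just its real part.
  The holomorphic half of the derivative of the metric cancels the Christoffel term of
  \<open>E\<close>, and the conjugate half cancels that of \<open>F\<close>.\<close>

lemma parallel_herm_derivative:
  assumes "parallel_on I E" "parallel_on I F" "t \<in> I"
  shows "((\<lambda>t. herm (\<gamma> t) (E t) (F t)) has_vector_derivative 0) (at t within I)"
proof -
  let ?Y = "\<lambda>t. metric_matrix (\<gamma> t)" and ?P = "metric_inverse (\<gamma> t)"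
  let ?T = "dtau (\<gamma> t) (velocity t)"
  let ?E' = "- christoffel_form (\<gamma> t) (velocity t) (E t)" and ?F' = "- christoffel_form (\<gamma> t) (velocity t) (F t)"
  have E: "(E has_vector_derivative ?E') (at t within I)" and F: "(F has_vector_derivative ?F') (at t within I)"
    using assms by (auto simp: parallel_on_def)
  have "bounded_linear (cnjv :: complex^'r \<Rightarrow> complex^'r)"
    unfolding linear_conv_bounded_linear [symmetric]
    by (rule linearI) (auto simp: cnjv_def vec_eq_iff)
  then have F_cnj: "((\<lambda>t. cnjv (F t)) has_vector_derivative cnjv ?F') (at t within I)"
    by (rule bounded_linear.has_vector_derivative [OF _ F])
  have Y: "(?Y has_vector_derivative imm ?T) (at t within I)"
    by (rule has_vector_derivative_at_within [OF metric_matrix_along])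
  have "((\<lambda>t. dot (?Y t *v E t) (cnjv (F t))) has_vector_derivative
      dot (?Y t *v E t) (cnjv ?F') + dot (?Y t *v ?E' + imm ?T *v E t) (cnjv (F t))) (at t within I)"
    by (intro bounded_bilinear.has_vector_derivative [OF bounded_bilinear_dot]
        bounded_bilinear.has_vector_derivative [OF bounded_bilinear_matrix_vector] E F_cnj Y)
  moreover have "dot (?Y t *v E t) (cnjv ?F') + dot (?Y t *v ?E' + imm ?T *v E t) (cnjv (F t)) = 0"
  proof -
    have "dot (?Y t *v E t) (cnjv (?P *v (?T *v F t))) = cnj (herm (\<gamma> t) (?P *v (?T *v F t)) (E t))"
      by (simp add: herm_cnj) (simp add: herm_def)
    also have "\<dots> = dot (cnjm ?T *v cnjv (F t)) (E t)"
      by (simp add: herm_metric_inverse cnj_dot cnjv_matrix_vector cnjv_simps)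
    also have "\<dots> = dot (cnjm ?T *v E t) (cnjv (F t))"
      by (simp only: dot_symmetric_matrix [OF transpose_cnjm [OF transpose_dtau]] dot_commute [of "cnjv (F t)"])
    finally have 1: "dot (?Y t *v E t) (cnjv (?P *v (?T *v F t))) = dot (cnjm ?T *v E t) (cnjv (F t))" .
    have 2: "?Y t *v ?E' = - ((1 / (2 * \<i>)) *s (?T *v E t))"
      by (simp add: christoffel_form_def matrix_vector_mult_simps metric_inverse_cancel)
    have 3: "cnjv ?F' = (1 / (2 * \<i>)) *s cnjv (?P *v (?T *v F t))"
      by (simp add: christoffel_form_def cnjv_simps vec_eq_iff)
    show ?thesis
      unfolding 2 3 imm_matrix_vector dot_simps 1 by (simp add: algebra_simps)
  qed
  ultimately show ?thesis
    by (simp add: herm_def)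
qed

section \<open>Parallel transport along the geodesic\<close>

lemma parallel_herm_constant:
  assumes "parallel_on {p..q} E" "parallel_on {p..q} F" "s \<in> {p..q}" "t \<in> {p..q}"
  shows "herm (\<gamma> s) (E s) (F s) = herm (\<gamma> t) (E t) (F t)"
  by (rule has_vector_derivative_zero_constant [OF convex_real_interval(5) parallel_herm_derivative
        [OF assms(1,2)]]) (use assms in auto)

lemma parallel_subset: "parallel_on I E \<Longrightarrow> J \<subseteq> I \<Longrightarrow> parallel_on J E"
  unfolding parallel_on_def using has_vector_derivative_within_subset by blast

lemma parallel_scale: "parallel_on I E \<Longrightarrow> parallel_on I (\<lambda>t. c *s E t)"
  unfolding parallel_on_def christoffel_form_simps
  using bounded_linear.has_vector_derivative [OF bounded_linear_vector_scalar_mult_right, of E _ _ c]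
  by (fastforce simp: vector_scalar_mult_minus)

lemma parallel_velocity: "parallel_on I velocity"
  unfolding parallel_on_def using velocity_has_vector_derivative has_vector_derivative_at_within by blast

text \<open>The difference is parallel, so its length is constant, and it vanishes at one
  point.\<close>

lemma parallel_unique:
  assumes E: "parallel_on {p..q} E" and F: "parallel_on {p..q} F"
    and s: "s \<in> {p..q}" "E s = F s" and t: "t \<in> {p..q}"
  shows "E t = F t"
proof -
  have "parallel_on {p..q} (\<lambda>t. E t - F t)"
    using E F unfolding parallel_on_def christoffel_form_simps
    by (auto intro!: derivative_eq_intros)
  from parallel_herm_constant [OF this this s(1) t] s(2)
  have "herm (\<gamma> t) (E t - F t) (E t - F t) = 0" by (simp add: herm_simps)
  then show ?thesis
    using herm_positive [of "E t - F t" "\<gamma> t"] by fastforce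
qed

lemma along_ring_continuous:
  assumes "parallel_on I E" "f \<in> func_ring (along_base E)"
  shows "continuous_on I f"
proof -
  obtain g where "\<forall>t\<in>I. (f has_vector_derivative g t) (at t within I)"
    using func_ring_derivative [OF along_base_derivative [OF assms(1)] assms(2)] by blast
  then show ?thesis
    using has_vector_derivative_continuous continuous_on_eq_continuous_within by blast
qed

lemma parallel_exists:
  assumes "t0 \<in> {p..q}" obtains E where "parallel_on {p..q} E" "E t0 = e"
proof -
  define c :: complex where "c = - (1 / (2 * \<i>))"
  define M where "M t = metric_inverse (\<gamma> t) ** dtau (\<gamma> t) (velocity t)" for t
  define A where "A t = (\<chi> i j. c * M t $ i $ j)" for t
  have A: "A t *v v = - christoffel_form (\<gamma> t) (velocity t) v" for t v
  proof -
    have "A t *v v = c *s (M t *v v)"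
      by (simp add: A_def vec_eq_iff matrix_vector_mult_def sum_distrib_left mult.assoc)
    then show ?thesis
      by (simp add: christoffel_form_def c_def M_def matrix_vector_mul_assoc vec_eq_iff)
  qed
  \<comment> \<open>The ring is built on some parallel field; the velocity is the one already
    available.\<close>
  have "(\<lambda>t. c * M t $ i $ j) \<in> func_ring (along_base velocity)" for i j
    unfolding M_def matrix_matrix_mult_def vec_lambda_beta
    by (intro func_ring.mult func_ring.const func_ring_sum along_base_ring dtau_ring)
  then have "continuous_on {p..q} A"
    unfolding A_def by (intro continuous_on_vec_lambda along_ring_continuous [OF parallel_velocity])
  from linear_ode_solution [OF this assms] obtain E where "E t0 = e"
    "\<And>t. t \<in> {p..q} \<Longrightarrow> (E has_vector_derivative A t *v E t) (at t within {p..q})"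
    by metis
  then show ?thesis
    using that unfolding A parallel_on_def by blast
qed

section \<open>From components in special coordinates to vector fields along the geodesic\<close>

lemma differential_velocity:
  assumes \<kappa>: "\<kappa> \<in> charts_at (atlas X) (\<gamma> t)"
  shows "differential \<kappa> (a_periods X) (\<gamma> t) (vector_derivative (coords \<kappa> \<circ> \<gamma>) (at t)) = velocity t"
proof -
  note isc = charts_is_chart [OF charts_at_D(1) [OF \<kappa>]]
  have "coords \<kappa> \<circ> \<gamma> differentiable (at t)"
    using complete_geodesic \<kappa> by (simp add: complete_geodesic_def unit_speed_geodesic_at_def Let_def)
  then have 1: "(coords \<kappa> \<circ> \<gamma> has_derivative (\<lambda>h. h *\<^sub>R vector_derivative (coords \<kappa> \<circ> \<gamma>) (at t))) (at t)"
    unfolding vector_derivative_works has_vector_derivative_def .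
  have 2: "(a_periods X \<circ> param \<kappa> has_derivative differential \<kappa> (a_periods X) (\<gamma> t)) (at ((coords \<kappa> \<circ> \<gamma>) t))"
    using a_periods_has_derivative(1) [OF \<kappa>] by simp
  have "((a_periods X \<circ> param \<kappa>) \<circ> (coords \<kappa> \<circ> \<gamma>) has_derivative
      differential \<kappa> (a_periods X) (\<gamma> t) \<circ> (\<lambda>h. h *\<^sub>R vector_derivative (coords \<kappa> \<circ> \<gamma>) (at t))) (at t)"
    by (rule diff_chain_at [OF 1 2])
  then have "(a_periods X \<circ> \<gamma> has_derivative
      differential \<kappa> (a_periods X) (\<gamma> t) \<circ> (\<lambda>h. h *\<^sub>R vector_derivative (coords \<kappa> \<circ> \<gamma>) (at t))) (at t)"
    by (rule has_derivative_transform_within_open [OF _ open_geodesic_preimage [OF is_chart_open(1) [OF isc]]])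
      (use charts_at_D(2) [OF \<kappa>] param_coords [OF isc] in auto)
  then have "(a_periods X \<circ> \<gamma> has_vector_derivative
      differential \<kappa> (a_periods X) (\<gamma> t) (vector_derivative (coords \<kappa> \<circ> \<gamma>) (at t))) (at t)"
    unfolding has_vector_derivative_def
    by (simp add: o_def linear_scale [OF linear_differential_a_periods [OF \<kappa>]])
  then show ?thesis
    unfolding velocity_def by (simp add: vector_derivative_at)
qed

text \<open>The vector field whose components in special coordinates are \<open>\<xi>\<close>.\<close>

definition lift_field :: "(real \<Rightarrow> complex^'r) \<Rightarrow> ('x, 'r) chart \<Rightarrow> real \<Rightarrow> complex^'r" where
  "lift_field \<xi> \<kappa> t = inv (differential \<kappa> (a_periods X) (\<gamma> t)) (\<xi> t)"

lemma differential_lift_field: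
  assumes "\<kappa> \<in> charts_at (atlas X) (\<gamma> t)"
  shows "differential \<kappa> (a_periods X) (\<gamma> t) (lift_field \<xi> \<kappa> t) = \<xi> t"
  unfolding lift_field_def using differential_a_periods_bij [OF assms]
  by (simp add: bij_is_surj surj_f_inv_f)

lemma lift_field_eqI:
  assumes "\<kappa> \<in> charts_at (atlas X) (\<gamma> t)" "differential \<kappa> (a_periods X) (\<gamma> t) v = \<xi> t"
  shows "lift_field \<xi> \<kappa> t = v"
  using differential_a_periods_bij [OF assms(1)] differential_lift_field [OF assms(1), of \<xi>] assms(2)
  by (metis bij_is_inj injD)

lemma lift_field_special: "special U \<Longrightarrow> \<gamma> t \<in> U \<Longrightarrow> lift_field \<xi> (U, a_periods X) t = \<xi> t"
  by (rule lift_field_eqI [OF special_charts_at]) (simp_all add: differential_special)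

lemma smooth_field_along_lift_field:
  assumes "\<And>J. J \<subseteq> I \<Longrightarrow> smooth_on J \<xi>"
  shows "smooth_field_along X \<gamma> I (lift_field \<xi>)"
  unfolding smooth_field_along_def
proof (intro conjI ballI)
  fix t \<kappa> \<kappa>'
  assume \<kappa>: "\<kappa> \<in> charts_at (atlas X) (\<gamma> t)" and \<kappa>': "\<kappa>' \<in> charts_at (atlas X) (\<gamma> t)"
  have "differential \<kappa> (a_periods X) (\<gamma> t) = differential \<kappa>' (a_periods X) (\<gamma> t) \<circ> differential \<kappa> (coords \<kappa>') (\<gamma> t)"
    using has_derivative_unique [OF a_periods_has_derivative(1) [OF \<kappa>]
        differential_chain [OF holomorphic_atlas \<kappa> \<kappa>' a_periods_has_derivative(1) [OF \<kappa>']]] .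
  then show "lift_field \<xi> \<kappa>' t = differential \<kappa> (coords \<kappa>') (\<gamma> t) (lift_field \<xi> \<kappa> t)"
    using differential_lift_field [OF \<kappa>, of \<xi>] by (intro lift_field_eqI [OF \<kappa>']) simp
next
  fix t assume "t \<in> I"
  obtain U where U: "special U" "\<gamma> t \<in> U" by (rule special_exists)
  have "smooth_on {s \<in> I. \<gamma> s \<in> U} \<xi>" by (rule assms) auto
  then have "smooth_on {s \<in> I. \<gamma> s \<in> U} (lift_field \<xi> (U, a_periods X))"
    unfolding smooth_on_def using lift_field_special [OF U(1)] by auto
  then show "\<exists>\<kappa>\<in>charts_at (atlas X) (\<gamma> t). smooth_on {s \<in> I. \<gamma> s \<in> chart_dom \<kappa>} (lift_field \<xi> \<kappa>)"
    using special_charts_at [OF U] by (intro bexI [of _ "(U, a_periods X)"]) auto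
qed

lemma normal_field_lift_field:
  assumes "\<And>t. t \<in> I \<Longrightarrow> Re (herm (\<gamma> t) (\<xi> t) (velocity t)) = 0"
  shows "normal_field X \<gamma> I (lift_field \<xi>)"
  unfolding normal_field_def
proof (intro ballI)
  fix t \<kappa> assume t: "t \<in> I" and \<kappa>: "\<kappa> \<in> charts_at (atlas X) (\<gamma> t)"
  show "sk_metric X \<kappa> (coords \<kappa> (\<gamma> t)) (lift_field \<xi> \<kappa> t) (vector_derivative (coords \<kappa> \<circ> \<gamma>) (at t)) = 0"
    using assms [OF t]
    by (simp add: sk_metric_eq param_coords [OF charts_is_chart [OF charts_at_D(1) [OF \<kappa>]] charts_at_D(2) [OF \<kappa>]]
        differential_lift_field [OF \<kappa>] differential_velocity [OF \<kappa>])
qed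

lemma zero_field_at_lift_field: "zero_field_at X \<gamma> (lift_field \<xi>) t \<longleftrightarrow> \<xi> t = 0"
proof
  assume "zero_field_at X \<gamma> (lift_field \<xi>) t"
  moreover obtain U where U: "special U" "\<gamma> t \<in> U" by (rule special_exists)
  ultimately show "\<xi> t = 0"
    using special_charts_at [OF U] lift_field_special [OF U] unfolding zero_field_at_def by metis
next
  assume "\<xi> t = 0"
  then show "zero_field_at X \<gamma> (lift_field \<xi>) t"
    unfolding zero_field_at_def
    by (auto intro!: lift_field_eqI simp: linear_0 [OF linear_differential_a_periods])
qed

end

context special_kaehler_manifold
begin

text \<open>The factor \<i> squares to -1 in T(V) V, so the pairing without a sign turns into a
  second copy of the square.\<close>

lemma index_density_imaginary:
  "index_density p c (\<i> *s c) = conorm p (dtau p c *v c) / 2"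
proof -
  have "dtau p (\<i> *s c) *v (\<i> *s c) = - (dtau p c *v c)"
    by (simp add: dtau_scale matrix_vector_mult_simps vec_eq_iff mult.assoc [symmetric])
  then show ?thesis
    by (simp add: index_density_def matrix_vector_mult_simps conorm_scale cnjv_simps dot_simps)
      (simp add: conorm_def)
qed

lemma index_density_flat:
  "dtau p c *v c = 0 \<Longrightarrow> index_density p c V = conorm p (dtau p c *v V) / 4"
  by (simp add: index_density_def matrix_vector_mult_simps dot_simps)

end

context complete_geodesic_of_special_kaehler
begin

text \<open>For parallel \<open>E\<close> only the scalar factor is differentiated. The field
  \<open>W\<close> is prescribed only while the curve is in \<open>U\<close>, which allows a second
  application to the covariant derivative, known only there.\<close>

lemma covariant_derivative_special:
  assumes I: "p < q" "s \<in> {p..q}" and U: "special U" "\<gamma> s \<in> U"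
    and E: "parallel_on {p..q} E" and f: "(f has_real_derivative f') (at s)"
    and W: "\<And>u. u \<in> {p..q} \<Longrightarrow> \<gamma> u \<in> U \<Longrightarrow> W u = complex_of_real (f u) *s E u"
  shows "covariant_derivative (sk_metric X (U, a_periods X)) (a_periods X \<circ> \<gamma>) {p..q} W s
    = complex_of_real f' *s E s"
proof -
  have "(E has_vector_derivative - christoffel_form (\<gamma> s) (velocity s) (E s)) (at s within {p..q})"
    using E I by (simp add: parallel_on_def)
  moreover have "(f has_real_derivative f') (at s within {p..q})"
    using f by (rule has_field_derivative_at_within)
  ultimately have "((\<lambda>u. f u *\<^sub>R E u) has_vector_derivative
      f s *\<^sub>R (- christoffel_form (\<gamma> s) (velocity s) (E s)) + f' *\<^sub>R E s) (at s within {p..q})"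
    by (intro has_vector_derivative_scaleR)
  then have "(W has_vector_derivative
      f s *\<^sub>R (- christoffel_form (\<gamma> s) (velocity s) (E s)) + f' *\<^sub>R E s) (at s within {p..q})"
    by (rule has_vector_derivative_transform_within_open_set
        [OF _ I(2) open_geodesic_preimage [OF special_open(1) [OF U(1)]]])
      (use U W in \<open>auto simp: of_real_vector_scalar_mult\<close>)
  then have "vector_derivative W (at s within {p..q}) =
      f s *\<^sub>R (- christoffel_form (\<gamma> s) (velocity s) (E s)) + f' *\<^sub>R E s"
    by (rule vector_derivative_within_closed_interval [OF I])
  moreover have "christoffel UNIV (sk_metric X (U, a_periods X)) ((a_periods X \<circ> \<gamma>) s) (velocity s) (W s)
      = f s *\<^sub>R christoffel_form (\<gamma> s) (velocity s) (E s)"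
    using christoffel_special [OF U] W [OF I(2) U(2)]
    by (simp add: christoffel_form_simps(1) [of _ _ "complex_of_real (f s)", unfolded of_real_vector_scalar_mult]
        of_real_vector_scalar_mult)
  ultimately show ?thesis
    by (simp add: covariant_derivative_def velocity_def [symmetric] of_real_vector_scalar_mult)
qed

lemma jacobi_operator_bump:
  fixes L t0 :: real
  defines "I \<equiv> {t0 - L..t0 + L}" and "f \<equiv> \<lambda>t. L\<^sup>2 - (t - t0)\<^sup>2"
  assumes L: "0 < L" and t: "t \<in> I" and U: "special U" "\<gamma> t \<in> U" and E: "parallel_on I E"
  shows "sk_metric X (U, a_periods X) (a_periods X (\<gamma> t))
      (jacobi_operator (sk_metric X (U, a_periods X)) (a_periods X \<circ> \<gamma>) I
        (lift_field (\<lambda>t. complex_of_real (f t) *s E t) (U, a_periods X)) t)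
      (lift_field (\<lambda>t. complex_of_real (f t) *s E t) (U, a_periods X) t)
    = 2 * f t * Re (herm (\<gamma> t) (E t) (E t)) - (f t)\<^sup>2 * index_density (\<gamma> t) (velocity t) (E t)"
proof -
  let ?\<xi> = "\<lambda>t. complex_of_real (f t) *s E t"
  let ?G = "sk_metric X (U, a_periods X)" and ?V = "lift_field ?\<xi> (U, a_periods X)"
  note E = E [unfolded I_def]
  have pq: "t0 - L < t0 + L" using L by simp
  have V: "?V u = ?\<xi> u" if "\<gamma> u \<in> U" for u
    by (rule lift_field_special [OF U(1) that])
  have 1: "covariant_derivative ?G (a_periods X \<circ> \<gamma>) I ?V s = complex_of_real (- 2 * (s - t0)) *s E s"
    if "s \<in> I" "\<gamma> s \<in> U" for s
    unfolding I_def
    by (rule covariant_derivative_special [OF pq _ U(1) that(2) E, where f = f])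
      (use that V in \<open>auto simp: f_def I_def intro!: derivative_eq_intros\<close>)
  have 2: "covariant_derivative ?G (a_periods X \<circ> \<gamma>) I (covariant_derivative ?G (a_periods X \<circ> \<gamma>) I ?V) t
      = complex_of_real (- 2) *s E t"
    unfolding I_def
    \<comment> \<open>The scalar factor is now the first derivative of the bump; its derivative is
      the constant -2.\<close>
    by (rule covariant_derivative_special [OF pq _ U E, where f = "\<lambda>s. - 2 * (s - t0)"])
      (use t 1 in \<open>auto simp: I_def intro!: derivative_eq_intros\<close>)
  have "jacobi_operator ?G (a_periods X \<circ> \<gamma>) I ?V t = complex_of_real 2 *s E t
      - curvature ?G (a_periods X (\<gamma> t)) (?\<xi> t) (velocity t) (velocity t)"
    unfolding jacobi_operator_def 2 V [OF U(2)]
    by (simp add: velocity_def [symmetric] vec_eq_iff)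
  moreover have "Re (herm (\<gamma> t) (complex_of_real 2 *s E t - C) (?\<xi> t)) =
      2 * f t * Re (herm (\<gamma> t) (E t) (E t)) - Re (herm (\<gamma> t) C (?\<xi> t))" for C
    by (simp add: herm_simps algebra_simps)
  ultimately show ?thesis
    unfolding V [OF U(2)] sk_metric_special [OF U(1) imageI [OF U(2)]] point_a_periods [OF U]
    by (simp only: curvature_pairing [OF U, folded index_density_def] index_density_scale)
qed

text \<open>Stability holds for every choice of charts along the curve; taking a special chart at
  each time makes the integrand explicit. The test field is nonzero at \<open>t0\<close>, where the
  bump equals \<open>L\<^sup>2\<close>.\<close>

lemma stable_index_positive:
  fixes L t0 :: real
  defines "I \<equiv> {t0 - L..t0 + L}" and "f \<equiv> \<lambda>t. L\<^sup>2 - (t - t0)\<^sup>2"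
  assumes stable: "stable_geodesic X \<gamma>" and L: "0 < L" and E: "parallel_on I E"
    and normal: "\<And>t. t \<in> I \<Longrightarrow> Re (herm (\<gamma> t) (E t) (velocity t)) = 0" and "E t0 \<noteq> 0"
  shows "0 < integral I (\<lambda>t. 2 * f t * Re (herm (\<gamma> t) (E t) (E t))
    - (f t)\<^sup>2 * index_density (\<gamma> t) (velocity t) (E t))"
proof -
  let ?\<xi> = "\<lambda>t. complex_of_real (f t) *s E t"
  define U where "U t = (SOME U. special U \<and> \<gamma> t \<in> U)" for t
  have U: "special (U t)" "\<gamma> t \<in> U t" for t
  proof -
    have "\<exists>V. special V \<and> \<gamma> t \<in> V" using special_exists by metis
    from someI_ex [OF this] show "special (U t)" "\<gamma> t \<in> U t" by (auto simp: U_def)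
  qed
  define K where "K t = (U t, a_periods X)" for t
  have ring: "(\<lambda>t. ?\<xi> t $ i) \<in> func_ring (along_base E)" for i
  proof -
    \<comment> \<open>The bump is rewritten with sums, products and negations, the shapes that the
      ring rules match.\<close>
    have "(\<lambda>t. (complex_of_real (L\<^sup>2) + - ((complex_of_real t + - complex_of_real t0) *
        (complex_of_real t + - complex_of_real t0))) * E t $ i) \<in> func_ring (along_base E)"
      by (intro func_ring.mult func_ring.add func_ring.const func_ring_minus along_base_ring)
    then show ?thesis
      unfolding vector_smult_component by (simp add: f_def power2_eq_square)
  qed
  have smooth: "smooth_on J ?\<xi>" if "J \<subseteq> I" for J
    using along_base_derivative [OF E] ring that by (rule func_ring_smooth)
  have "stable_between X \<gamma> (t0 - L) (t0 + L)"
    using stable L by (simp add: stable_geodesic_def)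
  moreover have "smooth_field_along X \<gamma> {t0 - L..t0 + L} (lift_field ?\<xi>)"
    using smooth by (intro smooth_field_along_lift_field) (simp add: I_def)
  moreover have "normal_field X \<gamma> {t0 - L..t0 + L} (lift_field ?\<xi>)"
    using normal by (intro normal_field_lift_field) (simp add: I_def herm_simps)
  moreover have "zero_field_at X \<gamma> (lift_field ?\<xi>) (t0 - L)" "zero_field_at X \<gamma> (lift_field ?\<xi>) (t0 + L)"
    by (simp_all add: zero_field_at_lift_field f_def)
  moreover have "\<not> zero_field_at X \<gamma> (lift_field ?\<xi>) t0"
    using L \<open>E t0 \<noteq> 0\<close> by (simp add: zero_field_at_lift_field f_def)
  moreover have "K t \<in> charts_at (atlas X) (\<gamma> t)" for t
    unfolding K_def by (rule special_charts_at [OF U])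
  moreover have "t0 \<in> {t0 - L..t0 + L}" using L by simp
  ultimately have "0 < integral {t0 - L..t0 + L} (\<lambda>t. sk_metric X (K t) (coords (K t) (\<gamma> t))
      (jacobi_operator (sk_metric X (K t)) (coords (K t) \<circ> \<gamma>) {t0 - L..t0 + L} (lift_field ?\<xi> (K t)) t)
      (lift_field ?\<xi> (K t) t))"
    unfolding stable_between_def by blast
  also have "\<dots> = integral I (\<lambda>t. 2 * f t * Re (herm (\<gamma> t) (E t) (E t))
    - (f t)\<^sup>2 * index_density (\<gamma> t) (velocity t) (E t))"
    unfolding I_def
  proof (rule integral_cong)
    fix t assume "t \<in> {t0 - L..t0 + L}"
    from jacobi_operator_bump [OF L this U E [unfolded I_def]]
    show "sk_metric X (K t) (coords (K t) (\<gamma> t))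
      (jacobi_operator (sk_metric X (K t)) (coords (K t) \<circ> \<gamma>) {t0 - L..t0 + L} (lift_field ?\<xi> (K t)) t)
      (lift_field ?\<xi> (K t) t) = 2 * f t * Re (herm (\<gamma> t) (E t) (E t))
    - (f t)\<^sup>2 * index_density (\<gamma> t) (velocity t) (E t)"
      by (simp add: K_def f_def)
  qed
  finally show ?thesis .
qed

lemma index_density_continuous:
  assumes E: "parallel_on I E"
  shows "continuous_on I (\<lambda>t. index_density (\<gamma> t) (velocity t) (E t))"
proof -
  let ?R = "func_ring (along_base E)"
  have mv: "(\<lambda>t. (M t *v x t) $ i) \<in> ?R"
    if "\<And>i j. (\<lambda>t. M t $ i $ j) \<in> ?R" "\<And>i. (\<lambda>t. x t $ i) \<in> ?R"
    for M :: "real \<Rightarrow> complex^'r^'r" and x i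
    unfolding matrix_vector_mult_def vec_lambda_beta by (intro func_ring_sum func_ring.mult that)
  have pair: "(\<lambda>t. dot (metric_inverse (\<gamma> t) *v x t) (cnjv (y t))) \<in> ?R"
    if "\<And>i. (\<lambda>t. x t $ i) \<in> ?R" "\<And>i. (\<lambda>t. y t $ i) \<in> ?R" for x y
    unfolding dot_def cnjv_def vec_lambda_beta
    by (intro func_ring_sum func_ring.mult func_ring.cnj mv along_base_ring that)
  have "(\<lambda>t. (1 / 4) * (dot (metric_inverse (\<gamma> t) *v (dtau (\<gamma> t) (velocity t) *v E t))
        (cnjv (dtau (\<gamma> t) (velocity t) *v E t))
      + - dot (metric_inverse (\<gamma> t) *v (dtau (\<gamma> t) (velocity t) *v velocity t))
        (cnjv (dtau (\<gamma> t) (E t) *v E t)))) \<in> ?R" (is "?\<Phi> \<in> _")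
    by (intro func_ring.mult func_ring.const func_ring.add func_ring_minus pair mv dtau_ring along_base_ring)
  then have "continuous_on I (\<lambda>t. Re (?\<Phi> t))"
    using along_ring_continuous [OF E] continuous_on_Re by blast
  then show ?thesis
    by (simp add: index_density_def conorm_def)
qed

text \<open>Parallel fields are available on compact intervals, hence a family \<open>E L\<close>.
  By uniqueness all of them agree with \<open>E 1\<close> near \<open>t0\<close>, so the window
  \<open>\<delta>\<close> and the lower bound \<open>r\<close> can be fixed before \<open>L\<close>
  is chosen. Lengths and normality are constant along parallel fields, so conditions at
  \<open>t0\<close> suffice for these.\<close>

lemma index_density_nonpos:
  assumes stable: "stable_geodesic X \<gamma>"
    and E: "\<And>L. 1 \<le> L \<Longrightarrow> parallel_on {t0 - L..t0 + L} (E L) \<and> E L t0 = e"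
    and normal: "Re (herm (\<gamma> t0) e (velocity t0)) = 0"
    and nonneg: "\<And>L t. 1 \<le> L \<Longrightarrow> 0 \<le> index_density (\<gamma> t) (velocity t) (E L t)"
  shows "index_density (\<gamma> t0) (velocity t0) e \<le> 0"
proof (rule ccontr)
  let ?\<rho> = "\<lambda>L t. index_density (\<gamma> t) (velocity t) (E L t)"
  \<comment> \<open>Half the value at \<open>t0\<close>: by continuity the density varies by less
    than \<open>r\<close> on the window, so it stays above \<open>r\<close>.\<close>
  define r where "r = index_density (\<gamma> t0) (velocity t0) e / 2"
  assume "\<not> ?thesis"
  then have r: "0 < r" by (simp add: r_def)
  have "e \<noteq> 0"
    using r index_density_scale [of "\<gamma> t0" "velocity t0" 0 e] by (auto simp: r_def)
  have E1: "parallel_on {t0 - 1..t0 + 1} (E 1)" "E 1 t0 = e" using E [of 1] by auto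
  obtain d where d: "0 < d" "\<And>t. t \<in> {t0 - 1..t0 + 1} \<Longrightarrow> dist t t0 < d \<Longrightarrow> dist (?\<rho> 1 t) (?\<rho> 1 t0) < r"
    using index_density_continuous [OF E1(1)] r unfolding continuous_on_iff by (force dest: bspec [of _ _ t0])
  define \<delta> where "\<delta> = min 1 (d / 2)"
  define N where "N = Re (herm (\<gamma> t0) e e)"
  \<comment> \<open>The first entry gives \<open>2 * \<delta> \<le> L\<close> because
    \<open>\<delta> \<le> 1\<close>; the second makes the curvature term dominate.\<close>
  define L where "L = max 2 (4 * N / (\<delta> * r))"
  have \<delta>: "0 < \<delta>" "\<delta> \<le> 1" "\<delta> < d" using d(1) by (auto simp: \<delta>_def)
  have N: "0 < N" unfolding N_def by (rule herm_positive) fact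
  have L: "1 \<le> L" "0 < L" "2 * \<delta> \<le> L" using \<delta> by (auto simp: L_def)
  have "4 * N / (\<delta> * r) \<le> L" by (simp add: L_def)
  then have "4 * N \<le> L * \<delta> * r" using \<delta> r by (simp add: field_simps)
  note EL = E [OF L(1), THEN conjunct1] and EL0 = E [OF L(1), THEN conjunct2]
  have mem: "t0 \<in> {t0 - L..t0 + L}" using L by simp
  have lower: "r \<le> ?\<rho> L t" if t: "t \<in> {t0 - \<delta>..t0 + \<delta>}" for t
  proof -
    have t1: "t \<in> {t0 - 1..t0 + 1}" using t \<delta> by auto
    have "parallel_on {t0 - 1..t0 + 1} (E L)"
      using L by (intro parallel_subset [OF EL]) auto
    then have eq: "E L t = E 1 t"
      using parallel_unique [OF _ E1(1) _ _ t1, of "E L" t0] EL0 E1(2) by simp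
    have "dist t t0 < d" using t \<delta> by (auto simp: dist_real_def)
    from d(2) [OF t1 this] show ?thesis
      by (simp add: eq E1(2) r_def dist_real_def abs_if split: if_splits)
  qed
  have normalL: "Re (herm (\<gamma> t) (E L t) (velocity t)) = 0" if "t \<in> {t0 - L..t0 + L}" for t
    using parallel_herm_constant [OF EL parallel_velocity that mem] normal EL0 by simp
  have NL: "Re (herm (\<gamma> t) (E L t) (E L t)) = N" if "t \<in> {t0 - L..t0 + L}" for t
    using parallel_herm_constant [OF EL EL that mem] EL0 by (simp add: N_def)
  have "0 < integral {t0 - L..t0 + L} (\<lambda>t. 2 * (L\<^sup>2 - (t - t0)\<^sup>2) * Re (herm (\<gamma> t) (E L t) (E L t))
      - (L\<^sup>2 - (t - t0)\<^sup>2)\<^sup>2 * ?\<rho> L t)"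
    by (rule stable_index_positive [OF stable L(2) EL normalL]) (use EL0 \<open>e \<noteq> 0\<close> in auto)
  also have "\<dots> = integral {t0 - L..t0 + L} (\<lambda>t. 2 * (L\<^sup>2 - (t - t0)\<^sup>2) * N
      - (L\<^sup>2 - (t - t0)\<^sup>2)\<^sup>2 * ?\<rho> L t)"
    by (rule integral_cong) (simp only: NL)
  also have "\<dots> \<le> 0"
    by (rule index_of_bump_nonpos [OF \<delta>(1) L(3) less_imp_le [OF N] _ less_imp_le [OF r] nonneg [OF L(1)] lower])
      fact
  finally show False by simp
qed

text \<open>The direction \<i> \<gamma>' is parallel since the Christoffel form is complex-linear,
  and normal since \<open>herm p v v\<close> is real; its index density is nonnegative all along the
  curve.\<close>

lemma stable_dtau_velocity_velocity:
  assumes "stable_geodesic X \<gamma>"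
  shows "dtau (\<gamma> t) (velocity t) *v velocity t = 0"
proof (rule ccontr)
  assume "dtau (\<gamma> t) (velocity t) *v velocity t \<noteq> 0"
  from conorm_positive [OF this]
  have "0 < index_density (\<gamma> t) (velocity t) (\<i> *s velocity t)"
    by (simp add: index_density_imaginary)
  moreover have "index_density (\<gamma> t) (velocity t) (\<i> *s velocity t) \<le> 0"
  proof (rule index_density_nonpos [OF assms, where E = "\<lambda>L s. \<i> *s velocity s"])
    have "Im (herm (\<gamma> t) (velocity t) (velocity t)) = 0"
      using herm_cnj [of "\<gamma> t" "velocity t" "velocity t"] by (simp add: complex_eq_iff)
    then show "Re (herm (\<gamma> t) (\<i> *s velocity t) (velocity t)) = 0"
      by (simp add: herm_simps)
    show "0 \<le> index_density (\<gamma> s) (velocity s) (\<i> *s velocity s)" for s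
      by (simp add: index_density_imaginary conorm_nonneg)
  qed (simp add: parallel_scale [OF parallel_velocity])
  ultimately show False by simp
qed

text \<open>With T(\<gamma>') \<gamma>' = 0 at all times, the density of every parallel extension of
  \<open>e\<close> is nonnegative along the whole curve, as the test requires.\<close>

lemma stable_dtau_normal:
  assumes stable: "stable_geodesic X \<gamma>" and normal: "Re (herm (\<gamma> t0) e (velocity t0)) = 0"
  shows "dtau (\<gamma> t0) (velocity t0) *v e = 0"
proof (rule ccontr)
  note flat = index_density_flat [OF stable_dtau_velocity_velocity [OF stable]]
  assume "dtau (\<gamma> t0) (velocity t0) *v e \<noteq> 0"
  from conorm_positive [OF this] have "0 < index_density (\<gamma> t0) (velocity t0) e"
    by (simp add: flat)
  moreover have "\<exists>E. parallel_on {t0 - L..t0 + L} E \<and> E t0 = e" if "1 \<le> L" for L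
    using parallel_exists [of t0 "t0 - L" "t0 + L" e] that by auto
  then obtain E where "\<And>L. 1 \<le> L \<Longrightarrow> parallel_on {t0 - L..t0 + L} (E L) \<and> E L t0 = e"
    by metis
  from index_density_nonpos [OF stable this normal]
  have "index_density (\<gamma> t0) (velocity t0) e \<le> 0"
    by (simp add: flat conorm_nonneg)
  ultimately show False by simp
qed

lemma stable_dtau_zero:
  assumes stable: "stable_geodesic X \<gamma>" shows "dtau (\<gamma> t) (velocity t) *v v = 0"
proof -
  let ?r = "Re (herm (\<gamma> t) v (velocity t))"
  \<comment> \<open>The part of \<open>v\<close> normal to the curve; the coefficient needs no
    normalisation because the speed is 1.\<close>
  have "dtau (\<gamma> t) (velocity t) *v (v - complex_of_real ?r *s velocity t) = 0"
    by (rule stable_dtau_normal [OF stable]) (simp add: herm_simps velocity_unit)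
  then show ?thesis
    by (simp add: matrix_vector_mult_simps stable_dtau_velocity_velocity [OF stable])
qed

lemma stable_period_map_constant:
  assumes stable: "stable_geodesic X \<gamma>" shows "period_map X (\<gamma> s) = period_map X (\<gamma> t)"
proof -
  have "period_map X (\<gamma> s) $ i $ j = period_map X (\<gamma> t) $ i $ j" for i j
  proof -
    have "((\<lambda>t. period_map X (\<gamma> t) $ i $ j) has_vector_derivative 0) (at t)" for t
    proof -
      have "(dtau (\<gamma> t) (velocity t) *v axis j 1) $ i = dtau (\<gamma> t) (velocity t) $ i $ j"
        by (simp add: matrix_vector_mult_def axis_def if_distrib cong: if_cong)
      then have "dtau (\<gamma> t) (velocity t) $ i $ j = 0"
        by (simp add: stable_dtau_zero [OF stable])
      with holo_along [OF holo_period_map, of i j t] show ?thesis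
        by (simp add: dtau_def)
    qed
    then obtain c where "\<And>t. period_map X (\<gamma> t) $ i $ j = c"
      using has_vector_derivative_zero_constant [of UNIV "\<lambda>t. period_map X (\<gamma> t) $ i $ j"] by auto
    then show ?thesis by simp
  qed
  then show ?thesis by (simp add: vec_eq_iff)
qed

end

section \<open>Geodesics of the submanifold\<close>

text \<open>Components along the orthogonal complement are constantly zero, hence so are their
  derivatives, and \<open>W\<close> is its own double complement.\<close>

lemma derivative_in_subspace:
  fixes f :: "real \<Rightarrow> 'a::euclidean_space"
  assumes W: "subspace W" and f: "(f has_vector_derivative f') (at t)"
    and "open S" "t \<in> S" and inW: "\<And>s. s \<in> S \<Longrightarrow> f s \<in> W"
  shows "f' \<in> W"
proof -
  have "f' \<bullet> u = 0" if u: "u \<in> orthogonal_comp W" for u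
  proof -
    have "((\<lambda>s. f s \<bullet> u) has_vector_derivative f' \<bullet> u) (at t)"
      by (rule bounded_linear.has_vector_derivative [OF bounded_linear_inner_left f])
    moreover have "((\<lambda>s. f s \<bullet> u) has_vector_derivative 0) (at t)"
      by (rule has_vector_derivative_transform_within_open_set [of "\<lambda>s. 0" _ _ _ S])
        (use assms u in \<open>auto simp: orthogonal_comp_def orthogonal_def\<close>)
    ultimately show ?thesis by (rule vector_derivative_unique_at)
  qed
  then have "f' \<in> orthogonal_comp (orthogonal_comp W)"
    by (auto simp: orthogonal_comp_def orthogonal_def inner_commute)
  then show ?thesis using orthogonal_comp_self [OF W] by simp
qed

text \<open>Supplies the existence behind the definite description in \<open>christoffel\<close>. A
  positive form makes \<open>\<phi>\<close> injective, and equal finite dimensions make it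
  surjective.\<close>

lemma riesz_representation:
  fixes B :: "'a::euclidean_space \<Rightarrow> 'a \<Rightarrow> real"
  assumes B: "\<And>u. linear (\<lambda>x. B x u)" "\<And>x. linear (B x)" and pos: "\<And>x. x \<noteq> 0 \<Longrightarrow> 0 < B x x"
    and K: "linear K"
  shows "\<exists>x. \<forall>u. B x u = K u"
proof -
  define \<phi> where "\<phi> x = (\<Sum>b\<in>Basis. B x b *\<^sub>R b)" for x
  have \<phi>: "linear \<phi>"
    unfolding \<phi>_def
    by (intro linearI) (simp_all add: linear_add [OF B(1)] linear_scale [OF B(1)] sum.distrib
        scaleR_left_distrib scaleR_sum_right)
  have coeff: "\<phi> x \<bullet> b = B x b" if "b \<in> Basis" for x b
    using that by (simp add: \<phi>_def inner_sum_left_Basis)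
  have eqI: "B x u = K' u" if "linear K'" "\<And>b. b \<in> Basis \<Longrightarrow> B x b = K' b" for x u K'
    using linear_eq_on_span [OF B(2) that(1), of Basis] that(2) by (simp add: span_Basis)
  have "x = 0" if "\<phi> x = 0" for x
  proof (rule ccontr)
    assume "x \<noteq> 0"
    have "B x x = 0"
      using eqI [of "\<lambda>u. 0" x x] coeff [of _ x] that by (simp add: linear_zero)
    with pos [OF \<open>x \<noteq> 0\<close>] show False by simp
  qed
  then have "surj \<phi>"
    using \<phi> by (intro linear_injective_imp_surjective) (simp_all add: linear_injective_0)
  then obtain x where "\<phi> x = (\<Sum>b\<in>Basis. K b *\<^sub>R b)" by (metis surjD)
  then have "B x b = K b" if "b \<in> Basis" for b
    using coeff [OF that, of x] that by (simp add: inner_sum_left_Basis)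
  then show ?thesis using eqI [OF K] by blast
qed

context special_kaehler_manifold
begin

section \<open>The Koszul formula in arbitrary charts\<close>

lemma sk_metric_simps:
  assumes "is_chart \<kappa>" "\<kappa> \<in> charts (atlas X)" "z \<in> coords \<kappa> ` chart_dom \<kappa>"
  shows "linear (\<lambda>x. sk_metric X \<kappa> z x u)" "linear (sk_metric X \<kappa> z x)"
    and "x \<noteq> 0 \<Longrightarrow> 0 < sk_metric X \<kappa> z x x"
proof -
  have at: "\<kappa> \<in> charts_at (atlas X) (param \<kappa> z)"
    using assms param_in_dom [OF assms(1,3)] by (simp add: charts_at_def)
  note lin = linear_differential_a_periods [OF at]
  have scale: "herm p (r *\<^sub>R v) w = complex_of_real r * herm p v w"
    "herm p v (r *\<^sub>R w) = complex_of_real r * herm p v w" for p r v w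
    unfolding of_real_vector_scalar_mult [symmetric] by (simp_all add: herm_simps)
  show "linear (\<lambda>x. sk_metric X \<kappa> z x u)"
    unfolding sk_metric_eq
    by (rule linearI) (simp_all add: linear_add [OF lin] linear_scale [OF lin] herm_simps scale)
  show "linear (sk_metric X \<kappa> z x)"
    unfolding sk_metric_eq [abs_def]
    by (rule linearI) (simp_all add: linear_add [OF lin] linear_scale [OF lin] herm_simps scale)
  assume "x \<noteq> 0"
  then have "differential \<kappa> (a_periods X) (param \<kappa> z) x \<noteq> 0"
    using differential_a_periods_bij [OF at] linear_0 [OF lin] by (metis bij_is_inj injD)
  then show "0 < sk_metric X \<kappa> z x x"
    unfolding sk_metric_eq by (rule herm_positive)
qed

text \<open>Away from special coordinates the metric also contains first derivatives of the periods;
  these are holomorphic again, so differentiable.\<close>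

lemma sk_metric_differentiable:
  assumes \<kappa>: "\<kappa> \<in> charts (atlas X)" and z: "z \<in> coords \<kappa> ` chart_dom \<kappa>"
  shows "(\<lambda>y. sk_metric X \<kappa> y w u) differentiable (at z)"
proof -
  note isc = charts_is_chart [OF \<kappa>]
  let ?O = "coords \<kappa> ` chart_dom \<kappa>"
  let ?A = "\<lambda>w i y. frechet_derivative (\<lambda>z. (a_periods X \<circ> param \<kappa>) z $ i) (at y) w"
  note hol_a = a_periods_holomorphic [OF \<kappa>]
  have A: "differential \<kappa> (a_periods X) (param \<kappa> y) w $ i = ?A w i y" if "y \<in> ?O" for y w i
  proof -
    have "a_periods X \<circ> param \<kappa> differentiable (at y)"
      using holomorphic_map_derivative(1) [OF hol_a that] by (auto simp: differentiable_def)
    from frechet_derivative_vec_nth [OF this] show ?thesis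
      by (simp add: differential_def coords_param [OF isc that])
  qed
  have dA: "?A w i differentiable (at z)" for w i
    using scalar_holomorphic_on_derivative(1) [OF scalar_holomorphic_on_directional_derivative
        [OF holomorphic_map_vec_nth [OF hol_a]] z] by (auto simp: differentiable_def)
  have dA': "(\<lambda>y. cnj (?A w i y)) differentiable (at z)" for w i
    using dA bounded_linear.has_derivative [OF bounded_linear_cnj] unfolding differentiable_def by blast
  have dT: "(\<lambda>y. complex_of_real (Im (period_map X (param \<kappa> y) $ i $ j))) differentiable (at z)" for i j
  proof -
    have "(\<lambda>p. period_map X p $ i $ j) \<circ> param \<kappa> differentiable (at z)"
      using scalar_holomorphic_on_derivative(1) [OF holo_chart [OF holo_period_map \<kappa>] z]
      by (auto simp: differentiable_def)
    then show ?thesis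
      using bounded_linear.has_derivative [OF bounded_linear_compose [OF bounded_linear_of_real bounded_linear_Im]]
      unfolding differentiable_def o_def by blast
  qed
  have "(\<lambda>y. \<Sum>i\<in>UNIV. \<Sum>j\<in>UNIV. complex_of_real (Im (period_map X (param \<kappa> y) $ i $ j)) * ?A w i y
      * cnj (?A u j y)) differentiable (at z)"
    by (intro differentiable_sum finite differentiable_mult dA dA' dT ballI)
  then obtain D where "((\<lambda>y. \<Sum>i\<in>UNIV. \<Sum>j\<in>UNIV. complex_of_real (Im (period_map X (param \<kappa> y) $ i $ j))
      * ?A w i y * cnj (?A u j y)) has_derivative D) (at z)"
    unfolding differentiable_def by blast
  from bounded_linear.has_derivative [OF bounded_linear_Re this]
  have "((\<lambda>y. sk_metric X \<kappa> y w u) has_derivative (\<lambda>h. Re (D h))) (at z)"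
    by (rule has_derivative_transform_within_open [OF _ is_chart_open(2) [OF isc] z])
      (simp add: sk_metric_def Let_def A)
  then show ?thesis by (auto simp: differentiable_def)
qed

lemma christoffel_UNIV_koszul:
  assumes \<kappa>: "\<kappa> \<in> charts (atlas X)" and z: "z \<in> coords \<kappa> ` chart_dom \<kappa>"
  shows "sk_metric X \<kappa> z (christoffel UNIV (sk_metric X \<kappa>) z v w) u =
      (frechet_derivative (\<lambda>y. sk_metric X \<kappa> y w u) (at z) v
     + frechet_derivative (\<lambda>y. sk_metric X \<kappa> y v u) (at z) w
     - frechet_derivative (\<lambda>y. sk_metric X \<kappa> y v w) (at z) u) / 2"
proof -
  let ?G = "sk_metric X \<kappa>"
  note isc = charts_is_chart [OF \<kappa>]
  note G = sk_metric_simps [OF isc \<kappa>]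
  have der: "((\<lambda>y. ?G y a b) has_derivative frechet_derivative (\<lambda>y. ?G y a b) (at z)) (at z)" for a b
    using sk_metric_differentiable [OF \<kappa> z] frechet_derivative_works by blast
  have lin: "linear (\<lambda>u. frechet_derivative (\<lambda>y. ?G y a u) (at z) h)" for a h
  proof (rule linearI)
    fix b c :: "complex^'r" and r :: real
    have "((\<lambda>y. ?G y a (b + c)) has_derivative (\<lambda>h. frechet_derivative (\<lambda>y. ?G y a b) (at z) h
        + frechet_derivative (\<lambda>y. ?G y a c) (at z) h)) (at z)"
      by (rule has_derivative_transform_within_open [OF has_derivative_add [OF der der] is_chart_open(2) [OF isc] z])
        (simp add: linear_add [OF G(2)])
    from fun_cong [OF frechet_derivative_at [OF this], of h]
    show "frechet_derivative (\<lambda>y. ?G y a (b + c)) (at z) h =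
        frechet_derivative (\<lambda>y. ?G y a b) (at z) h + frechet_derivative (\<lambda>y. ?G y a c) (at z) h" by simp
    have "((\<lambda>y. ?G y a (r *\<^sub>R b)) has_derivative (\<lambda>h. r *\<^sub>R frechet_derivative (\<lambda>y. ?G y a b) (at z) h)) (at z)"
      by (rule has_derivative_transform_within_open [OF has_derivative_scaleR_right [OF der] is_chart_open(2) [OF isc] z])
        (simp add: linear_scale [OF G(2)])
    from fun_cong [OF frechet_derivative_at [OF this], of h]
    show "frechet_derivative (\<lambda>y. ?G y a (r *\<^sub>R b)) (at z) h =
        r *\<^sub>R frechet_derivative (\<lambda>y. ?G y a b) (at z) h" by simp
  qed
  let ?K = "\<lambda>u. (frechet_derivative (\<lambda>y. ?G y w u) (at z) v
     + frechet_derivative (\<lambda>y. ?G y v u) (at z) w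
     - frechet_derivative (\<lambda>y. ?G y v w) (at z) u) / 2"
  note lin' = has_derivative_linear [OF der]
  have K: "linear ?K"
    by (rule linearI) (simp_all add: linear_add [OF lin] linear_scale [OF lin] linear_add [OF lin']
        linear_scale [OF lin'] algebra_simps add_divide_distrib diff_divide_distrib)
  have "\<exists>x. \<forall>u. ?G z x u = ?K u"
  proof (rule riesz_representation [where B = "?G z" and K = ?K])
    show "linear (\<lambda>x. ?G z x u)" for u by (rule G(1) [OF z])
    show "linear (?G z x)" for x by (rule G(2) [OF z])
    show "0 < ?G z x x" if "x \<noteq> 0" for x by (rule G(3) [OF z that])
  qed (rule K)
  then obtain x where x: "\<And>u. ?G z x u = ?K u" by blast
  have "christoffel UNIV ?G z v w = x"
    unfolding christoffel_def
  proof (rule the_equality)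
    fix y assume y: "y \<in> UNIV \<and> (\<forall>u\<in>UNIV. ?G z y u = ?K u)"
    have "?G z y (y - x) = ?G z x (y - x)"
      by (rule trans [OF bspec [OF conjunct2 [OF y] UNIV_I] x [symmetric]])
    then have "?G z (y - x) (y - x) = 0"
      by (simp add: linear_diff [OF G(1) [OF z]])
    then show "y = x" using G(3) [OF z, of "y - x"] by auto
  qed (simp add: x)
  then show ?thesis by (simp add: x)
qed

end

context complete_geodesic_of_special_kaehler
begin

text \<open>In the chart the curve stays in \<open>W\<close>, hence so do its velocity and
  acceleration. The ambient Christoffel vector is minus the acceleration, so it lies in
  \<open>W\<close> and solves the Koszul equations for all \<open>u\<close>, in particular for
  \<open>u\<close> in \<open>W\<close>; uniqueness identifies it with the Christoffel vector of the
  submanifold.\<close>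

lemma geodesic_of_slice:
  assumes S: "range \<gamma> \<subseteq> S" and slice: "slice_chart (atlas X) S \<kappa> W" and t: "\<gamma> t \<in> chart_dom \<kappa>"
  shows "unit_speed_geodesic_at W (sk_metric X \<kappa>) (coords \<kappa> \<circ> \<gamma>) t"
proof -
  let ?c = "coords \<kappa> \<circ> \<gamma>" and ?G = "sk_metric X \<kappa>"
  let ?c' = "\<lambda>s. vector_derivative ?c (at s)"
  have \<kappa>: "\<kappa> \<in> charts (atlas X)" and W: "vec.subspace W"
    and cW: "coords \<kappa> ` (chart_dom \<kappa> \<inter> S) = coords \<kappa> ` chart_dom \<kappa> \<inter> W"
    using slice by (auto simp: slice_chart_def)
  note isc = charts_is_chart [OF \<kappa>]
  let ?T = "\<gamma> -` chart_dom \<kappa>"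
  have T: "open ?T" "t \<in> ?T"
    using open_geodesic_preimage [OF is_chart_open(1) [OF isc]] t by auto
  have geo: "unit_speed_geodesic_at UNIV ?G ?c s" if "s \<in> ?T" for s
  proof -
    have "\<kappa> \<in> charts_at (atlas X) (\<gamma> s)" using \<kappa> that by (simp add: charts_at_def)
    then show ?thesis using complete_geodesic unfolding complete_geodesic_def by blast
  qed
  have sub: "subspace W"
    unfolding subspace_def
  proof (intro conjI ballI allI)
    show "0 \<in> W" by (rule vec.subspace_0 [OF W])
    show "x + y \<in> W" if "x \<in> W" "y \<in> W" for x y by (rule vec.subspace_add [OF W that])
    show "r *\<^sub>R x \<in> W" if "x \<in> W" for r x
      using vec.subspace_scale [OF W that, of "complex_of_real r"] by (simp add: of_real_vector_scalar_mult)
  qed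
  have c_in: "?c s \<in> W" if "s \<in> ?T" for s
  proof -
    have "?c s \<in> coords \<kappa> ` (chart_dom \<kappa> \<inter> S)" using that S by auto
    then show ?thesis unfolding cW by simp
  qed
  have c'_in: "?c' s \<in> W" if "s \<in> ?T" for s
  proof (rule derivative_in_subspace [OF sub _ T(1) that c_in])
    show "(?c has_vector_derivative ?c' s) (at s)"
      using geo [OF that] by (simp add: unit_speed_geodesic_at_def Let_def vector_derivative_works)
  qed
  let ?x = "christoffel UNIV ?G (?c t) (?c' t) (?c' t)"
  have c'': "(?c' has_vector_derivative - ?x) (at t)"
    using geo [OF T(2)] by (simp add: unit_speed_geodesic_at_def Let_def)
  have "- ?x \<in> W"
    by (rule derivative_in_subspace [OF sub c'' T c'_in])
  then have x: "?x \<in> W" using subspace_neg [OF sub] by fastforce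
  have z: "?c t \<in> coords \<kappa> ` chart_dom \<kappa>" using t by simp
  note G = sk_metric_simps [OF isc \<kappa> z]
  have "christoffel W ?G (?c t) (?c' t) (?c' t) = ?x"
    unfolding christoffel_def [of W]
  proof (rule the_equality)
    fix y
    assume y: "y \<in> W \<and> (\<forall>u\<in>W. ?G (?c t) y u =
      (frechet_derivative (\<lambda>y. ?G y (?c' t) u) (at (?c t)) (?c' t)
     + frechet_derivative (\<lambda>y. ?G y (?c' t) u) (at (?c t)) (?c' t)
     - frechet_derivative (\<lambda>y. ?G y (?c' t) (?c' t)) (at (?c t)) u) / 2)"
    have "y - ?x \<in> W" using y x subspace_diff [OF sub] by blast
    then have "?G (?c t) (y - ?x) (y - ?x) = 0"
      using y by (simp only: linear_diff [OF G(1)] christoffel_UNIV_koszul [OF \<kappa> z] diff_self)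
    then show "y = ?x" using G(3) [of "y - ?x"] by auto
  qed (use x in \<open>simp only: christoffel_UNIV_koszul [OF \<kappa> z] simp_thms ball_triv\<close>)
  with geo [OF T(2)] show ?thesis
    by (simp add: unit_speed_geodesic_at_def Let_def)
qed

end

theorem proposition5:
  fixes X :: "('x::{t2_space,second_countable_topology}, 'r::finite) special_kaehler_data"
    and \<gamma> :: "real \<Rightarrow> 'x"
  assumes "special_kaehler X"
    and "simply_connected (UNIV :: 'x set)"
    and "complete_geodesic X \<gamma>"
    and "stable_geodesic X \<gamma>"
  shows "\<exists>\<tau>\<in>siegel. range \<gamma> \<subseteq> tau_fiber X \<tau> \<and>
    (complex_submanifold (atlas X) (tau_fiber X \<tau>) \<longrightarrow>
      complete_geodesic_of_submanifold X (tau_fiber X \<tau>) \<gamma>)"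
proof -
  interpret complete_geodesic_of_special_kaehler X \<gamma>
    by unfold_locales (use assms in auto)
  define T where "T = period_map X (\<gamma> 0)"
  have fiber: "range \<gamma> \<subseteq> tau_fiber X T"
    using stable_period_map_constant [OF assms(4)] by (auto simp: tau_fiber_def T_def)
  have "complete_geodesic_of_submanifold X (tau_fiber X T) \<gamma>"
    unfolding complete_geodesic_of_submanifold_def
    using complete_geodesic fiber geodesic_of_slice [OF fiber] by (simp add: complete_geodesic_def)
  then show ?thesis
    using fiber period_map_siegel [of "\<gamma> 0"] by (auto simp: T_def)
qed

end
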